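(* Let $K$ be a multi-quadratic number field. The following are equivalent: (1) There exists an elliptic curve over $K$ whose Mordell-Weil group $E(K)$ contains a subgroup isomorphic to $\mathbb{Z}/2 \times \mathbb{Z}/12$. (2) There exist infinitely many such elliptic curves (up to $K$-isomorphism). (3) $\operatorname{rank} J_1(2,12)(K) \ge 1$.
   Context: A multi-quadratic number field is a number field (including $\mathbb{Q}$ itself) which is a compositum of quadratic number fields. For positive integers $M,N$, $X_1(M,MN)$ is the modular curve (coarse moduli space) attached to the level structure $\Gamma_1(M,MN) = \{\begin{pmatrix}1&b\\0&d\end{pmatrix} \in \mathrm{GL}_2(\mathbb{Z}/MN) : b \equiv 0,\ d\equiv 1 \bmod M\}$; it is defined over $\mathbb{Q}(\zeta_M)$ and its non-cuspidal points correspond to elliptic curves equipped with a level structure of type $\mathbb{Z}/M\times\mathbb{Z}/MN$. $J_1(M,MN)$ denotes its Jacobian. Here $X_1(2,12)$ is defined over $\mathbb{Q}$ and has genus one (Cremona label 24a4). $\operatorname{rank}$ is the rank of the group of $K$-rational points. Elliptic curves over $K$ are counted up to $K$-isomorphism. *)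

theory Defs
  imports
    "HOL-Algebra.Elementary_Groups"
    "HOL-Algebra.FiniteProduct"
    "HOL-Library.Extended_Nat"
    "HOL-Analysis.Continuum_Not_Denumerable"
    "HOL-Computational_Algebra.Polynomial"
begin

section \<open>Multi-quadratic number fields\<close>

definition is_subfield :: "'a::field set \<Rightarrow> bool" where
  "is_subfield F \<longleftrightarrow> 0 \<in> F \<and> 1 \<in> F \<and>
     (\<forall>x\<in>F. \<forall>y\<in>F. x + y \<in> F \<and> x * y \<in> F) \<and> (\<forall>x\<in>F. - x \<in> F \<and> inverse x \<in> F)"

abbreviation rat_scale :: "rat \<Rightarrow> 'a::field_char_0 \<Rightarrow> 'a" where
  "rat_scale q x \<equiv> of_rat q * x"

lemma vector_space_rat_scale: "vector_space (rat_scale :: rat \<Rightarrow> 'a::field_char_0 \<Rightarrow> 'a)"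
  by unfold_locales (simp_all add: algebra_simps of_rat_add of_rat_mult)

definition number_field :: "'k::field_char_0 itself \<Rightarrow> bool" where
  "number_field _ \<longleftrightarrow> (\<exists>B::'k set. finite B \<and> module.span rat_scale B = UNIV)"

definition quadratic_subfield :: "'k::field_char_0 set \<Rightarrow> bool" where
  "quadratic_subfield F \<longleftrightarrow> is_subfield F \<and> vector_space.dim rat_scale F = 2"

text \<open>The compositum of a set of subfields is the subfield generated by their union; the
  compositum of the empty set is the prime field, so the rationals are included.\<close>

definition multi_quadratic_field :: "'k::field_char_0 itself \<Rightarrow> bool" where
  "multi_quadratic_field k \<longleftrightarrow> number_field k \<and>
     (\<exists>\<F>::'k set set. (\<forall>F\<in>\<F>. quadratic_subfield F) \<and> is_subfield hull (\<Union>\<F>) = UNIV)"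


section \<open>Elliptic curves\<close>

text \<open>The curve \<open>y\<^sup>2 + a\<^sub>1xy + a\<^sub>3y = x\<^sup>3 + a\<^sub>2x\<^sup>2 + a\<^sub>4x + a\<^sub>6\<close>.\<close>

datatype 'a weierstrass = Weierstrass (a1: 'a) (a2: 'a) (a3: 'a) (a4: 'a) (a6: 'a)
  for map: map_weierstrass

context
  fixes E :: "'a::field weierstrass"
begin

definition b2 :: 'a where "b2 = (a1 E)^2 + 4 * a2 E"
definition b4 :: 'a where "b4 = 2 * a4 E + a1 E * a3 E"
definition b6 :: 'a where "b6 = (a3 E)^2 + 4 * a6 E"
definition b8 :: 'a where
  "b8 = (a1 E)^2 * a6 E + 4 * a2 E * a6 E - a1 E * a3 E * a4 E + a2 E * (a3 E)^2 - (a4 E)^2"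
definition c4 :: 'a where "c4 = b2^2 - 24 * b4"
definition c6 :: 'a where "c6 = - (b2^3) + 36 * b2 * b4 - 216 * b6"
definition discr :: 'a where
  "discr = - (b2^2) * b8 - 8 * b4^3 - 27 * b6^2 + 9 * b2 * b4 * b6"
definition j_inv :: 'a where "j_inv = c4^3 / discr"

definition elliptic_curve :: bool where "elliptic_curve \<longleftrightarrow> discr \<noteq> 0"

end

datatype 'a point = Infinity | Affine 'a 'a

fun on_curve :: "'a::field weierstrass \<Rightarrow> 'a point \<Rightarrow> bool" where
  "on_curve E Infinity \<longleftrightarrow> True"
| "on_curve E (Affine x y) \<longleftrightarrow>
     y^2 + a1 E * x * y + a3 E * y = x^3 + a2 E * x^2 + a4 E * x + a6 E"

fun ec_add :: "'a::field weierstrass \<Rightarrow> 'a point \<Rightarrow> 'a point \<Rightarrow> 'a point" where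
  "ec_add E Infinity P = P"
| "ec_add E P Infinity = P"
| "ec_add E (Affine x1 y1) (Affine x2 y2) =
     (if x1 = x2 \<and> y1 + y2 + a1 E * x2 + a3 E = 0 then Infinity
      else let l = (if x1 = x2
                    then (3 * x1^2 + 2 * a2 E * x1 + a4 E - a1 E * y1) / (2 * y1 + a1 E * x1 + a3 E)
                    else (y2 - y1) / (x2 - x1));
               x3 = l^2 + a1 E * l - a2 E - x1 - x2
           in Affine x3 (l * (x1 - x3) - y1 - a1 E * x3 - a3 E))"

definition mordell_weil :: "'a::field weierstrass \<Rightarrow> 'a point monoid" where
  "mordell_weil E = \<lparr>carrier = {P. on_curve E P}, monoid.mult = ec_add E, one = Infinity\<rparr>"

text \<open>Two Weierstrass equations over a field define isomorphic elliptic curves over that field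
  iff they are related by a substitution \<open>x = u\<^sup>2x' + r\<close>, \<open>y = u\<^sup>3y' + su\<^sup>2x' + t\<close>; the
  equations below are the resulting transformation of the coefficients.\<close>

definition ec_isom :: "('a::field weierstrass \<times> 'a weierstrass) set" where
  "ec_isom = {(E, E'). \<exists>u r s t. u \<noteq> 0 \<and>
     u * a1 E' = a1 E + 2 * s \<and>
     u^2 * a2 E' = a2 E - s * a1 E + 3 * r - s^2 \<and>
     u^3 * a3 E' = a3 E + r * a1 E + 2 * t \<and>
     u^4 * a4 E' = a4 E - s * a3 E + 2 * r * a2 E - (t + r * s) * a1 E + 3 * r^2 - 2 * s * t \<and>
     u^6 * a6 E' = a6 E + r * a4 E + r^2 * a2 E + r^3 - t * a3 E - t^2 - r * t * a1 E}"

abbreviation base_change :: "rat weierstrass \<Rightarrow> 'k::field_char_0 weierstrass" where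
  "base_change \<equiv> map_weierstrass of_rat"

definition has_subgroup_isomorphic_to :: "('a, 'b) monoid_scheme \<Rightarrow> 'c monoid \<Rightarrow> bool" where
  "has_subgroup_isomorphic_to G A \<longleftrightarrow> (\<exists>H. subgroup H G \<and> G\<lparr>carrier := H\<rparr> \<cong> A)"

definition elliptic_curves_2_12 :: "'k::field weierstrass set" where
  "elliptic_curves_2_12 = {E. elliptic_curve E \<and>
     has_subgroup_isomorphic_to (mordell_weil E) (integer_mod_group 2 \<times>\<times> integer_mod_group 12)}"


section \<open>Rank of an abelian group\<close>

definition int_independent :: "('a, 'b) monoid_scheme \<Rightarrow> 'a set \<Rightarrow> bool" where
  "int_independent G S \<longleftrightarrow> finite S \<and> S \<subseteq> carrier G \<and>
     (\<forall>c::'a \<Rightarrow> int. (\<Otimes>\<^bsub>G\<^esub>x\<in>S. x [^]\<^bsub>G\<^esub> c x) = \<one>\<^bsub>G\<^esub> \<longrightarrow> (\<forall>x\<in>S. c x = 0))"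

definition group_rank :: "('a, 'b) monoid_scheme \<Rightarrow> enat" where
  "group_rank G = Sup {enat (card S) |S. int_independent G S}"


section \<open>The Jacobian of the modular curve \<open>X\<^sub>1(2,12)\<close>\<close>

text \<open>\<open>X\<^sub>1(2,12)\<close> has genus one and a rational cusp, so it is its own Jacobian; it is the
  elliptic curve with Cremona label 24a4, \<open>y\<^sup>2 = x\<^sup>3 - x\<^sup>2 + x\<close>.  That this equation is a model of the
  modular curve is the final lemma of this theory.\<close>

definition J1_2_12 :: "rat weierstrass" where
  "J1_2_12 = Weierstrass 0 (-1) 0 1 0"

text \<open>A level structure of type \<open>\<int>/M \<times> \<int>/MN\<close>: the points \<open>Q\<close> and \<open>P\<close> are the images of the
  two standard generators under an injective homomorphism to the group of points.\<close>

definition level_structure ::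
  "nat \<Rightarrow> nat \<Rightarrow> 'a::field weierstrass \<Rightarrow> 'a point \<Rightarrow> 'a point \<Rightarrow> bool" where
  "level_structure M MN E Q P \<longleftrightarrow> P \<in> carrier (mordell_weil E) \<and> Q \<in> carrier (mordell_weil E) \<and>
     (\<forall>m n::nat. ec_add E (P [^]\<^bsub>mordell_weil E\<^esub> n) (Q [^]\<^bsub>mordell_weil E\<^esub> m) = Infinity
        \<longleftrightarrow> M dvd m \<and> MN dvd n)"

text \<open>The Weber function: for \<open>j \<noteq> 0, 1728\<close> it is the \<open>x\<close>-coordinate up to the normalisation that
  makes it invariant under isomorphisms.\<close>

fun weber :: "'a::field weierstrass \<Rightarrow> 'a point \<Rightarrow> 'a" where
  "weber E Infinity = 0"
| "weber E (Affine x y) = c4 E / c6 E * (12 * x + b2 E)"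

text \<open>The modular curve \<open>X\<^sub>1(2,12)\<close> over the rationals is the smooth projective curve whose function
  field is the field of moduli \<open>\<rat>(j(E), h(P), h(Q))\<close> of a generic elliptic curve \<open>E\<close> (one with
  transcendental \<open>j\<close>-invariant) with a level structure \<open>(Q, P)\<close> of type \<open>\<int>/2 \<times> \<int>/12\<close>, where \<open>h\<close> is
  the Weber function.  The following predicate says that this is the function field
  \<open>\<rat>(s, t)\<close> of the elliptic curve \<open>C\<close>, where \<open>(s, t)\<close> is a generic point of \<open>C\<close>.\<close>

definition models_X1_2_12 :: "rat weierstrass \<Rightarrow> bool" where
  "models_X1_2_12 C \<longleftrightarrow> elliptic_curve C \<and>
     (\<exists>(E :: complex weierstrass) P Q s t.
        elliptic_curve E \<and> \<not> algebraic (j_inv E) \<and> level_structure 2 12 E Q P \<and>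
        on_curve (base_change C) (Affine s t) \<and>
        is_subfield hull {s, t} = is_subfield hull {j_inv E, weber E P, weber E Q})"


subsection \<open>24a4 is a model of the modular curve\<close>

lemma is_subfield_hull: "is_subfield (is_subfield hull S)"
  by (rule hull_in) (unfold is_subfield_def, blast)

lemma countable_algebraic: "countable {x::complex. algebraic x}"
proof -
  have "countable (UNIV :: int poly set)"
    by (rule countableI'[of "\<lambda>p. to_nat (coeffs p)"]) (auto simp: inj_on_def coeffs_eq_iff)
  moreover have "{x::complex. algebraic x} \<subseteq>
      (\<Union>p::int poly. {x. p \<noteq> 0 \<and> poly (map_poly of_int p) x = 0})"
  proof
    fix x :: complex assume "x \<in> {x. algebraic x}"
    then obtain p :: "complex poly" where p: "\<And>i. coeff p i \<in> \<int>" "p \<noteq> 0" "poly p x = 0"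
      unfolding algebraic_def by blast
    define q :: "int poly" where "q = map_poly (\<lambda>c. THE n. of_int n = c) p"
    have "map_poly of_int q = p"
    proof (rule poly_eqI)
      fix n
      obtain k :: int where k: "coeff p n = of_int k" using p(1)[of n] by (auto elim: Ints_cases)
      have "(THE k. of_int k = (0::complex)) = (0::int)" by (rule the_equality) auto
      moreover have "(THE m. of_int m = coeff p n) = k" unfolding k by (rule the_equality) auto
      ultimately show "coeff (map_poly of_int q) n = coeff p n"
        by (simp add: q_def coeff_map_poly k)
    qed
    with p have "q \<noteq> 0 \<and> poly (map_poly of_int q) x = 0" by auto
    then show "x \<in> (\<Union>p::int poly. {x. p \<noteq> 0 \<and> poly (map_poly of_int p) x = 0})"
      by blast
  qed
  moreover have "countable {x::complex. p \<noteq> 0 \<and> poly (map_poly of_int p) x = 0}" for p :: "int poly"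
  proof (cases "p = 0")
    case False
    then have "map_poly of_int p \<noteq> (0::complex poly)" by (auto simp: poly_eq_iff coeff_map_poly)
    then show ?thesis by (auto intro!: countable_finite poly_roots_finite)
  qed auto
  ultimately show ?thesis
    by (meson countable_UN countable_subset)
qed

text \<open>Kubert's parametrisation of elliptic curves with a point of order 12, which is \<open>(0, 0)\<close>;
  the model is scaled so that its coefficients are polynomials in the parameter.\<close>

context
  fixes \<tau> :: "'a::field_char_0"
begin

private abbreviation (input) "m2 \<equiv> 2 * \<tau>^2 - 2 * \<tau> + 1"
private abbreviation (input) "m3 \<equiv> 3 * \<tau>^2 - 3 * \<tau> + 1"
private abbreviation (input) "ht \<equiv> 2 * \<tau> - 1"
private abbreviation (input) "al \<equiv> \<tau> - 1"

definition kubert_curve :: "'a weierstrass" where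
  "kubert_curve = Weierstrass (- (al^3) - \<tau> * ht * m3)
     (- \<tau> * ht * al^2 * m2 * m3) (\<tau> * ht * al^5 * m2 * m3) 0 0"

private abbreviation "KM \<equiv> mordell_weil kubert_curve"

lemma kubert_add:
  assumes "x \<noteq> 0" "l * x = y" "x' = l^2 + a1 kubert_curve * l - a2 kubert_curve - x"
    "y' = - l * x' - a1 kubert_curve * x' - a3 kubert_curve"
  shows "ec_add kubert_curve (Affine x y) (Affine 0 0) = Affine x' y'"
proof -
  have "(0 - y) / (0 - x) = l" using assms(1,2) by (simp add: field_simps)
  moreover have "l * (x - x') - y = - l * x'" using assms(2) by (simp add: algebra_simps)
  ultimately have "ec_add kubert_curve (Affine x y) (Affine 0 0) =
      Affine (l^2 + a1 kubert_curve * l - a2 kubert_curve - x)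
        (l * (x - (l^2 + a1 kubert_curve * l - a2 kubert_curve - x)) - y
          - a1 kubert_curve * (l^2 + a1 kubert_curve * l - a2 kubert_curve - x) - a3 kubert_curve)"
    using assms(1) by (simp only: ec_add.simps Let_def) simp
  also have "\<dots> = Affine x' (l * (x - x') - y - a1 kubert_curve * x' - a3 kubert_curve)"
    unfolding assms(3) by simp
  also have "\<dots> = Affine x' y'"
    using \<open>l * (x - x') - y = - l * x'\<close> assms(4) by simp
  finally show ?thesis .
qed

lemma kubert_multiples:
  assumes nz: "\<tau> \<noteq> 0" "al \<noteq> 0" "ht \<noteq> 0" "m2 \<noteq> 0" "m3 \<noteq> 0"
  defines "P \<equiv> Affine 0 0"
  shows "P [^]\<^bsub>KM\<^esub> (0::nat) = Infinity"
    "P [^]\<^bsub>KM\<^esub> (1::nat) = Affine 0 0"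
    "P [^]\<^bsub>KM\<^esub> (2::nat) = Affine (\<tau> * al^2 * ht * m3 * m2) (\<tau>^2 * al^2 * ht^2 * m3^2 * m2)"
    "P [^]\<^bsub>KM\<^esub> (3::nat) = Affine (- \<tau> * al^3 * ht * m3) (- (\<tau>^2) * al^5 * ht^2 * m3)"
    "P [^]\<^bsub>KM\<^esub> (4::nat) = Affine (\<tau> * al^4 * ht * m2) (\<tau>^2 * al^4 * ht^2 * m2^2)"
    "P [^]\<^bsub>KM\<^esub> (5::nat) = Affine (- \<tau> * al * ht * m3 * m2) (- (\<tau>^2) * al^2 * ht * m3^2 * m2)"
    "P [^]\<^bsub>KM\<^esub> (6::nat) = Affine (\<tau> * al^5 * m3) (\<tau>^2 * al^6 * m3^2)"
    "P [^]\<^bsub>KM\<^esub> (7::nat) = Affine (- \<tau> * al * ht * m3 * m2) (- (\<tau>^2) * al * ht^2 * m3 * m2^2)"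
    "P [^]\<^bsub>KM\<^esub> (8::nat) = Affine (\<tau> * al^4 * ht * m2) (\<tau>^2 * al^6 * ht^2 * m2)"
    "P [^]\<^bsub>KM\<^esub> (9::nat) = Affine (- \<tau> * al^3 * ht * m3) (- (\<tau>^2) * al^3 * ht^2 * m3^2)"
    "P [^]\<^bsub>KM\<^esub> (10::nat) = Affine (\<tau> * al^2 * ht * m3 * m2) 0"
    "P [^]\<^bsub>KM\<^esub> (11::nat) = Affine 0 (- \<tau> * al^5 * ht * m3 * m2)"
    "P [^]\<^bsub>KM\<^esub> (12::nat) = Infinity"
proof -
  note ks = kubert_curve_def weierstrass.sel
  have S: "P [^]\<^bsub>KM\<^esub> Suc n = ec_add kubert_curve (P [^]\<^bsub>KM\<^esub> n) P" for n
    by (simp add: mordell_weil_def nat_pow_def)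
  show 0: "P [^]\<^bsub>KM\<^esub> (0::nat) = Infinity"
    by (simp add: mordell_weil_def nat_pow_def)
  show 1: "P [^]\<^bsub>KM\<^esub> (1::nat) = Affine 0 0"
    using S[of 0] 0 by (simp add: P_def)
  show 2: "P [^]\<^bsub>KM\<^esub> (2::nat) = Affine (\<tau> * al^2 * ht * m3 * m2) (\<tau>^2 * al^2 * ht^2 * m3^2 * m2)"
  proof -
    have nz3: "a3 kubert_curve \<noteq> 0" using nz by (simp add: ks)
    have "P [^]\<^bsub>KM\<^esub> (2::nat) = ec_add kubert_curve (Affine 0 0) (Affine 0 0)"
      using S[of 1] unfolding 1 by (simp add: P_def numeral_2_eq_2)
    also have "\<dots> = Affine (- a2 kubert_curve) (a1 kubert_curve * a2 kubert_curve - a3 kubert_curve)"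
      using nz3 by (simp add: Let_def) (simp add: ks)
    also have "\<dots> = Affine (\<tau> * al^2 * ht * m3 * m2) (\<tau>^2 * al^2 * ht^2 * m3^2 * m2)"
      by (unfold point.inject, rule conjI; unfold ks, algebra)
    finally show ?thesis .
  qed
  show 3: "P [^]\<^bsub>KM\<^esub> (3::nat) = Affine (- \<tau> * al^3 * ht * m3) (- (\<tau>^2) * al^5 * ht^2 * m3)"
  proof -
    have "P [^]\<^bsub>KM\<^esub> (3::nat) = ec_add kubert_curve (P [^]\<^bsub>KM\<^esub> (2::nat)) (Affine 0 0)"
      using S[of 2] by (simp add: P_def)
    also have "\<dots> = Affine (- \<tau> * al^3 * ht * m3) (- (\<tau>^2) * al^5 * ht^2 * m3)"
      unfolding 2 apply (rule kubert_add[where l = "\<tau> * ht * m3"]) using nz apply simp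
      by (unfold ks, algebra+)
    finally show ?thesis .
  qed
  show 4: "P [^]\<^bsub>KM\<^esub> (4::nat) = Affine (\<tau> * al^4 * ht * m2) (\<tau>^2 * al^4 * ht^2 * m2^2)"
  proof -
    have "P [^]\<^bsub>KM\<^esub> (4::nat) = ec_add kubert_curve (P [^]\<^bsub>KM\<^esub> (3::nat)) (Affine 0 0)"
      using S[of 3] by (simp add: P_def)
    also have "\<dots> = Affine (\<tau> * al^4 * ht * m2) (\<tau>^2 * al^4 * ht^2 * m2^2)"
      unfolding 3 apply (rule kubert_add[where l = "\<tau> * al^2 * ht"]) using nz apply simp
      by (unfold ks, algebra+)
    finally show ?thesis .
  qed
  show 5: "P [^]\<^bsub>KM\<^esub> (5::nat) = Affine (- \<tau> * al * ht * m3 * m2) (- (\<tau>^2) * al^2 * ht * m3^2 * m2)"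
  proof -
    have "P [^]\<^bsub>KM\<^esub> (5::nat) = ec_add kubert_curve (P [^]\<^bsub>KM\<^esub> (4::nat)) (Affine 0 0)"
      using S[of 4] by (simp add: P_def)
    also have "\<dots> = Affine (- \<tau> * al * ht * m3 * m2) (- (\<tau>^2) * al^2 * ht * m3^2 * m2)"
      unfolding 4 apply (rule kubert_add[where l = "\<tau> * ht * m2"]) using nz apply simp
      by (unfold ks, algebra+)
    finally show ?thesis .
  qed
  show 6: "P [^]\<^bsub>KM\<^esub> (6::nat) = Affine (\<tau> * al^5 * m3) (\<tau>^2 * al^6 * m3^2)"
  proof -
    have "P [^]\<^bsub>KM\<^esub> (6::nat) = ec_add kubert_curve (P [^]\<^bsub>KM\<^esub> (5::nat)) (Affine 0 0)"
      using S[of 5] by (simp add: P_def)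
    also have "\<dots> = Affine (\<tau> * al^5 * m3) (\<tau>^2 * al^6 * m3^2)"
      unfolding 5 apply (rule kubert_add[where l = "\<tau> * al * m3"]) using nz apply simp
      by (unfold ks, algebra+)
    finally show ?thesis .
  qed
  show 7: "P [^]\<^bsub>KM\<^esub> (7::nat) = Affine (- \<tau> * al * ht * m3 * m2) (- (\<tau>^2) * al * ht^2 * m3 * m2^2)"
  proof -
    have "P [^]\<^bsub>KM\<^esub> (7::nat) = ec_add kubert_curve (P [^]\<^bsub>KM\<^esub> (6::nat)) (Affine 0 0)"
      using S[of 6] by (simp add: P_def)
    also have "\<dots> = Affine (- \<tau> * al * ht * m3 * m2) (- (\<tau>^2) * al * ht^2 * m3 * m2^2)"
      unfolding 6 apply (rule kubert_add[where l = "\<tau> * al * m3"]) using nz apply simp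
      by (unfold ks, algebra+)
    finally show ?thesis .
  qed
  show 8: "P [^]\<^bsub>KM\<^esub> (8::nat) = Affine (\<tau> * al^4 * ht * m2) (\<tau>^2 * al^6 * ht^2 * m2)"
  proof -
    have "P [^]\<^bsub>KM\<^esub> (8::nat) = ec_add kubert_curve (P [^]\<^bsub>KM\<^esub> (7::nat)) (Affine 0 0)"
      using S[of 7] by (simp add: P_def)
    also have "\<dots> = Affine (\<tau> * al^4 * ht * m2) (\<tau>^2 * al^6 * ht^2 * m2)"
      unfolding 7 apply (rule kubert_add[where l = "\<tau> * ht * m2"]) using nz apply simp
      by (unfold ks, algebra+)
    finally show ?thesis .
  qed
  show 9: "P [^]\<^bsub>KM\<^esub> (9::nat) = Affine (- \<tau> * al^3 * ht * m3) (- (\<tau>^2) * al^3 * ht^2 * m3^2)"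
  proof -
    have "P [^]\<^bsub>KM\<^esub> (9::nat) = ec_add kubert_curve (P [^]\<^bsub>KM\<^esub> (8::nat)) (Affine 0 0)"
      using S[of 8] by (simp add: P_def)
    also have "\<dots> = Affine (- \<tau> * al^3 * ht * m3) (- (\<tau>^2) * al^3 * ht^2 * m3^2)"
      unfolding 8 apply (rule kubert_add[where l = "\<tau> * al^2 * ht"]) using nz apply simp
      by (unfold ks, algebra+)
    finally show ?thesis .
  qed
  show 10: "P [^]\<^bsub>KM\<^esub> (10::nat) = Affine (\<tau> * al^2 * ht * m3 * m2) 0"
  proof -
    have "P [^]\<^bsub>KM\<^esub> (10::nat) = ec_add kubert_curve (P [^]\<^bsub>KM\<^esub> (9::nat)) (Affine 0 0)"
      using S[of 9] by (simp add: P_def)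
    also have "\<dots> = Affine (\<tau> * al^2 * ht * m3 * m2) 0"
      unfolding 9 apply (rule kubert_add[where l = "\<tau> * ht * m3"]) using nz apply simp
      by (unfold ks, algebra+)
    finally show ?thesis .
  qed
  show 11: "P [^]\<^bsub>KM\<^esub> (11::nat) = Affine 0 (- \<tau> * al^5 * ht * m3 * m2)"
  proof -
    have "P [^]\<^bsub>KM\<^esub> (11::nat) = ec_add kubert_curve (P [^]\<^bsub>KM\<^esub> (10::nat)) (Affine 0 0)"
      using S[of 10] by (simp add: P_def)
    also have "\<dots> = Affine 0 (- \<tau> * al^5 * ht * m3 * m2)"
      unfolding 10 apply (rule kubert_add[where l = 0]) using nz apply simp
      by (unfold ks, simp_all)
    finally show ?thesis .
  qed
  show "P [^]\<^bsub>KM\<^esub> (12::nat) = Infinity"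
  proof -
    have "P [^]\<^bsub>KM\<^esub> (12::nat) = ec_add kubert_curve (P [^]\<^bsub>KM\<^esub> (11::nat)) (Affine 0 0)"
      using S[of 11] by (simp add: P_def)
    also have "\<dots> = Infinity"
      unfolding 11 by (simp add: ks)
    finally show ?thesis .
  qed
qed

end

lemma kubert_factor:
  fixes \<tau> :: "'a::field_char_0" and x
  defines "E \<equiv> kubert_curve \<tau>"
  shows "4 * x^3 + b2 E * x^2 + 2 * b4 E * x + b6 E =
    (x - \<tau> * (\<tau> - 1)^5 * (3 * \<tau>^2 - 3 * \<tau> + 1)) *
    (4 * x^2 + (12 * \<tau>^4 - 20 * \<tau>^3 + 10 * \<tau>^2 - 1) * (2 * \<tau> - 1) * (2 * \<tau>^2 - 2 * \<tau> + 1) * x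
      - \<tau> * (\<tau> - 1)^5 * (2 * \<tau> - 1)^2 * (3 * \<tau>^2 - 3 * \<tau> + 1) * (2 * \<tau>^2 - 2 * \<tau> + 1)^2)"
  unfolding E_def kubert_curve_def b2_def b4_def b6_def weierstrass.sel by algebra

lemma on_curve_two_torsion:
  fixes E :: "'a::field_char_0 weierstrass"
  assumes "2 * y + a1 E * x + a3 E = 0" "4 * x^3 + b2 E * x^2 + 2 * b4 E * x + b6 E = 0"
  shows "on_curve E (Affine x y)"
proof -
  have "4 * (y^2 + a1 E * x * y + a3 E * y - (x^3 + a2 E * x^2 + a4 E * x + a6 E))
      = (2 * y + a1 E * x + a3 E)^2 - (4 * x^3 + b2 E * x^2 + 2 * b4 E * x + b6 E)"
    unfolding b2_def b4_def b6_def by algebra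
  with assms have "4 * (y^2 + a1 E * x * y + a3 E * y - (x^3 + a2 E * x^2 + a4 E * x + a6 E)) = 0"
    by (simp only:) simp
  then have "y^2 + a1 E * x * y + a3 E * y - (x^3 + a2 E * x^2 + a4 E * x + a6 E) = 0"
    unfolding mult_eq_0_iff by simp
  then show ?thesis by simp
qed

lemma kubert_level_structure:
  fixes \<tau> :: "'a::field_char_0"
  assumes nz: "\<tau> \<noteq> 0" "\<tau> - 1 \<noteq> 0" "2 * \<tau> - 1 \<noteq> 0" "2 * \<tau>^2 - 2 * \<tau> + 1 \<noteq> 0" "3 * \<tau>^2 - 3 * \<tau> + 1 \<noteq> 0"
  defines "E \<equiv> kubert_curve \<tau>"
  assumes x: "4 * x^2 + (12 * \<tau>^4 - 20 * \<tau>^3 + 10 * \<tau>^2 - 1) * (2 * \<tau> - 1) * (2 * \<tau>^2 - 2 * \<tau> + 1) * x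
      - \<tau> * (\<tau> - 1)^5 * (2 * \<tau> - 1)^2 * (3 * \<tau>^2 - 3 * \<tau> + 1) * (2 * \<tau>^2 - 2 * \<tau> + 1)^2 = 0"
    and y: "2 * y + a1 E * x + a3 E = 0"
  shows "level_structure 2 12 E (Affine x y) (Affine 0 0)"
proof -
  define P Q :: "'a point" where "P = Affine 0 0" and "Q = Affine x y"
  note mult = kubert_multiples[OF nz, folded E_def P_def]
  have onP: "on_curve E P" by (simp add: P_def E_def kubert_curve_def)
  have onQ: "on_curve E Q"
    unfolding Q_def using kubert_factor[of x \<tau>, folded E_def] x
    by (intro on_curve_two_torsion[OF y]) simp
  have x6: "x \<noteq> \<tau> * (\<tau> - 1)^5 * (3 * \<tau>^2 - 3 * \<tau> + 1)"
  proof
    assume eq: "x = \<tau> * (\<tau> - 1)^5 * (3 * \<tau>^2 - 3 * \<tau> + 1)"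
    have "4 * x^2 + (12 * \<tau>^4 - 20 * \<tau>^3 + 10 * \<tau>^2 - 1) * (2 * \<tau> - 1) * (2 * \<tau>^2 - 2 * \<tau> + 1) * x
      - \<tau> * (\<tau> - 1)^5 * (2 * \<tau> - 1)^2 * (3 * \<tau>^2 - 3 * \<tau> + 1) * (2 * \<tau>^2 - 2 * \<tau> + 1)^2
      = 4 * \<tau>^6 * (\<tau> - 1)^6 * (3 * \<tau>^2 - 3 * \<tau> + 1)^2"
      unfolding eq by algebra
    with x nz show False by simp
  qed
  have S: "R [^]\<^bsub>mordell_weil E\<^esub> Suc n = ec_add E (R [^]\<^bsub>mordell_weil E\<^esub> n) R" for R n
    by (simp add: mordell_weil_def nat_pow_def)
  have per: "P [^]\<^bsub>mordell_weil E\<^esub> (12 + n) = P [^]\<^bsub>mordell_weil E\<^esub> n" for n :: nat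
  proof (induction n)
    case 0
    then show ?case using mult(1,13) by simp
  next
    case (Suc n)
    have "P [^]\<^bsub>mordell_weil E\<^esub> (12 + Suc n) = ec_add E (P [^]\<^bsub>mordell_weil E\<^esub> (12 + n)) P"
      unfolding add_Suc_right by (rule S)
    also have "\<dots> = P [^]\<^bsub>mordell_weil E\<^esub> Suc n" unfolding Suc S ..
    finally show ?case .
  qed
  have Pmod: "P [^]\<^bsub>mordell_weil E\<^esub> n = P [^]\<^bsub>mordell_weil E\<^esub> (n mod 12)" for n :: nat
  proof (induction n rule: less_induct)
    case (less n)
    show ?case
    proof (cases "n < 12")
      case False
      then have "P [^]\<^bsub>mordell_weil E\<^esub> n = P [^]\<^bsub>mordell_weil E\<^esub> (n - 12)"
        using per[of "n - 12"] by simp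
      also have "\<dots> = P [^]\<^bsub>mordell_weil E\<^esub> ((n - 12) mod 12)"
        using False by (intro less) auto
      also have "(n - 12) mod 12 = n mod 12" using False by (simp add: le_mod_geq)
      finally show ?thesis .
    qed simp
  qed
  have QQ: "ec_add E Q Q = Infinity" using y by (simp add: Q_def algebra_simps)
  have Qpow: "Q [^]\<^bsub>mordell_weil E\<^esub> m = (if even m then Infinity else Q)" for m :: nat
  proof (induction m)
    case 0
    then show ?case by (simp add: mordell_weil_def nat_pow_def)
  next
    case (Suc m)
    then show ?case using S[of Q m] QQ by simp
  qed
  have ks: "2 * Y + a1 E * X + a3 E = 2 * Y + (- ((\<tau> - 1)^3) - \<tau> * (2 * \<tau> - 1) * (3 * \<tau>^2 - 3 * \<tau> + 1)) * X
     + \<tau> * (2 * \<tau> - 1) * (\<tau> - 1)^5 * (2 * \<tau>^2 - 2 * \<tau> + 1) * (3 * \<tau>^2 - 3 * \<tau> + 1)" for X Y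
    by (simp add: E_def kubert_curve_def)
  have PQ: "ec_add E (Affine X Y) Q \<noteq> Infinity" if "X \<noteq> x \<or> 2 * Y + a1 E * X + a3 E \<noteq> 0" for X Y
  proof
    assume "ec_add E (Affine X Y) Q = Infinity"
    then have *: "X = x" "Y + y + a1 E * x + a3 E = 0"
      by (auto simp: Q_def Let_def split: if_splits)
    have "Y - y = (Y + y + a1 E * x + a3 E) - (2 * y + a1 E * x + a3 E)" by simp
    then have "Y = y" unfolding *(2) y by simp
    with * y that show False by simp
  qed
  let ?T = "\<lambda>k::nat. (\<exists>X Y. P [^]\<^bsub>mordell_weil E\<^esub> k = Affine X Y \<and> (X \<noteq> x \<or> 2 * Y + a1 E * X + a3 E \<noteq> 0))"
  let ?h = "2 * \<tau> - 1" and ?a = "\<tau> - 1" and ?m2 = "2 * \<tau>^2 - 2 * \<tau> + 1" and ?m3 = "3 * \<tau>^2 - 3 * \<tau> + 1"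
  have T: "\<And>k U V R. P [^]\<^bsub>mordell_weil E\<^esub> k = Affine U V \<Longrightarrow> 2 * V + a1 E * U + a3 E = R \<Longrightarrow> R \<noteq> 0 \<Longrightarrow> ?T k"
    by blast
  have mult1: "P [^]\<^bsub>mordell_weil E\<^esub> (1::nat) = Affine 0 0"
    unfolding mult(2) by (rule P_def)
  have t1: "?T 1" by (rule T[OF mult1, of "\<tau> * ?a^5 * ?h * ?m3 * ?m2"]) (unfold ks, algebra, use nz in simp)
  have t2: "?T 2" by (rule T[OF mult(3), of "\<tau>^2 * ?a^2 * ?h^2 * ?m3^2 * ?m2"]) (unfold ks, algebra, use nz in simp)
  have t3: "?T 3" by (rule T[OF mult(4), of "\<tau>^3 * ?a^3 * ?h^3 * ?m3"]) (unfold ks, algebra, use nz in simp)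
  have t4: "?T 4" by (rule T[OF mult(5), of "\<tau>^4 * ?a^4 * ?h^2 * ?m2"]) (unfold ks, algebra, use nz in simp)
  have t5: "?T 5" by (rule T[OF mult(6), of "\<tau>^5 * ?a * ?h * ?m3 * ?m2"]) (unfold ks, algebra, use nz in simp)
  have t6: "?T 6" using mult(7) x6 by blast
  have t7: "?T 7" by (rule T[OF mult(8), of "- (\<tau>^5) * ?a * ?h * ?m3 * ?m2"]) (unfold ks, algebra, use nz in simp)
  have t8: "?T 8" by (rule T[OF mult(9), of "- (\<tau>^4) * ?a^4 * ?h^2 * ?m2"]) (unfold ks, algebra, use nz in simp)
  have t9: "?T 9" by (rule T[OF mult(10), of "- (\<tau>^3) * ?a^3 * ?h^3 * ?m3"]) (unfold ks, algebra, use nz in simp)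
  have t10: "?T 10" by (rule T[OF mult(11), of "- (\<tau>^2) * ?a^2 * ?h^2 * ?m3^2 * ?m2"]) (unfold ks, algebra, use nz in simp)
  have t11: "?T 11" by (rule T[OF mult(12), of "- \<tau> * ?a^5 * ?h * ?m3 * ?m2"]) (unfold ks, algebra, use nz in simp)
  have T': "?T k" if "k < 12" "k \<noteq> 0" for k :: nat
  proof -
    have "k \<in> {1,2,3,4,5,6,7,8,9,10,11}"
      unfolding insert_iff empty_iff using that by presburger
    then show ?thesis
      by (elim insertE emptyE) (erule ssubst, rule t1 t2 t3 t4 t5 t6 t7 t8 t9 t10 t11)+
  qed
  have "ec_add E (P [^]\<^bsub>mordell_weil E\<^esub> n) (Q [^]\<^bsub>mordell_weil E\<^esub> m) = Infinity \<longleftrightarrow> 2 dvd m \<and> 12 dvd n"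
    for m n :: nat
  proof (cases "n mod 12 = 0")
    case True
    then have "P [^]\<^bsub>mordell_weil E\<^esub> n = Infinity" using Pmod[of n] mult(1) by simp
    moreover have "Q \<noteq> Infinity" by (simp add: Q_def)
    ultimately show ?thesis using True by (auto simp: Qpow)
  next
    case False
    then obtain X Y where XY: "P [^]\<^bsub>mordell_weil E\<^esub> n = Affine X Y"
        "X \<noteq> x \<or> 2 * Y + a1 E * X + a3 E \<noteq> 0"
      using T'[of "n mod 12"] Pmod[of n] by auto
    with False PQ[OF XY(2)] show ?thesis by (auto simp: Qpow)
  qed
  with onP onQ show ?thesis
    unfolding level_structure_def P_def[symmetric] Q_def[symmetric] by (simp add: mordell_weil_def)
qed

text \<open>For a curve through \<open>(0, 0)\<close> with horizontal tangent there, the coefficients of its Tate normal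
  form are rational functions of the \<open>j\<close>-invariant and of the Weber function at \<open>(0, 0)\<close>.\<close>

lemma tate_invariants:
  fixes E :: "'a::field_char_0 weierstrass"
  assumes E: "a4 E = 0" "a6 E = 0" and nz: "a3 E \<noteq> 0" "c4 E \<noteq> 0" "c6 E \<noteq> 0"
  defines "x \<equiv> 3 * (c4 E / c6 E * b2 E)" and "k \<equiv> c4 E ^ 3 / c6 E ^ 2"
  defines "w \<equiv> x^3 - 27 * k * x - 54 * k" and "N \<equiv> 3 * x^2 - 27 * k"
  defines "z \<equiv> 3 * x - N^2 / (4 * w)"
  shows "- (z^3) / (4 * w) = - (a2 E ^ 3) / a3 E ^ 2" "N * z / (2 * w) = a1 E * a2 E / a3 E"
proof -
  define L where "L = c4 E / c6 E"
  have L: "L \<noteq> 0" using nz by (simp add: L_def)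
  have k1: "k = c4 E * L^2" and k2: "k = c6 E * L^3"
    using nz by (simp_all add: k_def L_def field_simps power2_eq_square power3_eq_cube)
  have "w = L^3 * (27 * b2 E ^ 3 - 81 * c4 E * b2 E - 54 * c6 E)"
    unfolding w_def x_def L_def[symmetric] using k1 k2 by algebra
  also have "\<dots> = 11664 * L^3 * a3 E ^ 2"
    unfolding c4_def c6_def b6_def E by algebra
  finally have w: "w = 11664 * L^3 * a3 E ^ 2" .
  have "N = L^2 * (27 * b2 E ^ 2 - 27 * c4 E)"
    unfolding N_def x_def L_def[symmetric] using k1 by algebra
  also have "\<dots> = 648 * L^2 * a1 E * a3 E"
    unfolding c4_def b4_def E by algebra
  finally have N: "N = 648 * L^2 * a1 E * a3 E" .
  have "N^2 / (4 * w) = 9 * L * a1 E ^ 2"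
    unfolding w N using L nz by (simp add: field_simps power2_eq_square power3_eq_cube)
  then have z: "z = 36 * L * a2 E"
    unfolding z_def x_def L_def[symmetric] b2_def by (simp add: algebra_simps)
  show "- (z^3) / (4 * w) = - (a2 E ^ 3) / a3 E ^ 2" "N * z / (2 * w) = a1 E * a2 E / a3 E"
    unfolding w N z using L nz by (simp_all add: field_simps power2_eq_square power3_eq_cube)
qed

lemma discr_relation:
  fixes E :: "'a::field_char_0 weierstrass"
  shows "c4 E ^ 3 - c6 E ^ 2 = 1728 * discr E"
proof -
  have "4 * b8 E = b2 E * b6 E - b4 E ^ 2"
    unfolding b2_def b4_def b6_def b8_def by algebra
  then show ?thesis unfolding c4_def c6_def discr_def by algebra
qed

lemma subfieldI:
  assumes "is_subfield F"
  shows "0 \<in> F" "1 \<in> F" "x \<in> F \<Longrightarrow> y \<in> F \<Longrightarrow> x + y \<in> F" "x \<in> F \<Longrightarrow> y \<in> F \<Longrightarrow> x * y \<in> F"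
    "x \<in> F \<Longrightarrow> y \<in> F \<Longrightarrow> x - y \<in> F" "x \<in> F \<Longrightarrow> y \<in> F \<Longrightarrow> x / y \<in> F"
    "x \<in> F \<Longrightarrow> - x \<in> F" "x \<in> F \<Longrightarrow> x ^ n \<in> F" "numeral m \<in> F"
proof -
  show *: "0 \<in> F" "1 \<in> F" "x \<in> F \<Longrightarrow> y \<in> F \<Longrightarrow> x + y \<in> F" "x \<in> F \<Longrightarrow> y \<in> F \<Longrightarrow> x * y \<in> F"
    "x \<in> F \<Longrightarrow> - x \<in> F" for x y
    using assms by (auto simp: is_subfield_def)
  show "x \<in> F \<Longrightarrow> y \<in> F \<Longrightarrow> x - y \<in> F"
    using *(3)[of x "- y"] *(5)[of y] by simp
  show "x \<in> F \<Longrightarrow> y \<in> F \<Longrightarrow> x / y \<in> F"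
    using *(4)[of x "inverse y"] assms by (simp add: divide_inverse is_subfield_def)
  show "x \<in> F \<Longrightarrow> x ^ n \<in> F"
    by (induction n) (auto intro: *)
  have "of_nat n \<in> F" for n
    by (induction n) (auto intro: *)
  from this[of "numeral m"] show "numeral m \<in> F" by simp
qed

definition polyfun :: "('a::comm_ring_1 \<Rightarrow> 'a) \<Rightarrow> bool" where
  "polyfun f \<longleftrightarrow> (\<exists>p. \<forall>x. f x = poly p x)"

lemma polyfun_intros:
  "polyfun (\<lambda>x. c)" "polyfun (\<lambda>x. x)"
  "polyfun f \<Longrightarrow> polyfun g \<Longrightarrow> polyfun (\<lambda>x. f x + g x)"
  "polyfun f \<Longrightarrow> polyfun g \<Longrightarrow> polyfun (\<lambda>x. f x - g x)"
  "polyfun f \<Longrightarrow> polyfun g \<Longrightarrow> polyfun (\<lambda>x. f x * g x)"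
  "polyfun f \<Longrightarrow> polyfun (\<lambda>x. - f x)" "polyfun f \<Longrightarrow> polyfun (\<lambda>x. f x ^ n)"
proof -
  show "polyfun (\<lambda>x. c)" unfolding polyfun_def by (rule exI[of _ "[:c:]"]) simp
  show "polyfun (\<lambda>x. x)" unfolding polyfun_def by (rule exI[of _ "[:0, 1:]"]) simp
qed (unfold polyfun_def, (metis poly_add poly_diff poly_mult poly_minus poly_power)+)

lemma polyfun_finite_roots:
  fixes f :: "'a::idom \<Rightarrow> 'a"
  assumes "polyfun f" "f a \<noteq> 0"
  shows "finite {x. f x = 0}"
  using assms unfolding polyfun_def by (metis (no_types, lifting) poly_0 poly_roots_finite Collect_cong)

lemmas kubert_unfold = kubert_curve_def b2_def b4_def b6_def b8_def c4_def c6_def discr_def weierstrass.sel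

lemma exists_generic:
  "\<exists>\<tau>::complex. \<not> algebraic (j_inv (kubert_curve \<tau>)) \<and> \<tau> \<noteq> 0 \<and> \<tau> - 1 \<noteq> 0 \<and> 2 * \<tau> - 1 \<noteq> 0 \<and>
     2 * \<tau>^2 - 2 * \<tau> + 1 \<noteq> 0 \<and> 3 * \<tau>^2 - 3 * \<tau> + 1 \<noteq> 0 \<and> b2 (kubert_curve \<tau>) \<noteq> 0 \<and>
     c4 (kubert_curve \<tau>) \<noteq> 0 \<and> c6 (kubert_curve \<tau>) \<noteq> 0 \<and> discr (kubert_curve \<tau>) \<noteq> 0"
proof -
  define g :: "complex \<Rightarrow> complex" where "g = (\<lambda>\<tau>. \<tau> * (\<tau> - 1) * (2 * \<tau> - 1) * (2 * \<tau>^2 - 2 * \<tau> + 1) *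
     (3 * \<tau>^2 - 3 * \<tau> + 1) * b2 (kubert_curve \<tau>) *
     c4 (kubert_curve \<tau>) * c6 (kubert_curve \<tau>) * discr (kubert_curve \<tau>))"
  define f where "f = (\<lambda>j \<tau>::complex. c4 (kubert_curve \<tau>)^3 - j * discr (kubert_curve \<tau>))"
  have "finite {\<tau>. g \<tau> = 0}"
  proof (rule polyfun_finite_roots)
    show "polyfun g" unfolding g_def kubert_unfold by (intro polyfun_intros)
    show "g 2 \<noteq> 0" unfolding g_def kubert_unfold by simp
  qed
  moreover have "finite {\<tau>. f j \<tau> = 0}" for j
  proof (rule polyfun_finite_roots)
    show "polyfun (f j)" unfolding f_def kubert_unfold by (intro polyfun_intros)
    show "f j 0 \<noteq> 0" unfolding f_def kubert_unfold by simp
  qed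
  ultimately have "countable ({\<tau>. g \<tau> = 0} \<union> (\<Union>j\<in>{x. algebraic x}. {\<tau>. f j \<tau> = 0}))"
    by (intro countable_Un countable_UN countable_algebraic) (auto intro: countable_finite)
  then obtain \<tau> where "\<tau> \<notin> {\<tau>. g \<tau> = 0} \<union> (\<Union>j\<in>{x. algebraic x}. {\<tau>. f j \<tau> = 0})"
    using uncountable_UNIV_complex by (metis UNIV_eq_I)
  then have \<tau>: "g \<tau> \<noteq> 0" "\<And>j. algebraic j \<Longrightarrow> f j \<tau> \<noteq> 0" by auto
  have "discr (kubert_curve \<tau>) \<noteq> 0" using \<tau>(1) by (simp add: g_def)
  then have "f (j_inv (kubert_curve \<tau>)) \<tau> = 0" by (simp add: f_def j_inv_def)
  with \<tau> show ?thesis by (intro exI[of _ \<tau>]) (auto simp: g_def)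
qed

lemma models_X1_2_12_J1_2_12: "models_X1_2_12 J1_2_12"
proof -
  obtain \<tau> :: complex where \<tau>: "\<not> algebraic (j_inv (kubert_curve \<tau>))"
    and nz: "\<tau> \<noteq> 0" "\<tau> - 1 \<noteq> 0" "2 * \<tau> - 1 \<noteq> 0" "2 * \<tau>^2 - 2 * \<tau> + 1 \<noteq> 0" "3 * \<tau>^2 - 3 * \<tau> + 1 \<noteq> 0"
      "b2 (kubert_curve \<tau>) \<noteq> 0" "c4 (kubert_curve \<tau>) \<noteq> 0" "c6 (kubert_curve \<tau>) \<noteq> 0" "discr (kubert_curve \<tau>) \<noteq> 0"
    using exists_generic by blast
  define E where "E = kubert_curve \<tau>"
  note nzE = nz(6-9)[folded E_def]
  define a h l2 l3 where "a = \<tau> - 1" and "h = 2 * \<tau> - 1"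
    and "l2 = 2 * \<tau>^2 - 2 * \<tau> + 1" and "l3 = 3 * \<tau>^2 - 3 * \<tau> + 1"
  note nz' = nz(1) nz(2-5)[folded a_def h_def l2_def l3_def]
  have E: "a1 E = - (a^3) - \<tau> * h * l3" "a2 E = - \<tau> * h * a^2 * l2 * l3"
      "a3 E = \<tau> * h * a^5 * l2 * l3" "a4 E = 0" "a6 E = 0"
    by (simp_all add: E_def kubert_curve_def a_def h_def l2_def l3_def)
  have a3: "a3 E \<noteq> 0" using nz' by (simp add: E)

  define W where "W = csqrt (4 * l2 * (6 * \<tau>^2 - 6 * \<tau> + 1))"
  have W: "W^2 = 4 * l2 * (6 * \<tau>^2 - 6 * \<tau> + 1)" by (simp add: W_def)
  define B where "B = (12 * \<tau>^4 - 20 * \<tau>^3 + 10 * \<tau>^2 - 1) * h * l2"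
  define x where "x = (h^3 * l2 * W / 2 - B) / 8"
  have "8 * x = h^3 * l2 * W / 2 - B"
    unfolding x_def by (subst times_divide_eq_right, subst nonzero_mult_div_cancel_left) simp_all
  then have xB: "8 * x + B = h^3 * l2 * W / 2" by simp
  define y where "y = - (a1 E * x + a3 E) / 2"
  have "16 * (4 * x^2 + B * x - \<tau> * a^5 * h^2 * l3 * l2^2) = (8 * x + B)^2 - (B^2 + 16 * \<tau> * a^5 * h^2 * l3 * l2^2)"
    by algebra
  also have "(8 * x + B)^2 = h^6 * l2^2 * W^2 / 4"
    unfolding xB by (simp add: power_mult_distrib power_divide flip: power_mult)
  also have "\<dots> = h^6 * l2^3 * (6 * \<tau>^2 - 6 * \<tau> + 1)"
    unfolding W by (simp add: power3_eq_cube power2_eq_square)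
  also have "\<dots> - (B^2 + 16 * \<tau> * a^5 * h^2 * l3 * l2^2) = 0"
    unfolding B_def a_def h_def l2_def l3_def by algebra
  finally have x0: "4 * x^2 + B * x - \<tau> * a^5 * h^2 * l3 * l2^2 = 0"
    by (simp only: mult_eq_0_iff) simp
  have level: "level_structure 2 12 E (Affine x y) (Affine 0 0)"
    unfolding E_def
  proof (rule kubert_level_structure[OF nz(1-5)])
    show "2 * y + a1 (kubert_curve \<tau>) * x + a3 (kubert_curve \<tau>) = 0"
      unfolding y_def E_def[symmetric] by (simp add: field_simps)
  qed (use x0 in \<open>simp add: B_def a_def h_def l2_def l3_def\<close>)

  define u where "u = - 1 / (2 * \<tau>)"
  define s where "s = W * u^2 + 2 * u^2 + 4 * u + 2"
  define t where "t = 2 * u * (s - 1) + 2 * s - 1"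
  have u: "u \<noteq> 0" "2 * u * \<tau> = - 1" using nz' by (simp_all add: u_def)
  have Wu: "(W * u^2)^2 = 4 * u^4 + 16 * u^3 + 20 * u^2 + 12 * u + 3"
  proof -
    have "(W * u^2)^2 = 4 * (u^2 * l2) * (u^2 * (6 * \<tau>^2 - 6 * \<tau> + 1))"
      using W by (simp add: power_mult_distrib)
    also have "u^2 * l2 = 1 / 2 + u + u^2"
      unfolding u_def l2_def using nz' by (simp add: field_simps power2_eq_square)
    also have "u^2 * (6 * \<tau>^2 - 6 * \<tau> + 1) = 3 / 2 + 3 * u + u^2"
      unfolding u_def using nz' by (simp add: field_simps power2_eq_square)
    also have "4 * (1 / 2 + u + u^2) * (3 / 2 + 3 * u + u^2) = (1 + 2 * u + 2 * u^2) * (3 + 6 * u + 2 * u^2)"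
    proof -
      have *: "4 * p * q = (2 * p) * (2 * q)" for p q :: complex by simp
      have **: "2 * (1 / 2 + u + u^2) = 1 + 2 * u + 2 * u^2" "2 * (3 / 2 + 3 * u + u^2) = 3 + 6 * u + 2 * u^2"
        by simp_all
      show ?thesis unfolding * ** ..
    qed
    also have "\<dots> = 4 * u^4 + 16 * u^3 + 20 * u^2 + 12 * u + 3" by algebra
    finally show ?thesis .
  qed
  have st: "t^2 = s^3 - s^2 + s"
    using Wu unfolding t_def s_def by algebra
  have s1: "s - 1 \<noteq> 0"
  proof
    assume "s - 1 = 0"
    then have "W * u^2 = - (2 * u^2 + 4 * u + 1)" unfolding s_def by algebra
    with Wu have "(2 * u^2 + 4 * u + 1)^2 = 4 * u^4 + 16 * u^3 + 20 * u^2 + 12 * u + 3"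
      by (metis power2_minus)
    then have "4 * u + 2 = 0" by algebra
    then have "2 * (2 * u + 1) = 0" by simp
    then have "2 * u = - 1" by (simp only: mult_eq_0_iff) (simp add: eq_neg_iff_add_eq_0)
    with u have "\<tau> = 1" by simp
    with nz' show False by (simp add: a_def)
  qed
  have \<tau>_eq: "\<tau> = (1 - s) / (t - 2 * s + 1)"
  proof -
    have *: "t - 2 * s + 1 = 2 * u * (s - 1)" by (simp add: t_def)
    have "\<tau> * (2 * u * (s - 1)) = 1 - s" using u(2) by algebra
    moreover have "2 * u * (s - 1) \<noteq> 0" using u(1) s1 by simp
    ultimately show ?thesis unfolding * by (simp only: eq_divide_eq) simp
  qed
  have W_eq: "W = (s - 2 * u^2 - 4 * u - 2) / u^2"
    using u(1) by (simp add: s_def)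

  let ?F = "is_subfield hull {j_inv E, weber E (Affine 0 0), weber E (Affine x y)}"
  let ?G = "is_subfield hull {s, t}"
  have F: "is_subfield ?F" and G: "is_subfield ?G"
    by (simp_all add: is_subfield_hull)
  note Fi = subfieldI[OF F] and Gi = subfieldI[OF G]
  have inF: "j_inv E \<in> ?F" "weber E (Affine 0 0) \<in> ?F" "weber E (Affine x y) \<in> ?F"
    by (simp_all add: hull_inc)
  have inG: "s \<in> ?G" "t \<in> ?G" by (simp_all add: hull_inc)

  have "\<tau> \<in> ?G" unfolding \<tau>_eq by (intro Gi inG)
  then have "u \<in> ?G" unfolding u_def by (intro Gi)
  then have "W \<in> ?G" unfolding W_eq by (intro Gi inG)
  have alG: "a \<in> ?G" "h \<in> ?G" "l2 \<in> ?G" "l3 \<in> ?G"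
    unfolding a_def h_def l2_def l3_def by (intro Gi \<open>\<tau> \<in> ?G\<close>)+
  have "x \<in> ?G" unfolding x_def B_def by (intro Gi \<open>\<tau> \<in> ?G\<close> \<open>W \<in> ?G\<close> alG)
  have EG: "a1 E \<in> ?G" "a2 E \<in> ?G" "a3 E \<in> ?G" "a4 E \<in> ?G" "a6 E \<in> ?G"
    unfolding E by (intro Gi \<open>\<tau> \<in> ?G\<close> alG)+
  have bbG: "b2 E \<in> ?G" "b4 E \<in> ?G" "b6 E \<in> ?G" "b8 E \<in> ?G"
    unfolding b2_def b4_def b6_def b8_def by (intro Gi EG)+
  have cG: "b2 E \<in> ?G" "c4 E \<in> ?G" "c6 E \<in> ?G" "discr E \<in> ?G"
    unfolding c4_def c6_def discr_def by (intro Gi bbG)+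
  have "{j_inv E, weber E (Affine 0 0), weber E (Affine x y)} \<subseteq> ?G"
    unfolding weber.simps j_inv_def insert_subset by (intro conjI Gi cG \<open>x \<in> ?G\<close>) auto
  then have FG: "?F \<subseteq> ?G" by (rule hull_minimal) (rule G)

  define k where "k = c4 E ^ 3 / c6 E ^ 2"
  define X where "X = 3 * (c4 E / c6 E * b2 E)"
  define w where "w = X^3 - 27 * k * X - 54 * k"
  define N where "N = 3 * X^2 - 27 * k"
  define z where "z = 3 * X - N^2 / (4 * w)"
  define b where "b = - (z^3) / (4 * w)"
  define c where "c = 1 - N * z / (2 * w)"
  have "j_inv E - 1728 = c6 E ^ 2 / discr E"
    using discr_relation[of E] nzE by (simp add: j_inv_def field_simps)
  then have k_eq: "k = j_inv E / (j_inv E - 1728)"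
    using nzE by (simp add: k_def j_inv_def)
  have kF: "k \<in> ?F" unfolding k_eq by (intro Fi inF)
  have X_eq: "X = 3 * weber E (Affine 0 0)" by (simp add: X_def)
  have XF: "X \<in> ?F" unfolding X_eq by (intro Fi inF)
  have wF: "w \<in> ?F" unfolding w_def by (intro Fi kF XF)
  have NF: "N \<in> ?F" unfolding N_def by (intro Fi kF XF)
  have zF: "z \<in> ?F" unfolding z_def by (intro Fi kF XF wF NF)
  have bF: "b \<in> ?F" unfolding b_def by (intro Fi zF wF)
  have cF: "c \<in> ?F" unfolding c_def by (intro Fi zF wF NF)
  note tate = tate_invariants[OF E(4,5) a3 nzE(2,3), folded X_def k_def, folded w_def N_def, folded z_def]
  have b: "b = \<tau> * h * l2 * l3 / a^4"
    unfolding b_def tate(1) E using nz' by (simp add: field_simps eval_nat_numeral)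
  have c: "c = - \<tau> * h * l3 / a^3"
    unfolding c_def tate(2) E using nz' by (simp add: field_simps eval_nat_numeral)
  define d where "d = b / c"
  define f where "f = c / (d - 1)"
  have d: "d = - l2 / a" unfolding d_def b c using nz' by (simp add: field_simps eval_nat_numeral)
  have d1: "d - 1 = - \<tau> * h / a"
    unfolding d using nz' by (simp add: field_simps) (simp add: a_def h_def l2_def algebra_simps power2_eq_square)
  have f: "f = l3 / a^2"
    unfolding f_def d1 c using nz' by (simp add: field_simps eval_nat_numeral)
  have f1: "1 - f = - \<tau> * h / a^2"
  proof -
    have "1 - f = (a^2 - l3) / a^2" unfolding f using nz' by (simp add: field_simps)
    also have "a^2 - l3 = - \<tau> * h" unfolding a_def h_def l3_def by algebra
    finally show ?thesis .
  qed
  have df: "d - f = - (\<tau>^2) * h / a^2"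
  proof -
    have "d - f = (- l2 * a - l3) / a^2"
      unfolding d f using nz' by (simp add: field_simps power2_eq_square)
    also have "- l2 * a - l3 = - (\<tau>^2) * h"
      unfolding a_def h_def l2_def l3_def by algebra
    finally show ?thesis .
  qed
  have \<tau>_eq': "\<tau> = (d - f) / (1 - f)"
    unfolding df f1 using nz' by (simp add: field_simps power2_eq_square)
  have dF: "d \<in> ?F" unfolding d_def by (intro Fi bF cF)
  have fF: "f \<in> ?F" unfolding f_def by (intro Fi cF dF)
  have \<tau>F: "\<tau> \<in> ?F" by (subst \<tau>_eq') (intro Fi dF fF)
  then have alF: "a \<in> ?F" "h \<in> ?F" "l2 \<in> ?F" "l3 \<in> ?F"
    unfolding a_def h_def l2_def l3_def by (intro Fi \<tau>F)+
  have EF: "a1 E \<in> ?F" "a2 E \<in> ?F" "a3 E \<in> ?F" "a4 E \<in> ?F" "a6 E \<in> ?F"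
    unfolding E by (intro Fi \<tau>F alF)+
  have bbF: "b2 E \<in> ?F" "b4 E \<in> ?F" "b6 E \<in> ?F"
    unfolding b2_def b4_def b6_def by (intro Fi EF)+
  have bcF: "b2 E \<in> ?F" "c4 E \<in> ?F" "c6 E \<in> ?F"
    unfolding c4_def c6_def by (intro Fi bbF)+
  have x_eq: "x = (weber E (Affine x y) / (c4 E / c6 E) - b2 E) / 12"
    using nzE by simp
  have xF: "x \<in> ?F" by (subst x_eq) (intro Fi inF bcF)
  have "W = (8 * x + B) * 2 / (h^3 * l2)"
    unfolding xB using nz' by simp
  also have "\<dots> \<in> ?F" unfolding B_def by (intro Fi xF \<tau>F alF)
  finally have WF: "W \<in> ?F" .
  have uF: "u \<in> ?F" unfolding u_def by (intro Fi \<tau>F)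
  have sF: "s \<in> ?F" unfolding s_def by (intro Fi WF uF)
  have tF: "t \<in> ?F" unfolding t_def by (intro Fi sF uF)
  have GF: "?G \<subseteq> ?F" using sF tF F by (intro hull_minimal) auto

  have "elliptic_curve J1_2_12"
    by (simp add: elliptic_curve_def J1_2_12_def discr_def b2_def b4_def b6_def b8_def)
  moreover have "on_curve (base_change J1_2_12) (Affine s t)"
    using st by (simp add: J1_2_12_def of_rat_minus)
  moreover have "elliptic_curve E" using nzE by (simp add: elliptic_curve_def)
  ultimately show ?thesis
    unfolding models_X1_2_12_def using \<tau> level FG GF unfolding E_def[symmetric] by blast
qed

end

theory Submission
  imports Defs
begin

text \<open>A curve with a subgroup \<open>\<int>/2 \<times> \<int>/12\<close> is put into Kubert's form with parameter \<open>\<tau>\<close>; the additional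
  point of order 2 makes \<open>4 (2\<tau>\<^sup>2 - 2\<tau> + 1) (6\<tau>\<^sup>2 - 6\<tau> + 1)\<close> a square, and the resulting quartic is birational to
  \<open>t\<^sup>2 = s\<^sup>3 - s\<^sup>2 + s\<close>, so the curve yields a point on 24a4 which is not one of the 16 cusps.  Over a
  multi-quadratic field every torsion point of 24a4 is a cusp.  Twice a point over \<open>F(\<theta>)\<close> is the sum of a
  point over \<open>F\<close> and a point of a quadratic twist over \<open>F\<close>, so by descent a point of odd order may
  be assumed to have a rational abscissa; but doubling then eventually lowers the 2-adic valuation of the abscissa
  for ever.  A half of a cusp that is not a cusp would make \<open>1/3\<close> or \<open>- 1/3\<close> a square in \<open>\<rat>\<close>, \<open>\<rat>(i)\<close> or
  \<open>\<rat>(\<surd>3)\<close>, by the norm from a quadratic extension, which disposes of points of 2-power order.  Conversely, the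
  multiples of a point of infinite order give infinitely many \<open>\<tau>\<close>, hence infinitely many \<open>j\<close>-invariants.\<close>

section \<open>The group law on an elliptic curve\<close>

text \<open>The multi-quadratic hypothesis enters through Kummer theory: if
  \<open>\<alpha>^2\<close> lies in a subfield \<open>F\<close>, then
  \<open>\<alpha>^2 = c * w^2\<close> with \<open>c\<close> rational and \<open>w\<close> in
  \<open>F\<close>. When \<open>F\<close> is quadratic over \<open>F0\<close>, the norm of
  \<open>\<alpha>^2\<close> is then the square of \<open>c\<close> times the norm of
  \<open>w\<close>, a square in \<open>F0\<close>. If \<open>(s, t)\<close> halves a point of
  abscissa \<open>X\<close>, then \<open>(s / t)^2\<close> is such an \<open>\<alpha>^2\<close>, and
  its norm is computable. In the odd part twists are unavoidable: a point plus its conjugate is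
  fixed by conjugation, but a point minus its conjugate is negated. The twisting factor remains a
  square root of a rational, so the descent ends at a point with rational abscissa and possibly
  irrational ordinate. This is enough, because
  \<open>X = (x^2 - 1)^2 / (4 * x * (x^2 - x + 1))\<close> involves the abscissa only; its factor 4
  is what lowers the valuation by 2. The cusps of 24a4 are the points over the degenerate
  parameters: \<tau> in {0, 1, 1/2, infinity} and the roots of the quadratics in \<tau> that occur
  in the multiples of P or in the quartic. A nonsingular curve therefore yields a non-cusp.\<close>

fun ec_neg :: "'a::field weierstrass \<Rightarrow> 'a point \<Rightarrow> 'a point" where
  "ec_neg E Infinity = Infinity"
| "ec_neg E (Affine x y) = Affine x (- y - a1 E * x - a3 E)"

definition ec_slope :: "'a::field weierstrass \<Rightarrow> 'a \<Rightarrow> 'a \<Rightarrow> 'a \<Rightarrow> 'a \<Rightarrow> 'a" where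
  "ec_slope E x1 y1 x2 y2 = (if x1 = x2
     then (3 * x1^2 + 2 * a2 E * x1 + a4 E - a1 E * y1) / (2 * y1 + a1 E * x1 + a3 E)
     else (y2 - y1) / (x2 - x1))"

lemma ec_add_slope:
  assumes "x1 = x2 \<Longrightarrow> y1 + y2 + a1 E * x2 + a3 E \<noteq> 0" "l = ec_slope E x1 y1 x2 y2"
    "x3 = l^2 + a1 E * l - a2 E - x1 - x2"
  shows "ec_add E (Affine x1 y1) (Affine x2 y2) = Affine x3 (l * (x1 - x3) - y1 - a1 E * x3 - a3 E)"
  unfolding assms(3) using assms(1) by (auto simp: Let_def assms(2) ec_slope_def)

lemma ec_add_Infinity [simp]: "ec_add E P Infinity = P"
  by (cases P) auto

lemma ec_neg_neg [simp]: "ec_neg E (ec_neg E P) = P"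
  by (cases P) auto

lemma on_curve_neg: "on_curve E P \<Longrightarrow> on_curve E (ec_neg E P)"
proof (cases P)
  case (Affine x y)
  assume "on_curve E P"
  then show ?thesis unfolding Affine on_curve.simps ec_neg.simps by algebra
qed auto

lemma ec_add_eq_Infinity: "ec_add E P Q = Infinity \<longleftrightarrow> Q = ec_neg E P"
proof (cases P; cases Q)
  fix x1 y1 x2 y2 assume PQ: "P = Affine x1 y1" "Q = Affine x2 y2"
  have "ec_add E P Q = Infinity \<longleftrightarrow> x1 = x2 \<and> y1 + y2 + a1 E * x2 + a3 E = 0"
    unfolding PQ by (simp add: Let_def)
  also have "\<dots> \<longleftrightarrow> x1 = x2 \<and> y2 = - y1 - a1 E * x2 - a3 E"
    by (auto simp: algebra_simps eq_neg_iff_add_eq_0)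
  finally show ?thesis unfolding PQ by auto
qed auto

lemma on_curve_same_x:
  assumes "on_curve E (Affine x y)" "on_curve E (Affine x y')"
  shows "y = y' \<or> y + y' + a1 E * x + a3 E = 0"
proof -
  have "(y - y') * (y + y' + a1 E * x + a3 E) = 0"
    using assms unfolding on_curve.simps by algebra
  then show ?thesis by simp
qed

lemma ec_add_commute:
  assumes "on_curve E P" "on_curve E Q"
  shows "ec_add E P Q = ec_add E Q P"
proof (cases P; cases Q)
  fix x1 y1 x2 y2 assume PQ: "P = Affine x1 y1" "Q = Affine x2 y2"
  show ?thesis
  proof (cases "x1 = x2")
    case True
    then have "y1 = y2 \<or> y1 + y2 + a1 E * x2 + a3 E = 0"
      using on_curve_same_x[of E x1 y1 y2] assms unfolding PQ by simp
    with True show ?thesis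
      unfolding PQ by (elim disjE) (simp, simp add: add.commute)
  next
    case False
    define l where "l = ec_slope E x1 y1 x2 y2"
    have l': "l = ec_slope E x2 y2 x1 y1"
      unfolding l_def ec_slope_def using False minus_divide_divide[of "y1 - y2" "x1 - x2"] by simp
    have l: "l * (x1 - x2) = y1 - y2"
      unfolding l' ec_slope_def using False by simp
    define x3 where "x3 = l^2 + a1 E * l - a2 E - x1 - x2"
    have "l * (x1 - x3) - y1 = l * (x2 - x3) - y2" using l by algebra
    then show ?thesis
      unfolding PQ using False ec_add_slope[OF _ l_def x3_def] ec_add_slope[OF _ l', of x3]
      by (simp add: x3_def del: ec_add.simps)
  qed
qed auto

section \<open>Chords and tangents\<close>

text \<open>Vieta's formulas for the intersection of the curve with a line of slope \<open>l\<close>; the predicate is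
  insensitive to coincidences between the three points.\<close>

definition collinear_on :: "'a::field weierstrass \<Rightarrow> 'a \<Rightarrow> 'a \<Rightarrow> 'a \<Rightarrow> 'a \<Rightarrow> 'a \<Rightarrow> 'a \<Rightarrow> 'a \<Rightarrow> bool" where
  "collinear_on E l x1 y1 x2 y2 x3 y3 \<longleftrightarrow> y2 - y1 = l * (x2 - x1) \<and> y3 - y1 = l * (x3 - x1) \<and>
     x1 + x2 + x3 = l^2 + a1 E * l - a2 E \<and>
     x1 * x2 + x1 * x3 + x2 * x3 = a4 E - 2 * l * (y1 - l * x1) - a1 E * (y1 - l * x1) - a3 E * l \<and>
     x1 * x2 * x3 = (y1 - l * x1)^2 + a3 E * (y1 - l * x1) - a6 E"

lemma collinear_onD:
  assumes "collinear_on E l x1 y1 x2 y2 x3 y3"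
  shows "y2 - y1 = l * (x2 - x1)" "y3 - y1 = l * (x3 - x1)" "x1 + x2 + x3 = l^2 + a1 E * l - a2 E"
    "x1 * x2 + x1 * x3 + x2 * x3 = a4 E - 2 * l * (y1 - l * x1) - a1 E * (y1 - l * x1) - a3 E * l"
    "x1 * x2 * x3 = (y1 - l * x1)^2 + a3 E * (y1 - l * x1) - a6 E"
  using assms unfolding collinear_on_def by simp_all

lemma collinear_on_ec_add:
  fixes E :: "'a::field weierstrass"
  assumes on: "on_curve E (Affine x1 y1)" "on_curve E (Affine x2 y2)"
    and ne: "x1 = x2 \<Longrightarrow> y1 + y2 + a1 E * x2 + a3 E \<noteq> 0"
  obtains l x3 y3 where "l = ec_slope E x1 y1 x2 y2" "collinear_on E l x1 y1 x2 y2 x3 y3"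
    "ec_add E (Affine x1 y1) (Affine x2 y2) = ec_neg E (Affine x3 y3)"
proof -
  define l where "l = ec_slope E x1 y1 x2 y2"
  define x3 where "x3 = l^2 + a1 E * l - a2 E - x1 - x2"
  define y3 where "y3 = y1 + l * (x3 - x1)"
  have "ec_add E (Affine x1 y1) (Affine x2 y2) = ec_neg E (Affine x3 y3)"
    by (subst ec_add_slope[OF ne l_def x3_def]) (auto simp: y3_def algebra_simps)
  moreover have "collinear_on E l x1 y1 x2 y2 x3 y3"
  proof (cases "x1 = x2")
    case False
    have l: "l * (x2 - x1) = y2 - y1" using False by (simp add: l_def ec_slope_def)
    have x21: "x2 - x1 \<noteq> 0" using False by simp
    have e2: "x1 * x2 + x1 * x3 + x2 * x3 = a4 E - 2 * l * (y1 - l * x1) - a1 E * (y1 - l * x1) - a3 E * l" (is "?L = ?R")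
    proof -
      have "(x2 - x1) * (?L - ?R) = 0"
        using on l unfolding x3_def on_curve.simps by algebra
      then show ?thesis using x21 by simp
    qed
    moreover have "x1 * x2 * x3 = (y1 - l * x1)^2 + a3 E * (y1 - l * x1) - a6 E"
      using on(1) e2 unfolding x3_def on_curve.simps by algebra
    ultimately show ?thesis using l unfolding collinear_on_def y3_def x3_def by simp
  next
    case True
    then have y: "y1 = y2" using on_curve_same_x[of E x1 y1 y2] on ne by auto
    have "2 * y1 + a1 E * x1 + a3 E \<noteq> 0" using ne[OF True] unfolding True y mult_2 .
    then have l: "l * (2 * y1 + a1 E * x1 + a3 E) = 3 * x1^2 + 2 * a2 E * x1 + a4 E - a1 E * y1"
      using True by (simp add: l_def ec_slope_def)
    have x3': "x3 = l^2 + a1 E * l - a2 E - 2 * x1" using True by (simp add: x3_def)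
    have e2: "x1 * x1 + x1 * x3 + x1 * x3 = a4 E - 2 * l * (y1 - l * x1) - a1 E * (y1 - l * x1) - a3 E * l"
      using l unfolding x3' by algebra
    moreover have "x1 * x1 * x3 = (y1 - l * x1)^2 + a3 E * (y1 - l * x1) - a6 E"
      using on(1) l unfolding x3' on_curve.simps by algebra
    moreover have "x1 + x1 + x3 = l^2 + a1 E * l - a2 E" unfolding x3' by simp
    ultimately show ?thesis using True y unfolding collinear_on_def y3_def by simp
  qed
  ultimately show ?thesis using that l_def by blast
qed

lemma collinear_on_imp_on_curve:
  assumes "collinear_on E l x1 y1 x2 y2 x3 y3"
  shows "on_curve E (Affine x3 y3)"
proof -
  note c = collinear_onD[OF assms]
  define v where "v = y1 - l * x1"
  have y3: "y3 = l * x3 + v" using c(2) by (simp add: v_def algebra_simps)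
  show ?thesis
    using c(3-5) unfolding y3 v_def[symmetric] on_curve.simps by algebra
qed

lemma on_curve_ec_add:
  fixes E :: "'a::field weierstrass"
  assumes "on_curve E P" "on_curve E Q"
  shows "on_curve E (ec_add E P Q)"
proof (cases P; cases Q)
  fix x1 y1 x2 y2 assume PQ: "P = Affine x1 y1" "Q = Affine x2 y2"
  show ?thesis
  proof (cases "ec_add E P Q = Infinity")
    case False
    then have "x1 = x2 \<Longrightarrow> y1 + y2 + a1 E * x2 + a3 E \<noteq> 0" unfolding PQ by auto
    then show ?thesis using collinear_on_ec_add assms collinear_on_imp_on_curve on_curve_neg
      unfolding PQ by metis
  qed auto
qed (use assms in auto)

text \<open>This is the converse of \<open>collinear_on_ec_add\<close>: Vieta's relations force the
  slope. If \<open>x1 = x2\<close>, they make \<open>x1\<close> a double root of the cubic cut out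
  by the line, so \<open>l\<close> is the tangent slope.\<close>

lemma ec_add_collinear_on:
  fixes E :: "'a::field weierstrass"
  assumes c: "collinear_on E l x1 y1 x2 y2 x3 y3"
    and ne: "x1 = x2 \<Longrightarrow> y1 + y2 + a1 E * x2 + a3 E \<noteq> 0"
  shows "ec_add E (Affine x1 y1) (Affine x2 y2) = ec_neg E (Affine x3 y3)"
proof -
  have l: "l = ec_slope E x1 y1 x2 y2"
  proof (cases "x1 = x2")
    case False
    then show ?thesis using c by (simp add: ec_slope_def collinear_on_def)
  next
    case True
    with c have y: "y1 = y2" by (simp add: collinear_on_def)
    have "2 * y1 + a1 E * x1 + a3 E \<noteq> 0" using ne[OF True] unfolding True y mult_2 .
    moreover have "l * (2 * y1 + a1 E * x1 + a3 E) = 3 * x1^2 + 2 * a2 E * x1 + a4 E - a1 E * y1"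
      using collinear_onD(3,4)[OF c] unfolding True[symmetric] by algebra
    ultimately show ?thesis using True by (simp add: ec_slope_def field_simps)
  qed
  have "x3 = l^2 + a1 E * l - a2 E - x1 - x2"
    unfolding collinear_onD(3)[OF c, symmetric] by simp
  moreover have "y3 = y1 + l * (x3 - x1)"
    unfolding collinear_onD(2)[OF c, symmetric] by simp
  ultimately show ?thesis by (subst ec_add_slope[OF ne l]) (auto simp: algebra_simps)
qed

lemma collinear_on_rotate:
  assumes "collinear_on E l x1 y1 x2 y2 x3 y3"
  shows "collinear_on E l x3 y3 x2 y2 x1 y1"
proof -
  note c = collinear_onD[OF assms]
  have "y3 - l * x3 = y1 - l * x1" using c(2) by (simp add: algebra_simps)
  moreover have "y2 - y3 = l * (x2 - x3)" using c(1,2) by algebra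
  moreover have "y1 - y3 = l * (x1 - x3)" using c(2) by (simp add: algebra_simps)
  ultimately show ?thesis
    using c(3-5) unfolding collinear_on_def by (simp add: ac_simps)
qed

text \<open>Negation is an affine map, sending the line \<open>y = l * x + v\<close> to the line of
  slope \<open>- l - a1 E\<close> and intercept \<open>- v - a3 E\<close>; the abscissas do not
  change.\<close>

lemma collinear_on_neg:
  assumes "collinear_on E l x1 y1 x2 y2 x3 y3"
  shows "collinear_on E (- l - a1 E)
     x1 (- y1 - a1 E * x1 - a3 E) x2 (- y2 - a1 E * x2 - a3 E) x3 (- y3 - a1 E * x3 - a3 E)"
proof -
  note c = collinear_onD[OF assms]
  define v where "v = y1 - l * x1"
  have v: "- y1 - a1 E * x1 - a3 E - (- l - a1 E) * x1 = - v - a3 E"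
    by (simp add: v_def algebra_simps)
  show ?thesis
    unfolding collinear_on_def v using c(3-5) unfolding v_def[symmetric]
  proof (intro conjI)
    show "- y2 - a1 E * x2 - a3 E - (- y1 - a1 E * x1 - a3 E) = (- l - a1 E) * (x2 - x1)"
      using c(1) by algebra
    show "- y3 - a1 E * x3 - a3 E - (- y1 - a1 E * x1 - a3 E) = (- l - a1 E) * (x3 - x1)"
      using c(2) by algebra
  qed algebra+
qed

section \<open>Changes of Weierstrass coordinates\<close>

definition ec_change ::
  "'a::field weierstrass \<Rightarrow> 'a weierstrass \<Rightarrow> 'a \<Rightarrow> 'a \<Rightarrow> 'a \<Rightarrow> 'a \<Rightarrow> bool" where
  "ec_change E E' u r s t \<longleftrightarrow> u \<noteq> 0 \<and>
     u * a1 E' = a1 E + 2 * s \<and>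
     u^2 * a2 E' = a2 E - s * a1 E + 3 * r - s^2 \<and>
     u^3 * a3 E' = a3 E + r * a1 E + 2 * t \<and>
     u^4 * a4 E' = a4 E - s * a3 E + 2 * r * a2 E - (t + r * s) * a1 E + 3 * r^2 - 2 * s * t \<and>
     u^6 * a6 E' = a6 E + r * a4 E + r^2 * a2 E + r^3 - t * a3 E - t^2 - r * t * a1 E"

lemma ec_isom_iff: "(E, E') \<in> ec_isom \<longleftrightarrow> (\<exists>u r s t. ec_change E E' u r s t)"
  by (simp add: ec_isom_def ec_change_def)

lemma ec_change_exists:
  fixes E :: "'a::field weierstrass"
  assumes "u \<noteq> 0"
  obtains E' where "ec_change E E' u r s t"
proof
  show "ec_change E (Weierstrass
     ((a1 E + 2 * s) / u)
     ((a2 E - s * a1 E + 3 * r - s^2) / u^2)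
     ((a3 E + r * a1 E + 2 * t) / u^3)
     ((a4 E - s * a3 E + 2 * r * a2 E - (t + r * s) * a1 E + 3 * r^2 - 2 * s * t) / u^4)
     ((a6 E + r * a4 E + r^2 * a2 E + r^3 - t * a3 E - t^2 - r * t * a1 E) / u^6)) u r s t"
    using assms by (simp add: ec_change_def)
qed

text \<open>Under \<open>ec_change E E' u r s t\<close> this carries points of \<open>E'\<close> to
  points of \<open>E\<close>, against the order of the arguments.\<close>

fun ec_map :: "'a::field \<Rightarrow> 'a \<Rightarrow> 'a \<Rightarrow> 'a \<Rightarrow> 'a point \<Rightarrow> 'a point" where
  "ec_map u r s t Infinity = Infinity"
| "ec_map u r s t (Affine x y) = Affine (u^2 * x + r) (u^3 * y + s * u^2 * x + t)"

text \<open>Solving for the coefficients of \<open>E\<close> makes every invariance statement a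
  polynomial identity in \<open>u\<close>, \<open>r\<close>, \<open>s\<close>, \<open>t\<close> and
  the coefficients of \<open>E'\<close>.\<close>

lemma ec_changeD:
  fixes E :: "'a::field weierstrass"
  assumes "ec_change E E' u r s t"
  shows "u \<noteq> 0" "a1 E = u * a1 E' - 2 * s" "a2 E = u^2 * a2 E' + s * u * a1 E' - s^2 - 3 * r"
    "a3 E = u^3 * a3 E' - r * u * a1 E' + 2 * r * s - 2 * t"
    "a4 E = u^4 * a4 E' + s * u^3 * a3 E' - 2 * r * u^2 * a2 E' + (t - 2 * r * s) * u * a1 E' + 3 * r^2
       + 2 * r * s^2 - 2 * s * t"
    "a6 E = u^6 * a6 E' - r * u^4 * a4 E' + r^2 * u^2 * a2 E' - r^3 + (t - r * s) * u^3 * a3 E'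
       - r * (t - r * s) * u * a1 E' - (t - r * s)^2"
proof -
  note c = assms[unfolded ec_change_def]
  show "u \<noteq> 0" using c by simp
  show A1: "a1 E = u * a1 E' - 2 * s" using c by (simp add: algebra_simps)
  have "a2 E = u^2 * a2 E' + s * a1 E - 3 * r + s^2" using c by (simp add: algebra_simps)
  also have "\<dots> = u^2 * a2 E' + s * u * a1 E' - s^2 - 3 * r" unfolding A1 by algebra
  finally show A2: "a2 E = u^2 * a2 E' + s * u * a1 E' - s^2 - 3 * r" .
  have "a3 E = u^3 * a3 E' - r * a1 E - 2 * t" using c by (simp add: algebra_simps)
  also have "\<dots> = u^3 * a3 E' - r * u * a1 E' + 2 * r * s - 2 * t" unfolding A1 by algebra
  finally show A3: "a3 E = u^3 * a3 E' - r * u * a1 E' + 2 * r * s - 2 * t" .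
  have "a4 E = u^4 * a4 E' + s * a3 E - 2 * r * a2 E + (t + r * s) * a1 E - 3 * r^2 + 2 * s * t"
    using c by (simp add: algebra_simps)
  also have "\<dots> = u^4 * a4 E' + s * u^3 * a3 E' - 2 * r * u^2 * a2 E' + (t - 2 * r * s) * u * a1 E' + 3 * r^2
       + 2 * r * s^2 - 2 * s * t" unfolding A1 A2 A3 by algebra
  finally show A4: "a4 E = u^4 * a4 E' + s * u^3 * a3 E' - 2 * r * u^2 * a2 E' + (t - 2 * r * s) * u * a1 E'
     + 3 * r^2 + 2 * r * s^2 - 2 * s * t" .
  have "a6 E = u^6 * a6 E' - r * a4 E - r^2 * a2 E - r^3 + t * a3 E + t^2 + r * t * a1 E"
    using c by (simp add: algebra_simps)
  also have "\<dots> = u^6 * a6 E' - r * u^4 * a4 E' + r^2 * u^2 * a2 E' - r^3 + (t - r * s) * u^3 * a3 E'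
       - r * (t - r * s) * u * a1 E' - (t - r * s)^2" unfolding A1 A2 A3 A4 by algebra
  finally show "a6 E = u^6 * a6 E' - r * u^4 * a4 E' + r^2 * u^2 * a2 E' - r^3 + (t - r * s) * u^3 * a3 E'
       - r * (t - r * s) * u * a1 E' - (t - r * s)^2" .
qed

context
  fixes E E' :: "'a::field weierstrass" and u r s t
  assumes c: "ec_change E E' u r s t"
begin

lemma on_curve_ec_map: "on_curve E (ec_map u r s t P) \<longleftrightarrow> on_curve E' P"
proof (cases P)
  case (Affine x y)
  define X Y where "X = u^2 * x + r" and "Y = u^3 * y + s * u^2 * x + t"
  have "Y^2 + a1 E * X * Y + a3 E * Y - (X^3 + a2 E * X^2 + a4 E * X + a6 E)
     = u^6 * (y^2 + a1 E' * x * y + a3 E' * y - (x^3 + a2 E' * x^2 + a4 E' * x + a6 E'))"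
    unfolding X_def Y_def ec_changeD(2-6)[OF c] by algebra
  then have "Y^2 + a1 E * X * Y + a3 E * Y = X^3 + a2 E * X^2 + a4 E * X + a6 E \<longleftrightarrow>
      y^2 + a1 E' * x * y + a3 E' * y = x^3 + a2 E' * x^2 + a4 E' * x + a6 E'"
    using ec_changeD(1)[OF c] by (metis eq_iff_diff_eq_0 mult_eq_0_iff power_not_zero)
  then show ?thesis unfolding Affine by (simp add: X_def Y_def)
qed auto

lemma ec_map_eq_iff: "ec_map u r s t P = ec_map u r s t Q \<longleftrightarrow> P = Q"
  using ec_changeD(1)[OF c] by (cases P; cases Q) auto

lemma ec_map_surj: "\<exists>P. ec_map u r s t P = Q"
proof (cases Q)
  case (Affine x y)
  have "ec_map u r s t (Affine ((x - r) / u^2) ((y - s * (x - r) - t) / u^3)) = Q"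
    unfolding Affine using ec_changeD(1)[OF c] by simp
  then show ?thesis by blast
qed (use ec_map.simps(1) in blast)

text \<open>The substitution is affine and turns a line of slope \<open>l\<close> into one of slope
  \<open>u * l + s\<close>, for chords and tangents alike.\<close>

lemma ec_map_add:
  assumes "on_curve E' P" "on_curve E' Q"
  shows "ec_add E (ec_map u r s t P) (ec_map u r s t Q) = ec_map u r s t (ec_add E' P Q)"
proof (cases P; cases Q)
  fix x1 y1 x2 y2 assume PQ: "P = Affine x1 y1" "Q = Affine x2 y2"
  define X1 Y1 X2 Y2 where "X1 = u^2 * x1 + r" and "Y1 = u^3 * y1 + s * u^2 * x1 + t"
    and "X2 = u^2 * x2 + r" and "Y2 = u^3 * y2 + s * u^2 * x2 + t"
  note XY = X1_def Y1_def X2_def Y2_def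
  note u = ec_changeD(1)[OF c]
  have X: "X1 = X2 \<longleftrightarrow> x1 = x2" using u by (simp add: XY)
  have neg: "Y1 + Y2 + a1 E * X2 + a3 E = u^3 * (y1 + y2 + a1 E' * x2 + a3 E')" if "x1 = x2"
    unfolding XY that ec_changeD(2-6)[OF c] by algebra
  have m: "ec_map u r s t P = Affine X1 Y1" "ec_map u r s t Q = Affine X2 Y2"
    by (simp_all add: PQ XY)
  show ?thesis
  proof (cases "x1 = x2 \<and> y1 + y2 + a1 E' * x2 + a3 E' = 0")
    case True
    then have "X1 = X2 \<and> Y1 + Y2 + a1 E * X2 + a3 E = 0" using X neg by simp
    then show ?thesis using True unfolding m unfolding PQ by simp
  next
    case False
    define l where "l = ec_slope E' x1 y1 x2 y2"
    define x3 where "x3 = l^2 + a1 E' * l - a2 E' - x1 - x2"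
    define L where "L = u * l + s"
    define X3 where "X3 = u^2 * x3 + r"
    have X3: "X3 = L^2 + a1 E * L - a2 E - X1 - X2"
      unfolding X3_def x3_def L_def X1_def X2_def ec_changeD(2-6)[OF c] by algebra
    have L: "L = ec_slope E X1 Y1 X2 Y2"
    proof (cases "x1 = x2")
      case True
      with False have y: "y1 = y2"
        using on_curve_same_x[of E' x1 y1 y2] assms unfolding PQ by simp
      have D: "2 * y1 + a1 E' * x1 + a3 E' \<noteq> 0"
        using False True y unfolding mult_2 by simp
      have l: "l * (2 * y1 + a1 E' * x1 + a3 E') = 3 * x1^2 + 2 * a2 E' * x1 + a4 E' - a1 E' * y1"
        using D True by (simp add: l_def ec_slope_def)
      have D': "2 * Y1 + a1 E * X1 + a3 E = u^3 * (2 * y1 + a1 E' * x1 + a3 E')"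
        unfolding XY ec_changeD(2-6)[OF c] by algebra
      have "3 * X1^2 + 2 * a2 E * X1 + a4 E - a1 E * Y1 =
          u^4 * (3 * x1^2 + 2 * a2 E' * x1 + a4 E' - a1 E' * y1) + s * u^3 * (2 * y1 + a1 E' * x1 + a3 E')"
        unfolding XY ec_changeD(2-6)[OF c] by algebra
      also have "\<dots> = L * (u^3 * (2 * y1 + a1 E' * x1 + a3 E'))"
        unfolding l[symmetric] L_def by algebra
      finally have N: "3 * X1^2 + 2 * a2 E * X1 + a4 E - a1 E * Y1 = L * (2 * Y1 + a1 E * X1 + a3 E)"
        unfolding D' .
      have "2 * Y1 + a1 E * X1 + a3 E \<noteq> 0" unfolding D' using D u by simp
      then have "ec_slope E X1 Y1 X2 Y2 = L" unfolding ec_slope_def N using X True by simp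
      then show ?thesis ..
    next
      case False
      then have l: "l * (x2 - x1) = y2 - y1" by (simp add: l_def ec_slope_def)
      have "Y2 - Y1 = u^3 * (y2 - y1) + s * u^2 * (x2 - x1)" unfolding XY by algebra
      also have "\<dots> = L * (X2 - X1)" unfolding l[symmetric] L_def XY by algebra
      finally have "Y2 - Y1 = L * (X2 - X1)" .
      then show ?thesis using False X by (simp add: ec_slope_def)
    qed
    have "ec_add E' P Q = Affine x3 (l * (x1 - x3) - y1 - a1 E' * x3 - a3 E')"
      unfolding PQ by (rule ec_add_slope[OF _ l_def x3_def]) (use False in simp)
    moreover have "ec_add E (Affine X1 Y1) (Affine X2 Y2) = Affine X3 (L * (X1 - X3) - Y1 - a1 E * X3 - a3 E)"
      by (rule ec_add_slope[OF _ L X3]) (use False X neg u in simp)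
    moreover have "L * (X1 - X3) - Y1 - a1 E * X3 - a3 E =
        u^3 * (l * (x1 - x3) - y1 - a1 E' * x3 - a3 E') + s * u^2 * x3 + t"
      unfolding L_def X3_def X1_def Y1_def ec_changeD(2-6)[OF c] by algebra
    ultimately show ?thesis unfolding m by (simp add: X3_def)
  qed
qed auto

lemma c4_ec_change: "c4 E = u^4 * c4 E'"
  unfolding c4_def b2_def b4_def ec_changeD(2-6)[OF c] by algebra

lemma c6_ec_change: "c6 E = u^6 * c6 E'"
proof -
  have b2: "b2 E = u^2 * b2 E' - 12 * r"
    unfolding b2_def ec_changeD(2-6)[OF c] by algebra
  have b4: "b4 E = u^4 * b4 E' - r * u^2 * b2 E' + 6 * r^2"
    unfolding b4_def b2_def ec_changeD(2-6)[OF c] by algebra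
  have b6: "b6 E = u^6 * b6 E' - 2 * r * u^4 * b4 E' + r^2 * u^2 * b2 E' - 4 * r^3"
    unfolding b6_def b4_def b2_def ec_changeD(2-6)[OF c] by algebra
  show ?thesis unfolding c6_def b2 b4 b6 by algebra
qed

end

lemma discr_ec_change:
  fixes E :: "'a::field_char_0 weierstrass"
  assumes "ec_change E E' u r s t"
  shows "discr E = u^12 * discr E'"
proof -
  have "1728 * discr E = (u^4 * c4 E')^3 - (u^6 * c6 E')^2"
    unfolding discr_relation[symmetric] c4_ec_change[OF assms] c6_ec_change[OF assms] ..
  also have "\<dots> = u^12 * (1728 * discr E')"
    unfolding discr_relation[symmetric] by algebra
  finally show ?thesis by simp
qed

lemma elliptic_curve_ec_change:
  fixes E :: "'a::field_char_0 weierstrass"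
  assumes "ec_change E E' u r s t"
  shows "elliptic_curve E \<longleftrightarrow> elliptic_curve E'"
  using discr_ec_change[OF assms] ec_changeD(1)[OF assms] by (simp add: elliptic_curve_def)

lemma j_inv_ec_change:
  fixes E :: "'a::field_char_0 weierstrass"
  assumes "ec_change E E' u r s t"
  shows "j_inv E = j_inv E'"
  using ec_changeD(1)[OF assms] unfolding j_inv_def discr_ec_change[OF assms] c4_ec_change[OF assms]
  by (simp add: power_mult_distrib flip: power_mult)

section \<open>Nonsingularity and cancellation\<close>

text \<open>Moving a singular point to the origin gives \<open>a3 = a4 = a6 = 0\<close>, and then
  every term of the discriminant vanishes.\<close>

lemma elliptic_curve_nonsingular:
  fixes E :: "'a::field_char_0 weierstrass"
  assumes "elliptic_curve E" "on_curve E (Affine x y)" "2 * y + a1 E * x + a3 E = 0"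
  shows "3 * x^2 + 2 * a2 E * x + a4 E - a1 E * y \<noteq> 0"
proof
  assume d: "3 * x^2 + 2 * a2 E * x + a4 E - a1 E * y = 0"
  obtain E' where E': "ec_change E E' 1 x 0 y" by (rule ec_change_exists[OF one_neq_zero])
  have c: "a3 E' = a3 E + x * a1 E + 2 * y" "a4 E' = a4 E + 2 * x * a2 E - y * a1 E + 3 * x^2"
    "a6 E' = a6 E + x * a4 E + x^2 * a2 E + x^3 - y * a3 E - y^2 - x * y * a1 E"
    using E' unfolding ec_change_def by simp_all
  have "a3 E' = 0" unfolding c using assms(3) by algebra
  moreover have "a4 E' = 0" unfolding c using d by algebra
  moreover have "a6 E' = 0" unfolding c using assms(2) unfolding on_curve.simps by algebra
  ultimately have "discr E' = 0" by (simp add: discr_def b4_def b6_def b8_def)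
  then show False using assms(1) elliptic_curve_ec_change[OF E'] by (simp add: elliptic_curve_def)
qed

lemma ec_neg_add:
  assumes "on_curve E P" "on_curve E Q"
  shows "ec_neg E (ec_add E P Q) = ec_add E (ec_neg E P) (ec_neg E Q)"
proof (cases P; cases Q)
  fix x1 y1 x2 y2 assume PQ: "P = Affine x1 y1" "Q = Affine x2 y2"
  show ?thesis
  proof (cases "ec_add E P Q = Infinity")
    case True
    then show ?thesis using ec_add_eq_Infinity ec_neg.simps(1) by metis
  next
    case False
    then have ne: "x1 = x2 \<Longrightarrow> y1 + y2 + a1 E * x2 + a3 E \<noteq> 0" unfolding PQ by auto
    obtain l x3 y3 where c: "collinear_on E l x1 y1 x2 y2 x3 y3"
      and add: "ec_add E (Affine x1 y1) (Affine x2 y2) = ec_neg E (Affine x3 y3)"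
      using collinear_on_ec_add[OF _ _ ne] assms unfolding PQ by metis
    have ne': "(- y1 - a1 E * x1 - a3 E) + (- y2 - a1 E * x2 - a3 E) + a1 E * x2 + a3 E \<noteq> 0" if "x1 = x2"
    proof -
      have "(- y1 - a1 E * x1 - a3 E) + (- y2 - a1 E * x2 - a3 E) + a1 E * x2 + a3 E = - (y1 + y2 + a1 E * x2 + a3 E)"
        using that by simp
      then show ?thesis using ne[OF that] by (metis neg_equal_0_iff_equal)
    qed
    show ?thesis
      using ec_add_collinear_on[OF collinear_on_neg[OF c] ne'] add unfolding PQ by simp
  qed
qed auto

text \<open>If \<open>P + Q = Q\<close>, the line through \<open>P\<close> and \<open>Q\<close>
  meets the curve again in \<open>- Q\<close>. As it is not vertical, \<open>- Q = Q\<close>, and it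
  meets the curve doubly at this 2-torsion point, where a smooth curve has a vertical
  tangent.\<close>

lemma ec_add_neq_right:
  fixes E :: "'a::field_char_0 weierstrass"
  assumes E: "elliptic_curve E" and on: "on_curve E P" "on_curve E Q" and P: "P \<noteq> Infinity"
  shows "ec_add E P Q \<noteq> Q"
proof
  assume eq: "ec_add E P Q = Q"
  with P have "Q \<noteq> Infinity" by auto
  with P obtain x1 y1 x2 y2 where PQ: "P = Affine x1 y1" "Q = Affine x2 y2"
    by (metis point.exhaust)
  have ne: "x1 = x2 \<Longrightarrow> y1 + y2 + a1 E * x2 + a3 E \<noteq> 0" using eq unfolding PQ by auto
  obtain l x3 y3 where c: "collinear_on E l x1 y1 x2 y2 x3 y3"
      and add: "ec_add E (Affine x1 y1) (Affine x2 y2) = ec_neg E (Affine x3 y3)"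
    using collinear_on_ec_add[OF _ _ ne] on unfolding PQ by metis
  have x3: "x3 = x2" and y3: "y2 = - y3 - a1 E * x3 - a3 E" using add eq unfolding PQ by (simp_all del: ec_add.simps)
  note d = collinear_onD[OF c, unfolded x3]
  have "y3 = y2" using d(1,2) by algebra
  with y3 x3 have t: "2 * y2 + a1 E * x2 + a3 E = 0" by algebra
  have "3 * x2^2 + 2 * a2 E * x2 + a4 E - a1 E * y2 = l * (2 * y2 + a1 E * x2 + a3 E)"
    using d(1,3,4) by algebra
  with t have "3 * x2^2 + 2 * a2 E * x2 + a4 E - a1 E * y2 = 0" by simp
  with elliptic_curve_nonsingular[OF E _ t] on show False unfolding PQ by simp
qed

text \<open>If \<open>P\<close>, \<open>Q\<close>, \<open>T\<close> are collinear, then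
  \<open>P + Q = - T\<close>, and the collinear triple \<open>- T\<close>, \<open>- Q\<close>,
  \<open>- P\<close> gives \<open>(- T) + (- Q) = P\<close>. That this last sum is not degenerate is
  \<open>ec_add_neq_right\<close>.\<close>

lemma ec_add_neg_cancel:
  fixes E :: "'a::field_char_0 weierstrass"
  assumes E: "elliptic_curve E" and on: "on_curve E P" "on_curve E Q"
  shows "ec_add E (ec_add E P Q) (ec_neg E Q) = P"
proof (cases "P = Infinity \<or> Q = Infinity \<or> ec_add E P Q = Infinity")
  case True
  then show ?thesis
  proof (elim disjE)
    assume "ec_add E P Q = Infinity"
    then have "Q = ec_neg E P" by (simp add: ec_add_eq_Infinity)
    then show ?thesis using \<open>ec_add E P Q = Infinity\<close> by simp
  qed (auto simp: ec_add_eq_Infinity)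
next
  case False
  then obtain x1 y1 x2 y2 where PQ: "P = Affine x1 y1" "Q = Affine x2 y2"
    by (metis point.exhaust)
  have ne: "x1 = x2 \<Longrightarrow> y1 + y2 + a1 E * x2 + a3 E \<noteq> 0" using False unfolding PQ by auto
  obtain l x3 y3 where c: "collinear_on E l x1 y1 x2 y2 x3 y3"
      and add: "ec_add E (Affine x1 y1) (Affine x2 y2) = ec_neg E (Affine x3 y3)"
    using collinear_on_ec_add[OF _ _ ne] on unfolding PQ by metis
  have "ec_add E (ec_add E P Q) (ec_neg E Q) \<noteq> Infinity"
    using ec_add_neq_right[OF E on] False by (metis ec_add_eq_Infinity ec_neg_neg)
  then have ne': "x3 = x2 \<Longrightarrow> (- y3 - a1 E * x3 - a3 E) + (- y2 - a1 E * x2 - a3 E) + a1 E * x2 + a3 E \<noteq> 0"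
    using add unfolding PQ by auto
  have "ec_add E (ec_neg E (Affine x3 y3)) (ec_neg E Q) = ec_neg E (ec_neg E P)"
    using ec_add_collinear_on[OF collinear_on_neg[OF collinear_on_rotate[OF c]] ne'] unfolding PQ by simp
  then show ?thesis using add unfolding PQ by simp
qed

lemma ec_add_left_cancel:
  fixes E :: "'a::field_char_0 weierstrass"
  assumes E: "elliptic_curve E" and on: "on_curve E P" "on_curve E Q"
  shows "ec_add E (ec_neg E P) (ec_add E P Q) = Q"
  using ec_add_neg_cancel[OF E on(2,1)] ec_add_commute[OF on]
    ec_add_commute[OF on_curve_neg[OF on(1)] on_curve_ec_add[OF on]] by simp

section \<open>Associativity\<close>

text \<open>Here \<open>P = (x\<^sub>1, l x\<^sub>1)\<close> and \<open>R = (x\<^sub>3, m x\<^sub>3)\<close>, and the slope is that of the line through \<open>P + (0, 0)\<close>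
  and \<open>R\<close>.  That the formula is the same for chords and tangents makes associativity a single computation.\<close>

lemma chord_slope:
  fixes E :: "'a::field weierstrass"
  assumes E: "a1 E = 0"
    and l: "x1 + x4 = l^2 - a2 E" "x1 * x4 = a4 E - a3 E * l"
    and m: "x3 + x5 = m^2 - a2 E" "x3 * x5 = a4 E - a3 E * m"
    and ne: "x4 = x3 \<Longrightarrow> - l * x4 - a3 E = m * x3 \<and> 2 * (m * x3) + a3 E \<noteq> 0"
  shows "ec_slope E x4 (- l * x4 - a3 E) x3 (m * x3) * (l - m) = l * m - a2 E - x3 - x4"
proof (cases "x4 = x3")
  case False
  then have d: "x3 - x4 \<noteq> 0" by simp
  have "(m * x3 - (- l * x4 - a3 E)) * (l - m) = (l * m - a2 E - x3 - x4) * (x3 - x4)"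
    using l m by algebra
  then have "(m * x3 - (- l * x4 - a3 E)) / (x3 - x4) * (l - m) = l * m - a2 E - x3 - x4"
    using d by (simp add: divide_simps)
  then show ?thesis using False by (simp add: ec_slope_def)
next
  case True
  have y: "- l * x3 - a3 E = m * x3" and D: "2 * (m * x3) + a3 E \<noteq> 0" using ne True by auto
  have "(3 * x3^2 + 2 * a2 E * x3 + a4 E) * (l - m) = (l * m - a2 E - 2 * x3) * (2 * (m * x3) + a3 E)"
    using l y unfolding True by algebra
  then have "(3 * x3^2 + 2 * a2 E * x3 + a4 E) / (2 * (m * x3) + a3 E) * (l - m) = l * m - a2 E - 2 * x3"
    using D by (simp add: divide_simps)
  then show ?thesis unfolding True ec_slope_def y using E by simp
qed

text \<open>As soon as one of the four sums is \<open>Infinity\<close>, associativity is a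
  consequence of cancellation, so the main computation may assume all points affine.\<close>

lemma ec_add_assoc_degenerate:
  fixes E :: "'a::field_char_0 weierstrass"
  assumes E: "elliptic_curve E" and on: "on_curve E P" "on_curve E Q" "on_curve E R"
    and inf: "ec_add E P Q = Infinity \<or> ec_add E Q R = Infinity \<or>
      ec_add E (ec_add E P Q) R = Infinity \<or> ec_add E P (ec_add E Q R) = Infinity"
  shows "ec_add E (ec_add E P Q) R = ec_add E P (ec_add E Q R)"
  using inf
proof (elim disjE)
  assume "ec_add E P Q = Infinity"
  moreover from this have "Q = ec_neg E P" by (simp add: ec_add_eq_Infinity)
  ultimately show ?thesis using ec_add_left_cancel[OF E on_curve_neg[OF on(1)] on(3)] by simp
next
  assume "ec_add E Q R = Infinity"
  moreover from this have "R = ec_neg E Q" by (simp add: ec_add_eq_Infinity)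
  ultimately show ?thesis using ec_add_neg_cancel[OF E on(1,2)] by simp
next
  assume inf: "ec_add E (ec_add E P Q) R = Infinity"
  then have "R = ec_add E (ec_neg E Q) (ec_neg E P)"
    using ec_neg_add[OF on(2,1)] ec_add_commute[OF on(1,2)] by (simp add: ec_add_eq_Infinity)
  then have "ec_add E Q R = ec_neg E P"
    using ec_add_left_cancel[OF E on(2)[THEN on_curve_neg] on(1)[THEN on_curve_neg]] by simp
  then show ?thesis using inf by (metis ec_add_eq_Infinity)
next
  assume inf: "ec_add E P (ec_add E Q R) = Infinity"
  then have "P = ec_add E (ec_neg E R) (ec_neg E Q)"
    using ec_neg_add[OF on(3,2)] ec_add_commute[OF on(2,3)] by (metis ec_add_eq_Infinity ec_neg_neg)
  then have "ec_add E P Q = ec_neg E R"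
    using ec_add_neg_cancel[OF E on(3)[THEN on_curve_neg] on(2)[THEN on_curve_neg]] by simp
  then show ?thesis using inf by (metis ec_add_eq_Infinity ec_neg_neg)
qed

text \<open>With \<open>Q\<close> at the origin, \<open>P\<close> and \<open>R\<close> lie on lines
  \<open>y = l * x\<close> and \<open>y = m * x\<close>. By \<open>chord_slope\<close> the slopes
  \<open>n\<close> and \<open>p\<close> of the two final additions satisfy
  \<open>n - p = m - l\<close> and \<open>(n + p) * (l - m) = x1 + x5 - x3 - x4\<close>, from which
  both coordinates agree.\<close>

lemma ec_add_assoc_origin:
  fixes E :: "'a::field_char_0 weierstrass"
  assumes E: "elliptic_curve E" "a1 E = 0" and on: "on_curve E P" "on_curve E R"
    and Q: "Q = Affine 0 0" "on_curve E Q"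
  shows "ec_add E (ec_add E P Q) R = ec_add E P (ec_add E Q R)"
proof (cases "P = Infinity \<or> R = Infinity \<or> ec_add E P Q = Infinity \<or> ec_add E Q R = Infinity \<or>
      ec_add E (ec_add E P Q) R = Infinity \<or> ec_add E P (ec_add E Q R) = Infinity")
  case True
  then show ?thesis using ec_add_assoc_degenerate[OF E(1) on(1) Q(2) on(2)] by auto
next
  case False
  then obtain x1 y1 x3 y3 where PR: "P = Affine x1 y1" "R = Affine x3 y3"
    by (metis point.exhaust)
  have line: "\<exists>l x'. y = l * x \<and> x + x' = l^2 - a2 E \<and> x * x' = a4 E - a3 E * l \<and>
      ec_add E Q (Affine x y) = Affine x' (- l * x' - a3 E)"
    if "on_curve E (Affine x y)" "ec_add E Q (Affine x y) \<noteq> Infinity" for x y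
  proof -
    have "0 = x \<Longrightarrow> 0 + y + a1 E * x + a3 E \<noteq> 0" using that(2) Q by auto
    from collinear_on_ec_add[OF Q(2)[unfolded Q(1)] that(1) this]
    obtain l x' y' where c: "collinear_on E l 0 0 x y x' y'"
      and add: "ec_add E Q (Affine x y) = ec_neg E (Affine x' y')"
      unfolding Q(1) by metis
    note c = collinear_onD[OF c]
    have y': "y' = l * x'" using c(2) by simp
    have "y = l * x" "x + x' = l^2 - a2 E" "x * x' = a4 E - a3 E * l"
      using c E(2) by simp_all
    then show ?thesis using add E(2) y' by auto
  qed
  have PQ: "ec_add E Q P = ec_add E P Q" by (rule ec_add_commute[OF Q(2) on(1)])
  obtain l x4 where y1: "y1 = l * x1" and l: "x1 + x4 = l^2 - a2 E" "x1 * x4 = a4 E - a3 E * l"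
    and A: "ec_add E P Q = Affine x4 (- l * x4 - a3 E)"
    using line[of x1 y1] on False PQ unfolding PR by auto
  obtain m x5 where y3: "y3 = m * x3" and m: "x3 + x5 = m^2 - a2 E" "x3 * x5 = a4 E - a3 E * m"
    and B: "ec_add E Q R = Affine x5 (- m * x5 - a3 E)"
    using line[of x3 y3] on False unfolding PR by auto
  have onA: "on_curve E (ec_add E P Q)" and onB: "on_curve E (ec_add E Q R)"
    using on Q by (auto intro: on_curve_ec_add)
  have comm: "ec_add E (ec_add E Q R) P = ec_add E P (ec_add E Q R)"
    by (rule ec_add_commute[OF onB on(1)])
  show ?thesis
  proof (cases "l = m")
    case True
    \<comment> \<open>For equal slopes \<open>x1, x4\<close> and \<open>x3, x5\<close> are the roots
      of the same quadratic: either \<open>P = R\<close>, or \<open>R\<close> is the third point on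
      the line through \<open>P\<close> and \<open>Q\<close>.\<close>
    have "(x1 - x3) * (x1 - x5) = 0" using l m unfolding True by algebra
    then consider "x1 = x3" | "x1 = x5" by auto
    then show ?thesis
    proof cases
      case 1
      then have "P = R" unfolding PR y1 y3 True by simp
      then show ?thesis using comm PQ by simp
    next
      case 2
      then have "ec_add E Q R = ec_neg E P" using B E(2) unfolding PR(1) y1 True by simp
      then have "ec_add E P (ec_add E Q R) = Infinity" by (simp add: ec_add_eq_Infinity)
      with False show ?thesis by simp
    qed
  next
    case False': False
    then have lm: "l - m \<noteq> 0" "m - l \<noteq> 0" by simp_all
    have 1: "x4 = x3 \<Longrightarrow> - l * x4 - a3 E + m * x3 + a1 E * x3 + a3 E \<noteq> 0"
      using False unfolding A unfolding PR y3 by auto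
    have 2: "x5 = x1 \<Longrightarrow> - m * x5 - a3 E + l * x1 + a1 E * x1 + a3 E \<noteq> 0"
      using False unfolding comm[symmetric] unfolding B unfolding PR y1 by auto
    define n where "n = ec_slope E x4 (- l * x4 - a3 E) x3 (m * x3)"
    define p where "p = ec_slope E x5 (- m * x5 - a3 E) x1 (l * x1)"
    have n: "n * (l - m) = l * m - a2 E - x3 - x4"
      unfolding n_def
    proof (rule chord_slope[OF E(2) l m])
      assume eq: "x4 = x3"
      have "- l * x4 - a3 E = m * x3"
        using on_curve_same_x[OF onA[unfolded A eq] on(2)[unfolded PR y3]] 1[OF eq] unfolding eq by blast
      then show "- l * x4 - a3 E = m * x3 \<and> 2 * (m * x3) + a3 E \<noteq> 0"
        using 1[OF eq] unfolding mult_2 E(2) by simp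
    qed
    have p: "p * (m - l) = m * l - a2 E - x1 - x5"
      unfolding p_def
    proof (rule chord_slope[OF E(2) m l])
      assume eq: "x5 = x1"
      have "- m * x5 - a3 E = l * x1"
        using on_curve_same_x[OF onB[unfolded B eq] on(1)[unfolded PR y1]] 2[OF eq] unfolding eq by blast
      then show "- m * x5 - a3 E = l * x1 \<and> 2 * (l * x1) + a3 E \<noteq> 0"
        using 2[OF eq] unfolding mult_2 E(2) by simp
    qed
    define x6 where "x6 = n^2 - a2 E - x4 - x3"
    define x7 where "x7 = p^2 - a2 E - x5 - x1"
    have L: "ec_add E (ec_add E P Q) R = Affine x6 (n * (x4 - x6) + l * x4)"
      unfolding A unfolding PR y3 using E(2) by (subst ec_add_slope[OF 1 n_def, of x6]) (simp_all add: x6_def)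
    have R: "ec_add E P (ec_add E Q R) = Affine x7 (p * (x5 - x7) + m * x5)"
      unfolding comm[symmetric] unfolding B unfolding PR y1 using E(2)
      by (subst ec_add_slope[OF 2 p_def, of x7]) (simp_all add: x7_def)
    have "(n - p - (m - l)) * (l - m) = 0" using n p l(1) m(1) by algebra
    then have "n - p - (m - l) = 0" using lm(1) by (metis mult_eq_0_iff)
    then have np: "n = p + m - l" by algebra
    have "(n + p) * (l - m) = x1 + x5 - x3 - x4" using n p by algebra
    then have "n^2 - p^2 = x3 + x4 - x1 - x5" unfolding np by algebra
    then have x67: "x6 = x7" unfolding x6_def x7_def by algebra
    have "(n * (x4 - x6) + l * x4 - (p * (x5 - x6) + m * x5)) * (l - m)
       = (n * (l - m)) * x4 + (p * (m - l)) * x5 + (l - m)^2 * x6 + (l - m) * (l * x4 - m * x5)"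
      unfolding np by algebra
    also have "(l - m)^2 * x6 = (p * (m - l))^2 - (l - m)^2 * (a2 E + x1 + x5)"
      unfolding x67 x7_def by algebra
    also have "(n * (l - m)) * x4 + (p * (m - l)) * x5 + \<dots> + (l - m) * (l * x4 - m * x5) = 0"
      unfolding n p using l(1) m(1) by algebra
    finally have "n * (x4 - x6) + l * x4 = p * (x5 - x6) + m * x5" using lm by simp
    then show ?thesis unfolding L R x67 by simp
  qed
qed

theorem ec_add_assoc:
  fixes E :: "'a::field_char_0 weierstrass"
  assumes E: "elliptic_curve E" and on: "on_curve E P" "on_curve E Q" "on_curve E R"
  shows "ec_add E (ec_add E P Q) R = ec_add E P (ec_add E Q R)"
proof (cases Q)
  case (Affine x y)
  \<comment> \<open>The translation moves \<open>Q\<close> to the origin, and the shear by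
    \<open>- a1 E / 2\<close> removes the coefficient \<open>a1\<close>.\<close>
  obtain E' where E': "ec_change E E' 1 x (- a1 E / 2) y"
    by (rule ec_change_exists[OF one_neq_zero])
  let ?f = "ec_map 1 x (- a1 E / 2) y"
  obtain P' R' where PR: "?f P' = P" "?f R' = R" using ec_map_surj[OF E'] by metis
  have Q: "?f (Affine 0 0) = Q" by (simp add: Affine)
  have on': "on_curve E' P'" "on_curve E' (Affine 0 0)" "on_curve E' R'"
    using on on_curve_ec_map[OF E'] PR Q by metis+
  have "elliptic_curve E'" using E elliptic_curve_ec_change[OF E'] by simp
  moreover have "a1 E' = 0" using E' by (simp add: ec_change_def)
  ultimately have "ec_add E' (ec_add E' P' (Affine 0 0)) R' = ec_add E' P' (ec_add E' (Affine 0 0) R')"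
    using on' by (intro ec_add_assoc_origin) auto
  then have "?f (ec_add E' (ec_add E' P' (Affine 0 0)) R') = ?f (ec_add E' P' (ec_add E' (Affine 0 0) R'))"
    by simp
  then show ?thesis
    using on' by (simp only: on_curve_ec_add PR Q flip: ec_map_add[OF E'])
qed simp

lemma comm_group_mordell_weil:
  fixes E :: "'a::field_char_0 weierstrass"
  assumes "elliptic_curve E"
  shows "comm_group (mordell_weil E)"
proof (rule comm_groupI)
  fix x assume "x \<in> carrier (mordell_weil E)"
  then have x: "on_curve E x" by (simp add: mordell_weil_def)
  have "ec_add E (ec_neg E x) x = Infinity" by (simp add: ec_add_eq_Infinity)
  then show "\<exists>y\<in>carrier (mordell_weil E). y \<otimes>\<^bsub>mordell_weil E\<^esub> x = \<one>\<^bsub>mordell_weil E\<^esub>"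
    using on_curve_neg[OF x] by (auto simp: mordell_weil_def)
qed (auto simp: mordell_weil_def on_curve_ec_add ec_add_assoc[OF assms] intro: ec_add_commute)

section \<open>Square roots in multi-quadratic fields\<close>

definition adjoin :: "'a::field set \<Rightarrow> 'a \<Rightarrow> 'a set" where
  "adjoin F \<theta> = {a + b * \<theta> |a b. a \<in> F \<and> b \<in> F}"

text \<open>The head of the list is adjoined last. An entry may already lie in the field below it,
  so a step can be trivial.\<close>

fun tower :: "'a::field set \<Rightarrow> 'a list \<Rightarrow> 'a set" where
  "tower F [] = F"
| "tower F (\<theta> # \<theta>s) = adjoin (tower F \<theta>s) \<theta>"

lemma subset_adjoin:
  assumes "is_subfield F"
  shows "F \<subseteq> adjoin F \<theta>" "\<theta> \<in> adjoin F \<theta>"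
proof -
  show "F \<subseteq> adjoin F \<theta>"
    using subfieldI(1)[OF assms] unfolding adjoin_def by (force intro: exI[of _ 0])
  show "\<theta> \<in> adjoin F \<theta>"
    using subfieldI(1,2)[OF assms] unfolding adjoin_def by (force intro: exI[of _ 0] exI[of _ 1])
qed

lemma adjoin_mem: "\<theta> \<in> F \<Longrightarrow> is_subfield F \<Longrightarrow> adjoin F \<theta> = F"
  using subset_adjoin(1)[of F \<theta>] subfieldI(3,4)[of F] unfolding adjoin_def by auto

lemma adjoin_eq_iff:
  assumes F: "is_subfield F" "\<theta> \<notin> F" and "a \<in> F" "b \<in> F" "c \<in> F" "d \<in> F"
    "a + b * \<theta> = c + d * \<theta>"
  shows "a = c \<and> b = d"
proof (cases "b = d")
  case False
  have "\<theta> * (b - d) = c - a" using assms(7) by (simp add: algebra_simps)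
  then have "\<theta> = (c - a) / (b - d)" using False by (simp add: field_simps)
  also have "\<dots> \<in> F" using assms by (intro subfieldI[OF F(1)])
  finally show ?thesis using F by simp
qed (use assms in simp)

lemma is_subfield_adjoin:
  assumes F: "is_subfield F" and sq: "\<theta>^2 \<in> F"
  shows "is_subfield (adjoin F \<theta>)"
proof (cases "\<theta> \<in> F")
  case False
  note Fi = subfieldI[OF F]
  have mem: "a + b * \<theta> \<in> adjoin F \<theta>" if "a \<in> F" "b \<in> F" for a b
    using that unfolding adjoin_def by blast
  show ?thesis
    unfolding is_subfield_def
  proof (intro conjI ballI)
    show "0 \<in> adjoin F \<theta>" "1 \<in> adjoin F \<theta>" using subset_adjoin(1)[OF F] Fi(1,2) by auto
  next
    fix x y assume "x \<in> adjoin F \<theta>" "y \<in> adjoin F \<theta>"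
    then obtain a b c d where x: "x = a + b * \<theta>" and y: "y = c + d * \<theta>" and abcd: "a \<in> F" "b \<in> F" "c \<in> F" "d \<in> F"
      unfolding adjoin_def by blast
    have "x + y = (a + c) + (b + d) * \<theta>" unfolding x y by algebra
    also have "\<dots> \<in> adjoin F \<theta>" by (intro mem Fi abcd)
    finally show "x + y \<in> adjoin F \<theta>" .
    have "x * y = (a * c + b * d * \<theta>^2) + (a * d + b * c) * \<theta>" unfolding x y by algebra
    also have "\<dots> \<in> adjoin F \<theta>" by (intro mem Fi sq abcd)
    finally show "x * y \<in> adjoin F \<theta>" .
  next
    fix x assume "x \<in> adjoin F \<theta>"
    then obtain a b where x: "x = a + b * \<theta>" and ab: "a \<in> F" "b \<in> F"
      unfolding adjoin_def by blast
    have "- x = - a + (- b) * \<theta>" unfolding x by algebra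
    also have "\<dots> \<in> adjoin F \<theta>" by (intro mem Fi ab)
    finally show "- x \<in> adjoin F \<theta>" .
    show "inverse x \<in> adjoin F \<theta>"
    proof (cases "x = 0")
      case True
      then show ?thesis using \<open>x \<in> _\<close> by simp
    next
      case x0: False
      define n where "n = a^2 - b^2 * \<theta>^2"
      have "a - b * \<theta> \<noteq> 0"
      proof
        assume 0: "a - b * \<theta> = 0"
        then have "a + (- b) * \<theta> = 0 + 0 * \<theta>" by simp
        from adjoin_eq_iff[OF F False _ _ _ _ this] ab Fi have "a = 0 \<and> b = 0" by simp
        with x x0 show False by simp
      qed
      moreover have n: "x * (a - b * \<theta>) = n" unfolding x n_def by algebra
      ultimately have n0: "n \<noteq> 0" using x0 by auto
      have "inverse x = a / n + (- b / n) * \<theta>"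
        using n n0 x0 by (simp add: field_simps)
      also have "\<dots> \<in> adjoin F \<theta>"
        unfolding n_def by (intro mem Fi sq ab)
      finally show ?thesis .
    qed
  qed
qed (use F adjoin_mem in metis)

lemma is_subfield_Rats: "is_subfield (\<rat> :: 'a::field_char_0 set)"
  by (simp add: is_subfield_def)

lemma of_rat_in_subfield:
  fixes F :: "'a::field_char_0 set"
  assumes "is_subfield F"
  shows "of_rat q \<in> F"
proof -
  have nat: "of_nat n \<in> F" for n by (induction n) (auto intro: subfieldI[OF assms])
  have int: "of_int z \<in> F" for z
    by (cases z rule: int_cases2) (auto intro: nat subfieldI[OF assms])
  show ?thesis
    by (cases q) (auto simp: of_rat_rat intro: int subfieldI[OF assms])
qed

lemma Rats_subset_subfield:
  fixes F :: "'a::field_char_0 set"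
  shows "is_subfield F \<Longrightarrow> \<rat> \<subseteq> F"
  by (auto simp: Rats_def of_rat_in_subfield)

lemma is_subfield_tower:
  fixes F :: "'a::field_char_0 set"
  assumes "is_subfield F" "\<And>\<theta>. \<theta> \<in> set \<theta>s \<Longrightarrow> \<theta>^2 \<in> \<rat>"
  shows "is_subfield (tower F \<theta>s)"
  using assms(2)
proof (induction \<theta>s)
  case (Cons \<theta> \<theta>s)
  then have "is_subfield (tower F \<theta>s)" by simp
  then show ?case using Cons.prems Rats_subset_subfield by (auto intro!: is_subfield_adjoin)
qed (use assms(1) in simp)

lemma tower_mono: "F \<subseteq> G \<Longrightarrow> tower F \<theta>s \<subseteq> tower G \<theta>s"
  by (induction \<theta>s) (auto simp: adjoin_def)

lemma tower_append: "tower F (\<theta>s @ \<eta>s) = tower (tower F \<eta>s) \<theta>s"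
  by (induction \<theta>s) auto

lemma subset_tower:
  fixes F :: "'a::field_char_0 set"
  assumes "is_subfield F" "\<And>\<theta>. \<theta> \<in> set \<theta>s \<Longrightarrow> \<theta>^2 \<in> \<rat>"
  shows "F \<subseteq> tower F \<theta>s"
  using assms(2)
proof (induction \<theta>s)
  case (Cons \<theta> \<theta>s)
  have "F \<subseteq> tower F \<theta>s" using Cons by simp
  also have "\<dots> \<subseteq> adjoin (tower F \<theta>s) \<theta>"
    using Cons.prems by (intro subset_adjoin is_subfield_tower assms(1)) auto
  finally show ?case by simp
qed simp

lemma tower_common:
  fixes F :: "'a::field_char_0 set"
  assumes F: "is_subfield F" and sq: "\<And>\<theta>. \<theta> \<in> set \<theta>s \<union> set \<eta>s \<Longrightarrow> \<theta>^2 \<in> \<rat>"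
  shows "tower F \<theta>s \<subseteq> tower F (\<theta>s @ \<eta>s)" "tower F \<eta>s \<subseteq> tower F (\<theta>s @ \<eta>s)"
  unfolding tower_append
  by (rule tower_mono[OF subset_tower[OF F]] subset_tower[OF is_subfield_tower[OF F]]; use sq in blast)+

section \<open>Generators of a multi-quadratic field\<close>

text \<open>In a space of dimension 2 the elements 1, \<alpha> and \<open>\<alpha>^2\<close> are
  dependent; a rational \<alpha> satisfies such an equation trivially.\<close>

lemma quadratic_subfield_element:
  fixes F :: "'k::field_char_0 set"
  assumes F: "quadratic_subfield F" and \<alpha>: "\<alpha> \<in> F"
  shows "\<exists>p q. \<alpha>^2 = of_rat p * \<alpha> + of_rat q"
proof (rule ccontr)
  assume neg: "\<nexists>p q. \<alpha>^2 = of_rat p * \<alpha> + of_rat q"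
  interpret vector_space "rat_scale :: rat \<Rightarrow> 'k \<Rightarrow> 'k" by (rule vector_space_rat_scale)
  have sub: "is_subfield F" and dim: "dim F = 2" using F by (auto simp: quadratic_subfield_def)
  obtain B where B: "B \<subseteq> F" "independent B" "F \<subseteq> span B" "card B = dim F"
    by (rule basis_exists)
  have "finite B" using B dim card.infinite by fastforce
  have \<alpha>1: "\<alpha> \<noteq> of_rat q" for q
  proof
    assume "\<alpha> = of_rat q"
    then have "\<alpha>^2 = of_rat 0 * \<alpha> + of_rat (q^2)" by (simp add: of_rat_power)
    with neg show False by blast
  qed
  have 1: "x \<in> span {1} \<longleftrightarrow> (\<exists>q. x = of_rat q)" for x :: 'k
    by (auto simp: span_insert)
  have 2: "x \<in> span {\<alpha>, 1} \<longleftrightarrow> (\<exists>p q. x = of_rat p * \<alpha> + of_rat q)" for x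
    unfolding span_insert[of \<alpha>] mem_Collect_eq 1 diff_eq_eq by (simp add: add.commute)
  have "independent {1 :: 'k}" by simp
  moreover have "\<alpha> \<notin> span {1}" using \<alpha>1 unfolding 1 by blast
  ultimately have i2: "independent {\<alpha>, 1}" by (simp add: independent_insert)
  have n2: "\<alpha>^2 \<notin> span {\<alpha>, 1}" using neg unfolding 2 .
  then have "\<alpha>^2 \<notin> {\<alpha>, 1}" using span_base by metis
  with i2 n2 have "independent {\<alpha>^2, \<alpha>, 1}" by (simp add: independent_insert)
  moreover have "{\<alpha>^2, \<alpha>, 1} \<subseteq> F" using \<alpha> subfieldI(2,8)[OF sub] by simp
  ultimately have "card {\<alpha>^2, \<alpha>, 1} \<le> card B"
    using independent_span_bound[OF \<open>finite B\<close>] B(3) by blast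
  moreover have "\<alpha> \<noteq> 1" using \<alpha>1[of 1] by simp
  ultimately show False using \<open>\<alpha>^2 \<notin> {\<alpha>, 1}\<close> B(4) dim by simp
qed

text \<open>The elements that lie in some tower form a subfield, because two towers lie in the tower
  of the concatenated lists, and this subfield contains every quadratic subfield. Two elements are
  treated together so that both coordinates of a point are covered by one tower.\<close>

lemma multi_quadratic_tower:
  fixes F :: "'k::field_char_0 set"
  assumes K: "multi_quadratic_field TYPE('k)" and F: "is_subfield F"
  shows "\<exists>\<theta>s. (\<forall>\<theta>\<in>set \<theta>s. \<theta>^2 \<in> \<rat>) \<and> x \<in> tower F \<theta>s \<and> y \<in> tower F \<theta>s"
proof -
  define U where "U = {x. \<exists>\<theta>s. (\<forall>\<theta>\<in>set \<theta>s. \<theta>^2 \<in> \<rat>) \<and> x \<in> tower F \<theta>s}"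
  have 2: "\<exists>\<theta>s. (\<forall>\<theta>\<in>set \<theta>s. \<theta>^2 \<in> \<rat>) \<and> x \<in> tower F \<theta>s \<and> y \<in> tower F \<theta>s" if xy: "x \<in> U" "y \<in> U" for x y
  proof -
    obtain \<theta>s \<eta>s where "\<forall>\<theta>\<in>set \<theta>s. \<theta>^2 \<in> \<rat>" "x \<in> tower F \<theta>s" "\<forall>\<theta>\<in>set \<eta>s. \<theta>^2 \<in> \<rat>" "y \<in> tower F \<eta>s"
      using xy unfolding U_def by blast
    then show ?thesis using tower_common[OF F, of \<theta>s \<eta>s] by (intro exI[of _ "\<theta>s @ \<eta>s"]) auto
  qed
  have "is_subfield U"
    unfolding is_subfield_def
  proof (intro conjI ballI)
    show "0 \<in> U" "1 \<in> U" unfolding U_def using subfieldI[OF F] by (auto intro: exI[of _ "[]"])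
  next
    fix x y assume "x \<in> U" "y \<in> U"
    with 2 obtain \<theta>s where \<theta>s: "\<forall>\<theta>\<in>set \<theta>s. \<theta>^2 \<in> \<rat>" and "x \<in> tower F \<theta>s" "y \<in> tower F \<theta>s" by blast
    moreover have "is_subfield (tower F \<theta>s)" by (rule is_subfield_tower[OF F]) (use \<theta>s in blast)
    ultimately show "x + y \<in> U" "x * y \<in> U"
      unfolding U_def by (auto intro!: exI[of _ \<theta>s] intro: subfieldI(3,4))
  next
    fix x assume "x \<in> U"
    with 2 obtain \<theta>s where \<theta>s: "\<forall>\<theta>\<in>set \<theta>s. \<theta>^2 \<in> \<rat>" and "x \<in> tower F \<theta>s" by blast
    moreover have "is_subfield (tower F \<theta>s)" by (rule is_subfield_tower[OF F]) (use \<theta>s in blast)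
    ultimately show "- x \<in> U" "inverse x \<in> U"
      unfolding U_def is_subfield_def by (auto intro!: exI[of _ \<theta>s])
  qed
  note Ui = subfieldI[OF this] of_rat_in_subfield[OF this]
  have "A \<subseteq> U" if A: "quadratic_subfield A" for A
  proof
    fix \<alpha> assume "\<alpha> \<in> A"
    then obtain p q where pq: "\<alpha>^2 = of_rat p * \<alpha> + of_rat q"
      using quadratic_subfield_element[OF A] by blast
    \<comment> \<open>Completing the square: \<open>\<theta>^2\<close> is the rational
      discriminant.\<close>
    define \<theta> where "\<theta> = 2 * \<alpha> - of_rat p"
    have "\<theta>^2 = of_rat p ^ 2 + 4 * of_rat q" unfolding \<theta>_def using pq by algebra
    also have "\<dots> \<in> \<rat>" by simp
    finally have "\<theta> \<in> U"
      unfolding U_def using subset_adjoin(2)[OF F] by (auto intro!: exI[of _ "[\<theta>]"])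
    moreover have "\<alpha> = (\<theta> + of_rat p) / 2" by (simp add: \<theta>_def)
    ultimately show "\<alpha> \<in> U" using Ui by (metis (no_types))
  qed
  moreover obtain \<F> :: "'k set set" where "\<forall>A\<in>\<F>. quadratic_subfield A" "is_subfield hull (\<Union>\<F>) = UNIV"
    using K unfolding multi_quadratic_field_def by blast
  ultimately have "U = UNIV"
    using hull_minimal[of "\<Union>\<F>" U is_subfield] \<open>is_subfield U\<close> by auto
  then show ?thesis using 2 by blast
qed

section \<open>Square roots of elements of a subfield\<close>

text \<open>Kummer theory for exponent 2: up to a factor in \<open>F\<close>, a square root of an
  element of \<open>F\<close> is a product of some of the adjoined roots, whose squares are
  rational.\<close>

lemma square_in_tower:
  fixes F :: "'a::field_char_0 set"
  assumes F: "is_subfield F" and "\<And>\<theta>. \<theta> \<in> set \<theta>s \<Longrightarrow> \<theta>^2 \<in> \<rat>"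
    and "\<alpha> \<in> tower F \<theta>s" "\<alpha>^2 \<in> F"
  shows "\<exists>c\<in>\<rat>. \<exists>v\<in>F. \<alpha>^2 = c * v^2"
  using assms(2-)
proof (induction \<theta>s arbitrary: \<alpha>)
  case Nil
  then show ?case by (intro bexI[of _ 1] bexI[of _ \<alpha>]) auto
next
  case (Cons \<theta> \<theta>s)
  let ?T = "tower F \<theta>s"
  have T: "is_subfield ?T" "F \<subseteq> ?T"
    using is_subfield_tower[OF F, of \<theta>s] subset_tower[OF F, of \<theta>s] Cons.prems(1) by auto
  note Ti = subfieldI[OF T(1)]
  have d: "\<theta>^2 \<in> \<rat>" using Cons.prems by simp
  then have dF: "\<theta>^2 \<in> F" using Rats_subset_subfield[OF F] by auto
  obtain a b where \<alpha>: "\<alpha> = a + b * \<theta>" and ab: "a \<in> ?T" "b \<in> ?T"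
    using Cons.prems(2) by (auto simp: adjoin_def)
  show ?case
  proof (cases "\<alpha> \<in> ?T")
    case True
    then show ?thesis using Cons by simp
  next
    case False
    \<comment> \<open>Otherwise the cross term \<open>2 * a * b * \<theta>\<close> of
      \<open>\<alpha>^2\<close> would put \<theta> into the smaller field.\<close>
    have "a = 0"
    proof (rule ccontr)
      assume "a \<noteq> 0"
      moreover have "b \<noteq> 0" using False \<alpha> ab by auto
      ultimately have "\<theta> = (2 * a * b * \<theta>) / (2 * a * b)" by simp
      also have "2 * a * b * \<theta> = \<alpha>^2 - a^2 - b^2 * \<theta>^2" unfolding \<alpha> by algebra
      also have "\<dots> / (2 * a * b) \<in> ?T"
        by (intro Ti ab subsetD[OF T(2) Cons.prems(3)] subsetD[OF T(2) dF])
      finally show False using False \<alpha> ab Ti by simp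
    qed
    then have \<alpha>': "\<alpha>^2 = b^2 * \<theta>^2" by (simp add: \<alpha> power_mult_distrib)
    have "\<theta>^2 \<noteq> 0" using False \<open>a = 0\<close> \<alpha> Ti by auto
    then have "b^2 = \<alpha>^2 / \<theta>^2" by (simp add: \<alpha>')
    also have "\<dots> \<in> F" by (intro subfieldI[OF F] Cons.prems(3) dF)
    finally obtain c v where "c \<in> \<rat>" "v \<in> F" "b^2 = c * v^2"
      using Cons.IH[OF Cons.prems(1) ab(2)] by auto
    then show ?thesis using d \<alpha>' by (intro bexI[of _ "c * \<theta>^2"] bexI[of _ v]) auto
  qed
qed

text \<open>By \<open>square_in_tower\<close> over \<open>adjoin F \<theta>\<close>,
  \<open>\<alpha>^2\<close> is \<open>c * (p + q * \<theta>)^2\<close> with \<open>c\<close>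
  rational, so its norm to \<open>F\<close> is the square of
  \<open>c * (p^2 - q^2 * \<theta>^2)\<close>.\<close>

lemma multi_quadratic_norm:
  fixes F :: "'k::field_char_0 set"
  assumes K: "multi_quadratic_field TYPE('k)" and F: "is_subfield F"
    and \<theta>: "\<theta> \<notin> F" "\<theta>^2 \<in> F" and \<alpha>: "\<alpha>^2 = u + v * \<theta>" "u \<in> F" "v \<in> F"
  shows "\<exists>w\<in>F. u^2 - v^2 * \<theta>^2 = w^2"
proof -
  have A: "is_subfield (adjoin F \<theta>)" using F \<theta> by (intro is_subfield_adjoin)
  have "\<alpha>^2 \<in> adjoin F \<theta>" using \<alpha> by (auto simp: adjoin_def)
  then obtain c w where c: "c \<in> \<rat>" and "w \<in> adjoin F \<theta>" "\<alpha>^2 = c * w^2"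
    using multi_quadratic_tower[OF K A, of \<alpha> \<alpha>] square_in_tower[OF A] by metis
  then obtain p q where pq: "p \<in> F" "q \<in> F" "\<alpha>^2 = c * (p + q * \<theta>)^2"
    unfolding adjoin_def by auto
  have cF: "c \<in> F" using c Rats_subset_subfield[OF F] by auto
  note Fi = subfieldI[OF F]
  have "u + v * \<theta> = c * (p^2 + q^2 * \<theta>^2) + (2 * c * p * q) * \<theta>"
    using pq(3) unfolding \<alpha>(1) by algebra
  then have "u = c * (p^2 + q^2 * \<theta>^2) \<and> v = 2 * c * p * q"
    by (rule adjoin_eq_iff[OF F \<theta>(1), rotated 4]) (intro \<alpha> pq Fi cF \<theta>)+
  then have "u^2 - v^2 * \<theta>^2 = (c * (p^2 - q^2 * \<theta>^2))^2" by algebra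
  moreover have "c * (p^2 - q^2 * \<theta>^2) \<in> F" by (intro \<alpha> pq Fi cF \<theta>)
  ultimately show ?thesis by blast
qed

section \<open>The 2-power torsion of 24a4\<close>

abbreviation X12 :: "'a::field_char_0 weierstrass" where
  "X12 \<equiv> base_change J1_2_12"

lemma X12_coeffs [simp]: "a1 X12 = 0" "a2 X12 = - 1" "a3 X12 = 0" "a4 X12 = 1" "a6 X12 = 0"
  by (simp_all add: J1_2_12_def of_rat_minus)

lemma on_curve_X12: "on_curve X12 (Affine x y) \<longleftrightarrow> y^2 = x^3 - x^2 + x"
  by simp

lemma elliptic_curve_X12: "elliptic_curve (X12 :: 'a::field_char_0 weierstrass)"
  by (simp add: elliptic_curve_def discr_def b2_def b4_def b6_def b8_def)

lemma rat_square_int: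
  assumes "(q::rat)^2 = of_int n"
  shows "\<exists>m. n = m^2"
proof -
  obtain a b where q: "q = of_int a / of_int b" "coprime a b" "b > 0"
    using quotient_of_unique[of q] by (metis quotient_of_div quotient_of_coprime quotient_of_denom_pos prod.exhaust)
  have "of_int (a^2) = (of_int (n * b^2) :: rat)"
    using assms q by (simp add: field_simps)
  then have ab: "a^2 = n * b^2" by (simp only: of_int_eq_iff)
  have "coprime (b^2) (a^2)" using q(2) by (simp add: coprime_commute)
  moreover have "b^2 dvd a^2" using ab by simp
  ultimately have "is_unit (b^2)" by (metis coprime_absorb_left)
  then have "b = 1" using q(3) by (auto simp: is_unit_power_iff power2_eq_1_iff)
  then show ?thesis using ab by auto
qed

lemma int_not_square: "(m::int)^2 \<noteq> 2" "m^2 \<noteq> 3" "m^2 \<noteq> 6"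
proof -
  have "m^2 \<in> {0, 1, 4} \<or> m^2 \<ge> 9"
  proof (cases "\<bar>m\<bar> \<ge> 3")
    case True
    then have "3^2 \<le> \<bar>m\<bar>^2" by (intro power_mono) auto
    then show ?thesis by simp
  next
    case False
    then have "m \<in> {-2, -1, 0, 1, 2}" by auto
    then show ?thesis by auto
  qed
  then show "m^2 \<noteq> 2" "m^2 \<noteq> 3" "m^2 \<noteq> 6" by auto
qed

lemma rat_not_square: "(q::rat)^2 \<noteq> 2" "q^2 \<noteq> 3" "q^2 \<noteq> 6"
  using rat_square_int[of q 2] rat_square_int[of q 3] rat_square_int[of q 6] int_not_square by force+

lemma of_rat_square_iff: "(of_rat q :: 'a::field_char_0)^2 = of_rat p \<longleftrightarrow> q^2 = p"
  by (simp flip: of_rat_power)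

lemma adjoin_Rats_square:
  fixes w :: "'a::field_char_0"
  assumes w: "w^2 = of_rat d" "w \<notin> \<rat>" and y: "y \<in> adjoin \<rat> w" "y^2 = of_rat p + of_rat q * w"
  shows "\<exists>a b. a^2 + d * b^2 = p \<and> 2 * a * b = q"
proof -
  obtain a b where y': "y = of_rat a + of_rat b * w"
    using y(1) unfolding adjoin_def by (auto elim!: Rats_cases)
  have "y^2 = of_rat (a^2 + d * b^2) + of_rat (2 * a * b) * w"
    unfolding y' of_rat_add of_rat_mult of_rat_power w(1)[symmetric] of_rat_numeral_eq by algebra
  then have "of_rat (a^2 + d * b^2) + of_rat (2 * a * b) * w = of_rat p + of_rat q * w"
    using y(2) by simp
  from adjoin_eq_iff[OF is_subfield_Rats w(2) _ _ _ _ this] show ?thesis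
    by (auto simp only: Rats_of_rat of_rat_eq_iff)
qed

lemma minus_third_not_square: "(q::rat)^2 \<noteq> - 1 / 3" "q^2 \<noteq> 1 / 3"
proof -
  have "0 \<le> q^2" by simp
  then show "q^2 \<noteq> - 1 / 3" by linarith
  show "q^2 \<noteq> 1 / 3"
  proof
    assume "q^2 = 1 / 3"
    then have "(3 * q)^2 = 3" by (simp add: power_mult_distrib)
    then show False using rat_not_square by blast
  qed
qed

text \<open>With \<open>Infinity\<close> these are 16 points over
  \<open>\<rat>(i, \<surd>3)\<close>, a group of type Z/2 x Z/8. The 2-torsion is
  \<open>s = 0\<close> and \<open>s^2 - s + 1 = 0\<close>, the points of order 4 are
  \<open>s = 1\<close> and \<open>s = - 1\<close>, and the last two quadratics give order 8.
  Polynomial conditions are used because the field may contain only some of the roots.\<close>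

definition cusp_abscissa :: "'a::field_char_0 \<Rightarrow> bool" where
  "cusp_abscissa s \<longleftrightarrow> s = 0 \<or> s = 1 \<or> s = - 1 \<or> s^2 - s + 1 = 0 \<or> s^2 + 1 = 0 \<or> s^2 - 4 * s + 1 = 0"

lemma X12_double:
  fixes x :: "'a::field_char_0"
  assumes on: "on_curve X12 (Affine x y)" and y: "y \<noteq> 0"
  obtains X Y where "ec_add X12 (Affine x y) (Affine x y) = Affine X Y" "4 * y^2 * X = (x^2 - 1)^2"
proof -
  define l where "l = ec_slope X12 x y x y"
  have l: "l * (2 * y) = 3 * x^2 - 2 * x + 1" using y by (simp add: l_def ec_slope_def)
  define X where "X = l^2 + 1 - x - x"
  have "ec_add X12 (Affine x y) (Affine x y) = Affine X (l * (x - X) - y)"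
    using ec_add_slope[OF _ l_def, of X] y by (simp add: X_def)
  moreover have "4 * y^2 * X = (x^2 - 1)^2"
    using l on unfolding on_curve_X12 X_def by algebra
  ultimately show thesis using that by blast
qed

context
  fixes s t X :: "'k::field_char_0"
  assumes K: "multi_quadratic_field TYPE('k)"
    and on: "t^2 = s^3 - s^2 + s" and t: "t \<noteq> 0" and X: "4 * t^2 * X = (s^2 - 1)^2"
begin

text \<open>Since \<open>X\<close> is the abscissa of the double of \<open>(s, t)\<close>, the square \<open>z\<close> is a root of a quadratic equation over
  \<open>\<rat>(X)\<close> whose discriminant is \<open>16 (X\<^sup>2 - X + 1)\<close> and whose roots have product \<open>- 1/3\<close>.\<close>

private definition "z = (s / t)^2"

private lemma z: "4 * X * z = 2 * z - 3 * z^2 + 1"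
proof -
  have zt: "z * t^2 = s^2" using t by (simp add: z_def power_divide)
  have s0: "s \<noteq> 0" "s^2 - s + 1 \<noteq> 0"
  proof -
    have "s * (s^2 - s + 1) = t^2" using on by algebra
    then show "s \<noteq> 0" "s^2 - s + 1 \<noteq> 0" using t by auto
  qed
  have "s * (z * (s^2 - s + 1)) = s * s" using zt on by algebra
  then have z: "z * (s^2 - s + 1) = s" using s0 by simp
  have X': "4 * X * s * (s^2 - s + 1) = (s^2 - 1)^2" using X on by algebra
  have "(s^2 - s + 1)^2 * (4 * X * z - (2 * z - 3 * z^2 + 1))
      = 4 * X * (z * (s^2 - s + 1)) * (s^2 - s + 1) - 2 * (z * (s^2 - s + 1)) * (s^2 - s + 1)
        + 3 * (z * (s^2 - s + 1))^2 - (s^2 - s + 1)^2"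
    by algebra
  also have "\<dots> = 0" unfolding z X' by algebra
  finally show ?thesis using s0 by simp
qed

private definition "\<theta> = (3 * z - (1 - 2 * X)) / 2"

private lemma \<theta>: "\<theta>^2 = X^2 - X + 1"
proof -
  have "2 * \<theta> = 3 * z - (1 - 2 * X)" by (simp add: \<theta>_def)
  then have "4 * (\<theta>^2 - (X^2 - X + 1)) = 0" using z by algebra
  then show ?thesis by (simp only: mult_eq_0_iff) simp
qed

text \<open>Here \<open>z\<close> is a square in the big field, and \<open>z\<close> and its
  conjugate over \<open>F\<close> are the two roots of the quadratic equation. The norm of
  \<open>z\<close> is their product \<open>- 1 / 3\<close>, which
  \<open>multi_quadratic_norm\<close> makes a square in \<open>F\<close>.\<close>

private lemma third: "\<exists>w\<in>F. w^2 = - 1 / 3"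
  if F: "is_subfield F" "X \<in> F" and "\<theta> \<notin> F"
proof -
  note Fi = subfieldI[OF F(1)]
  have "(s / t)^2 = (1 - 2 * X) / 3 + 2 / 3 * \<theta>"
    unfolding z_def[symmetric] by (simp add: \<theta>_def field_simps)
  moreover have "\<theta>^2 \<in> F" unfolding \<theta> by (intro Fi F)
  moreover have "(1 - 2 * X) / 3 \<in> F" "2 / 3 \<in> F" by (intro Fi F)+
  ultimately obtain w where w: "w \<in> F" "((1 - 2 * X) / 3)^2 - (2 / 3)^2 * \<theta>^2 = w^2"
    using multi_quadratic_norm[OF K F(1) \<open>\<theta> \<notin> F\<close>] by metis
  have "9 * (((1 - 2 * X) / 3)^2 - (2 / 3)^2 * \<theta>^2) = (1 - 2 * X)^2 - 4 * \<theta>^2"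
    by (simp add: power_divide algebra_simps)
  also have "\<dots> = - 3" unfolding \<theta> by algebra
  finally have "w^2 = - 1 / 3" unfolding w(2) by (simp add: field_simps)
  with w show ?thesis by blast
qed

private lemma sqrt_notin_Rats: "x \<notin> \<rat>" if "x^2 = of_rat d" "\<And>q. q^2 \<noteq> d" for x :: 'k and d
  using that by (auto elim!: Rats_cases simp: of_rat_square_iff)

text \<open>The only cuspidal abscissas that can be halved are 0 and 1. The first has halves with
  \<open>s = 1\<close> or \<open>s = - 1\<close>, the second has halves with
  \<open>s^2 + 1 = 0\<close> or \<open>s^2 - 4 * s + 1 = 0\<close>; these are cuspidal
  again.\<close>

lemma cusp_abscissa_half:
  assumes "cusp_abscissa X"
  shows "cusp_abscissa s"
proof -
  have "X \<noteq> - 1"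
  proof
    assume X1: "X = - 1"
    have "\<theta>^2 = of_rat 3" using \<theta> unfolding X1 by simp
    from sqrt_notin_Rats[OF this rat_not_square(2)] have "\<theta> \<notin> \<rat>" .
    then obtain w :: 'k where "w \<in> \<rat>" "w^2 = - 1 / 3"
      using third[OF is_subfield_Rats] X1 by auto
    then have "w^2 = of_rat (- 1 / 3)" by (simp add: of_rat_divide of_rat_minus)
    from sqrt_notin_Rats[OF this minus_third_not_square(1)] \<open>w \<in> \<rat>\<close> show False by simp
  qed
  moreover have "X^2 - X + 1 \<noteq> 0"
  proof
    assume X1: "X^2 - X + 1 = 0"
    have t3: "(1 - 2 * X)^2 = of_rat (- 3)" using X1 by (simp add: of_rat_minus) algebra
    have "\<And>q::rat. q^2 \<noteq> - 3" by (metis zero_le_power2 neg_0_le_iff_le not_numeral_le_zero)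
    with t3 have notin: "1 - 2 * X \<notin> \<rat>" by (intro sqrt_notin_Rats)
    have "\<theta> = 0" using \<theta> X1 by simp
    \<comment> \<open>The discriminant vanishes, so \<open>third\<close> does not apply. Now
      \<open>z\<close> itself is a third of a square root of -3, and its norm to the rationals is
      \<open>1 / 3\<close>.\<close>
    then have "(s / t)^2 = 0 + 1 / 3 * (1 - 2 * X)"
      unfolding z_def[symmetric] by (simp add: \<theta>_def field_simps)
    moreover have "(1 - 2 * X)^2 \<in> \<rat>" unfolding t3 by simp
    ultimately obtain w where w: "w \<in> \<rat>" "0^2 - (1 / 3)^2 * (1 - 2 * X)^2 = w^2"
      using multi_quadratic_norm[OF K is_subfield_Rats notin] by (metis Rats_0 Rats_1 Rats_divide Rats_number_of)
    then have "w^2 = of_rat (1 / 3)" unfolding t3 by (simp add: of_rat_divide of_rat_minus power2_eq_square)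
    from sqrt_notin_Rats[OF this minus_third_not_square(2)] \<open>w \<in> \<rat>\<close> show False by simp
  qed
  moreover have "X^2 + 1 \<noteq> 0"
  proof
    assume X1: "X^2 + 1 = 0"
    then have X2: "X^2 = of_rat (- 1)" by (simp add: of_rat_minus eq_neg_iff_add_eq_0)
    have "\<And>q::rat. q^2 \<noteq> - 1" by (metis zero_le_power2 neg_0_le_iff_le not_one_le_zero)
    with X2 have notin: "X \<notin> \<rat>" by (intro sqrt_notin_Rats)
    have F: "is_subfield (adjoin \<rat> X)" using X2 by (intro is_subfield_adjoin is_subfield_Rats) simp
    \<comment> \<open>Here \<open>\<theta>^2 = - X\<close> is a primitive fourth root of unity; a
      square root of it in \<open>\<rat>(i)\<close> would make 2 a rational square.\<close>
    have "\<theta> \<notin> adjoin \<rat> X"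
    proof
      assume "\<theta> \<in> adjoin \<rat> X"
      moreover have "\<theta>^2 = of_rat 0 + of_rat (- 1) * X" unfolding \<theta> using X1 by (simp add: of_rat_minus)
      ultimately obtain a b :: rat where "a^2 + (- 1) * b^2 = 0" "2 * a * b = - 1"
        using adjoin_Rats_square[OF X2 notin] by blast
      then have "(2 * a^2 - 1) * (2 * a^2 + 1) = 0" by algebra
      moreover have "2 * a^2 + 1 \<noteq> 0" using zero_le_power2[of a] by linarith
      ultimately have "(2 * a)^2 = 2" by (simp add: power_mult_distrib)
      with rat_not_square show False by blast
    qed
    then obtain w where w: "w \<in> adjoin \<rat> X" "w^2 = - 1 / 3"
      using third[OF F] subset_adjoin(2)[OF is_subfield_Rats] by blast
    then have "w^2 = of_rat (- 1 / 3) + of_rat 0 * X" by (simp add: of_rat_divide of_rat_minus)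
    then obtain a b :: rat where ab: "a^2 + (- 1) * b^2 = - 1 / 3" "2 * a * b = 0"
      using adjoin_Rats_square[OF X2 notin w(1)] by blast
    then have "a^2 = - 1 / 3 \<or> b^2 = 1 / 3" by auto
    with minus_third_not_square show False by blast
  qed
  moreover have "X^2 - 4 * X + 1 \<noteq> 0"
  proof
    assume X1: "X^2 - 4 * X + 1 = 0"
    define r where "r = X - 2"
    have r: "r^2 = of_rat 3" unfolding r_def using X1 by simp algebra
    from sqrt_notin_Rats[OF this rat_not_square(2)] have notin: "r \<notin> \<rat>" .
    have F: "is_subfield (adjoin \<rat> r)" using r by (intro is_subfield_adjoin is_subfield_Rats) simp
    have "X = 2 + 1 * r" by (simp add: r_def)
    then have XF: "X \<in> adjoin \<rat> r" unfolding adjoin_def using Rats_1 Rats_number_of by blast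
    \<comment> \<open>Here \<open>\<theta>^2 = 3 * X\<close>. If \<open>a + b * r\<close> were a
      root, \<open>(2 * a)^2\<close> would solve \<open>m^2 - 24 * m + 108 = 0\<close>, whose
      solutions 6 and 18 are not rational squares.\<close>
    have "\<theta> \<notin> adjoin \<rat> r"
    proof
      assume "\<theta> \<in> adjoin \<rat> r"
      moreover have "\<theta>^2 = of_rat 6 + of_rat 3 * r" unfolding \<theta> r_def using X1 by simp algebra
      ultimately obtain a b :: rat where ab: "a^2 + 3 * b^2 = 6" "2 * a * b = 3"
        using adjoin_Rats_square[OF r notin] by blast
      have "((2 * a)^2 - 6) * ((2 * a)^2 - 2 * 9) = 16 * a^2 * (a^2 + 3 * b^2) - 12 * (2 * a * b)^2 - 96 * a^2 + 108"
        by algebra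
      also have "\<dots> = 0" unfolding ab by simp
      finally have "((2 * a)^2 - 6) * ((2 * a)^2 - 2 * 9) = 0" .
      then have "(2 * a)^2 = 6 \<or> (2 * a)^2 = 2 * 9" by simp
      moreover have "(2 * a)^2 = 2 * 9 \<Longrightarrow> (2 * a / 3)^2 = 2" by (simp add: power_divide)
      ultimately show False using rat_not_square by blast
    qed
    then obtain w where w: "w \<in> adjoin \<rat> r" "w^2 = - 1 / 3"
      using third[OF F XF] by blast
    then have "w^2 = of_rat (- 1 / 3) + of_rat 0 * r" by (simp add: of_rat_divide of_rat_minus)
    then obtain a b :: rat where ab: "a^2 + 3 * b^2 = - 1 / 3"
      using adjoin_Rats_square[OF r notin w(1)] by blast
    have "0 \<le> a^2" "0 \<le> b^2" by simp_all
    with ab show False by linarith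
  qed
  ultimately have "X = 0 \<or> X = 1" using assms by (auto simp: cusp_abscissa_def)
  then show ?thesis
  proof
    assume "X = 0"
    then have "(s - 1) * (s + 1) = 0" using X by simp algebra
    then show ?thesis by (auto simp: cusp_abscissa_def eq_neg_iff_add_eq_0)
  next
    assume "X = 1"
    then have "(s^2 + 1) * (s^2 - 4 * s + 1) = 0" using X on by algebra
    then show ?thesis by (auto simp: cusp_abscissa_def)
  qed
qed

end

section \<open>The odd torsion of 24a4\<close>

lemma (in group) pow_two_odd_one:
  assumes x: "x \<in> carrier G" "x [^] (2::nat) = \<one>" and n: "odd (n::nat)" "x [^] n = \<one>"
  shows "x = \<one>"
proof -
  obtain k where "n = 2 * k + 1" using n(1) by (auto elim: oddE)
  then have "x [^] n = (x [^] (2::nat)) [^] k \<otimes> x"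
    using x(1) by (simp add: nat_pow_pow)
  then show ?thesis using x n by simp
qed

abbreviation MW :: "'a::field_char_0 point monoid" where
  "MW \<equiv> mordell_weil X12"

interpretation MW: comm_group "MW :: 'a::field_char_0 point monoid"
  by (rule comm_group_mordell_weil) (rule elliptic_curve_X12)

lemma carrier_mordell_weil: "carrier (mordell_weil E) = {P. on_curve E P}"
  and mult_mordell_weil: "P \<otimes>\<^bsub>mordell_weil E\<^esub> Q = ec_add E P Q"
  and one_mordell_weil: "\<one>\<^bsub>mordell_weil E\<^esub> = Infinity"
  by (simp_all add: mordell_weil_def)

lemma X12_double_Infinity:
  assumes "on_curve X12 (Affine x y)"
  shows "ec_add X12 (Affine x y) (Affine x y) = Infinity \<longleftrightarrow> y = 0"
  by (auto simp: Let_def)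

section \<open>Doubling and the 2-adic valuation\<close>

text \<open>The 2-adic valuation of \<open>x\<close> is \<open>- k\<close> and \<open>k\<close>, respectively.\<close>

definition even_den :: "nat \<Rightarrow> 'a::field_char_0 \<Rightarrow> bool" where
  "even_den k x \<longleftrightarrow> (\<exists>a b::int. odd a \<and> odd b \<and> x * (2^k * of_int b) = of_int a)"

definition even_num :: "nat \<Rightarrow> 'a::field_char_0 \<Rightarrow> bool" where
  "even_num k x \<longleftrightarrow> (\<exists>a b::int. odd a \<and> odd b \<and> x * of_int b = 2^k * of_int a)"

lemma even_den_unique:
  assumes "even_den k x" "even_den l x"
  shows "k = l"
proof -
  have "\<not> k < l" if "even_den k x" "even_den l x" for k l
  proof
    assume "k < l"
    then obtain m where l: "l = k + Suc m" using less_imp_Suc_add by auto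
    from that obtain a b c d :: int where ab: "odd a" "odd b" "x * (2^k * of_int b) = of_int a"
      and cd: "odd c" "odd d" "x * (2^l * of_int d) = of_int c"
      unfolding even_den_def by blast
    have "of_int c * of_int b = x * (2^l * of_int d) * of_int b" using cd by simp
    also have "\<dots> = 2^Suc m * of_int d * (x * (2^k * of_int b))" unfolding l power_add by (simp only: ac_simps)
    also have "\<dots> = 2^Suc m * of_int d * of_int a" using ab by simp
    finally have "of_int (c * b) = (of_int (2^Suc m * d * a) :: 'a)" by simp
    then have "c * b = 2^Suc m * d * a" by (simp only: of_int_eq_iff)
    then have "even (c * b)" by simp
    with ab cd show False by simp
  qed
  with assms show ?thesis by (meson nat_neq_iff)
qed

lemma int_two_part:
  assumes "(n::int) \<noteq> 0"
  shows "\<exists>k m. odd m \<and> n = 2^k * m"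
proof -
  obtain m where "n = 2 ^ multiplicity 2 n * m" "odd m"
    using multiplicity_decompose'[of n 2] assms by auto
  then show ?thesis by blast
qed

lemma rational_even_cases:
  assumes "x \<in> \<rat>" "x \<noteq> 0"
  shows "(\<exists>k\<ge>1. even_den k x) \<or> (\<exists>k. even_num k x)"
proof -
  obtain r where x: "x = of_rat r" using assms by (auto elim: Rats_cases)
  obtain p q :: int where pq: "r = of_int p / of_int q" "q \<noteq> 0" by (cases r) (auto simp: Fract_of_int_quotient)
  have p0: "p \<noteq> 0" using assms x pq by auto
  obtain i a where a: "odd a" "p = 2^i * a" using int_two_part p0 by metis
  obtain j b where b: "odd b" "q = 2^j * b" using int_two_part pq by metis
  have "x * of_int q = of_int p" unfolding x pq(1) using pq(2) by (simp add: of_rat_divide)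
  then have *: "x * (2^j * of_int b) = 2^i * of_int a" by (simp add: a b)
  show ?thesis
  proof (cases "i \<ge> j")
    case True
    then have "2^i = (2^j * 2^(i - j) :: 'a)" by (simp flip: power_add)
    then have "x * of_int b = 2^(i - j) * of_int a" using * by simp
    then show ?thesis unfolding even_num_def using a b by blast
  next
    case False
    then have "2^j = (2^i * 2^(j - i) :: 'a)" by (simp flip: power_add)
    then have "2^i * (x * (2^(j - i) * of_int b)) = 2^i * of_int a" using * by (simp add: ac_simps)
    then have "x * (2^(j - i) * of_int b) = of_int a" by simp
    then have "even_den (j - i) x" unfolding even_den_def using a b by blast
    then show ?thesis using False by (intro disjI1 exI[of _ "j - i"]) auto
  qed
qed

context
  fixes x y X :: "'a::field_char_0"
  assumes on: "y^2 = x^3 - x^2 + x" and X: "4 * y^2 * X = (x^2 - 1)^2"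
begin

text \<open>This is the doubling formula homogenised by \<open>x = u / v\<close>, so that valuations
  can be read off from parities of integers.\<close>

lemma double_homogeneous:
  assumes "x * v = u"
  shows "(u^2 - v^2)^2 = X * 4 * v * (u * (u^2 - u * v + v^2))"
proof -
  have "(u^2 - v^2)^2 = v^4 * (x^2 - 1)^2"
    unfolding assms[symmetric] by (simp add: algebra_simps eval_nat_numeral)
  also have "\<dots> = v^4 * (4 * (x^3 - x^2 + x) * X)" unfolding X[symmetric] on ..
  also have "\<dots> = X * 4 * v * (u * (u^2 - u * v + v^2))"
    unfolding assms[symmetric] by (simp add: algebra_simps eval_nat_numeral)
  finally show ?thesis .
qed

text \<open>For \<open>x = a / D\<close> with \<open>a\<close> odd and \<open>D\<close> even,
  \<open>a^2 - D^2\<close> and \<open>a^2 - a * D + D^2\<close> are odd. The denominator of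
  \<open>X\<close> thus acquires exactly the power of 2 in \<open>4 * D\<close>.\<close>

lemma even_den_double:
  assumes "even_den k x" "k \<ge> 1"
  shows "even_den (k + 2) X"
proof -
  obtain a b :: int where ab: "odd a" "odd b" "x * (2^k * of_int b) = of_int a"
    using assms unfolding even_den_def by blast
  define D :: int where "D = 2^k * b"
  have D: "even D" using assms(2) by (simp add: D_def)
  have xD: "x * of_int D = of_int a" using ab by (simp add: D_def)
  have "of_int ((a^2 - D^2)^2) = X * 4 * of_int D * (of_int a * ((of_int a)^2 - of_int a * of_int D + (of_int D)^2))"
    using double_homogeneous[OF xD] by simp
  also have "\<dots> = X * (2^(k + 2) * of_int (b * (a * (a^2 - a * D + D^2))))"
    by (simp add: D_def power_add)
  finally show ?thesis
    unfolding even_den_def using ab D by (intro exI[of _ "(a^2 - D^2)^2"] exI[of _ "b * (a * (a^2 - a * D + D^2))"]) auto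
qed

lemma even_num_double:
  assumes "even_num k x" "k \<ge> 1"
  shows "even_den (k + 2) X"
proof -
  obtain a b :: int where ab: "odd a" "odd b" "x * of_int b = 2^k * of_int a"
    using assms unfolding even_num_def by blast
  define A :: int where "A = 2^k * a"
  have A: "even A" using assms(2) by (simp add: A_def)
  have xb: "x * of_int b = of_int A" using ab by (simp add: A_def)
  have "of_int ((A^2 - b^2)^2) = X * 4 * of_int b * (of_int A * ((of_int A)^2 - of_int A * of_int b + (of_int b)^2))"
    using double_homogeneous[OF xb] by simp
  also have "\<dots> = X * (2^(k + 2) * of_int (b * (a * (A^2 - A * b + b^2))))"
    by (simp add: A_def power_add)
  finally show ?thesis
    unfolding even_den_def using ab A by (intro exI[of _ "(A^2 - b^2)^2"] exI[of _ "b * (a * (A^2 - A * b + b^2))"]) auto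
qed

text \<open>Odd squares are congruent modulo 8, so \<open>(a^2 - b^2)^2\<close> is divisible by 64,
  while the denominator contributes only the factor 4.\<close>

lemma odd_double:
  assumes "even_num 0 x" "X \<noteq> 0"
  shows "\<exists>k\<ge>1. even_num k X"
proof -
  obtain a b :: int where ab: "odd a" "odd b" "x * of_int b = of_int a"
    using assms unfolding even_num_def by auto
  have "8 dvd a^2 - b^2" 
  proof -
    obtain i j where "a = 2 * i + 1" "b = 2 * j + 1" using ab by (auto elim!: oddE)
    then have "a^2 - b^2 = 4 * (i * (i + 1)) - 4 * (j * (j + 1))"
      by (simp add: algebra_simps power2_eq_square)
    moreover have "even (i * (i + 1))" "even (j * (j + 1))" by auto
    then have "8 dvd 4 * (i * (i + 1))" "8 dvd 4 * (j * (j + 1))"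
      using mult_dvd_mono[of 4 4 2] by fastforce+
    ultimately show ?thesis by simp
  qed
  then obtain c where c: "a^2 - b^2 = 8 * c" by blast
  have "4 * of_int (16 * c^2) = (of_int ((a^2 - b^2)^2) :: 'a)" unfolding c by simp
  also have "\<dots> = 4 * (X * of_int (b * (a * (a^2 - a * b + b^2))))"
    using double_homogeneous[OF ab(3)] by simp
  finally have e: "X * of_int (b * (a * (a^2 - a * b + b^2))) = of_int (16 * c^2)" by simp
  have o: "odd (b * (a * (a^2 - a * b + b^2)))" using ab by simp
  then have "b * (a * (a^2 - a * b + b^2)) \<noteq> 0" by (metis even_zero)
  then have "X * of_int (b * (a * (a^2 - a * b + b^2))) \<noteq> 0" using assms(2) by (simp only: mult_eq_0_iff of_int_eq_0_iff) simp
  then have "16 * c^2 \<noteq> 0" unfolding e by (simp only: of_int_eq_0_iff) simp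
  then obtain k m where km: "odd m" "16 * c^2 = 2^k * m" using int_two_part by metis
  then have "k \<noteq> 0" by (metis dvd_mult2 even_numeral mult_1 power_0 dvd_triv_left even_mult_iff)
  moreover have "even_num k X" unfolding even_num_def using e o km by (metis of_int_mult of_int_numeral of_int_power)
  ultimately show ?thesis by (intro exI[of _ k]) auto
qed

end

text \<open>Doubling never reaches \<open>Infinity\<close> from a nonzero point of odd order. Hence
  after at most two doublings the abscissas have even denominators, which then grow without bound,
  although the point has only finitely many multiples.\<close>

lemma rational_odd_torsion:
  assumes P: "on_curve X12 P" "P [^]\<^bsub>MW\<^esub> n = Infinity" and n: "odd (n::nat)"
    and rat: "\<And>x y. P = Affine x y \<Longrightarrow> x \<in> \<rat>"
  shows "P = Infinity"
proof (rule ccontr)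
  assume "P \<noteq> Infinity"
  have Pc: "P \<in> carrier MW" using P by (simp add: carrier_mordell_weil)
  define D where "D = (\<lambda>j::nat. P [^]\<^bsub>MW\<^esub> (2^j :: nat))"
  have Pn: "P [^]\<^bsub>MW\<^esub> n = \<one>\<^bsub>MW\<^esub>" using P(2) by (simp add: one_mordell_weil)
  have pow_mod: "P [^]\<^bsub>MW\<^esub> m = P [^]\<^bsub>MW\<^esub> (m mod n)" for m :: nat
  proof -
    have "P [^]\<^bsub>MW\<^esub> (n * (m div n) + m mod n) =
        (P [^]\<^bsub>MW\<^esub> n) [^]\<^bsub>MW\<^esub> (m div n) \<otimes>\<^bsub>MW\<^esub> P [^]\<^bsub>MW\<^esub> (m mod n)"
      unfolding MW.nat_pow_pow[OF Pc] by (rule MW.nat_pow_mult[OF Pc, symmetric])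
    then show ?thesis using Pc unfolding Pn by simp
  qed
  have "range D \<subseteq> (\<lambda>m. P [^]\<^bsub>MW\<^esub> m) ` {..<n}"
    using pow_mod odd_pos[OF n] by (force simp: D_def)
  then have fin: "finite (range D)" by (rule finite_subset) simp
  have DO: "D j \<noteq> Infinity" for j
  proof (induction j)
    case 0
    then show ?case using \<open>P \<noteq> Infinity\<close> Pc by (simp add: D_def)
  next
    case (Suc j)
    have Dc: "D j \<in> carrier MW" using Pc by (simp add: D_def)
    have "D (Suc j) = D j [^]\<^bsub>MW\<^esub> (2::nat)"
      unfolding D_def MW.nat_pow_pow[OF Pc] by (simp add: mult.commute)
    moreover have "D j [^]\<^bsub>MW\<^esub> n = \<one>\<^bsub>MW\<^esub>"
      unfolding D_def MW.nat_pow_pow[OF Pc] using Pn MW.nat_pow_pow[OF Pc, of n "2^j"]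
      by (simp add: mult.commute)
    ultimately show ?case using MW.pow_two_odd_one[OF Dc _ n] Suc by (auto simp: one_mordell_weil)
  qed
  \<comment> \<open>The default 0 at \<open>Infinity\<close> never occurs, by
    \<open>DO\<close>.\<close>
  define x where "x = (\<lambda>j. case D j of Affine x y \<Rightarrow> x | Infinity \<Rightarrow> 0)"
  define y where "y = (\<lambda>j. case D j of Affine x y \<Rightarrow> y | Infinity \<Rightarrow> 0)"
  have Dxy: "D j = Affine (x j) (y j)" for j
    using DO[of j] by (cases "D j") (auto simp: x_def y_def)
  have on: "on_curve X12 (Affine (x j) (y j))" for j
    using MW.nat_pow_closed[OF Pc] unfolding Dxy[symmetric] D_def by (simp add: carrier_mordell_weil)
  then have on': "y j^2 = x j^3 - x j^2 + x j" for j by (simp only: on_curve_X12)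
  have DS: "D (Suc j) = ec_add X12 (D j) (D j)" for j
  proof -
    have "D (Suc j) = D j \<otimes>\<^bsub>MW\<^esub> D j"
      unfolding D_def using Pc by (simp add: MW.nat_pow_mult mult_2)
    then show ?thesis by (simp add: mult_mordell_weil)
  qed
  have y0: "y j \<noteq> 0" for j
    using X12_double_Infinity[OF on[of j]] DS[of j] DO[of "Suc j"] unfolding Dxy[of j] by metis
  have X: "4 * y j^2 * x (Suc j) = (x j^2 - 1)^2" for j
    using X12_double[OF on y0, of j] DS[of j] unfolding Dxy by (metis point.inject)
  have x0: "x j \<noteq> 0" for j using on'[of j] y0[of j] by auto
  have "\<exists>j k. k \<ge> 1 \<and> even_den k (x j)"
  proof -
    have "x 0 \<in> \<rat>" using rat Dxy[of 0] Pc by (simp add: D_def)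
    then consider k where "k \<ge> 1" "even_den k (x 0)" | k where "k \<ge> 1" "even_num k (x 0)" | "even_num 0 (x 0)"
      using rational_even_cases[OF _ x0] by (metis less_one linorder_not_le)
    then show ?thesis
    proof cases
      case 1
      then show ?thesis by blast
    next
      case 2
      then have "even_den (k + 2) (x (Suc 0))" using even_num_double[OF on' X] by blast
      then show ?thesis by (intro exI[of _ "Suc 0"] exI[of _ "k + 2"]) simp
    next
      case 3
      then obtain k where "k \<ge> 1" "even_num k (x (Suc 0))" using odd_double[OF on' X _ x0] by blast
      then have "even_den (k + 2) (x (Suc (Suc 0)))" using even_num_double[OF on' X] by blast
      then show ?thesis by (intro exI[of _ "Suc (Suc 0)"] exI[of _ "k + 2"]) simp
    qed
  qed
  then obtain j k where jk: "k \<ge> 1" "even_den k (x j)" by blast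
  have "even_den (k + 2 * i) (x (j + i))" for i
  proof (induction i)
    case (Suc i)
    have "even_den (k + 2 * i + 2) (x (Suc (j + i)))"
      by (rule even_den_double[OF on' X Suc]) (use jk in simp)
    then show ?case by (simp add: add.assoc)
  qed (use jk in simp)
  then have "inj (\<lambda>i. D (j + i))"
    by (intro injI) (metis even_den_unique x_def add_left_cancel mult_left_cancel zero_neq_numeral)
  moreover have "finite (range (\<lambda>i. D (j + i)))" by (rule finite_subset[OF _ fin]) auto
  ultimately show False using finite_imageD infinite_UNIV_nat by blast
qed

lemma inv_mordell_weil:
  fixes E :: "'a::field_char_0 weierstrass"
  assumes "elliptic_curve E" "on_curve E P"
  shows "inv\<^bsub>mordell_weil E\<^esub> P = ec_neg E P"
proof -
  interpret comm_group "mordell_weil E" by (rule comm_group_mordell_weil[OF assms(1)])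
  have "ec_add E (ec_neg E P) P = Infinity" by (simp add: ec_add_eq_Infinity)
  then show ?thesis using assms(2) on_curve_neg[OF assms(2)]
    by (intro inv_equality) (simp_all add: carrier_mordell_weil mult_mordell_weil one_mordell_weil)
qed

section \<open>Quadratic twists and conjugation\<close>

text \<open>For \<open>r\<^sup>2 \<in> F\<close>, the points \<open>(x, r z)\<close> with \<open>x, z \<in> F\<close> are those of a quadratic twist over \<open>F\<close>.\<close>

definition twisted :: "'a::field set \<Rightarrow> 'a \<Rightarrow> 'a point \<Rightarrow> bool" where
  "twisted F r P \<longleftrightarrow> P = Infinity \<or> (\<exists>x\<in>F. \<exists>z\<in>F. P = Affine x (r * z))"

text \<open>Conjugation acts on the twist \<open>r^2 * z^2 = x^3 - x^2 + x\<close>, where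
  \<open>y = r * z\<close>, and is transported to the original curve. The factor \<open>r\<close> is
  kept fixed, whether or not it lies in the domain of interest of \<sigma>.\<close>

fun point_conj :: "('a::field \<Rightarrow> 'a) \<Rightarrow> 'a \<Rightarrow> 'a point \<Rightarrow> 'a point" where
  "point_conj \<sigma> r Infinity = Infinity"
| "point_conj \<sigma> r (Affine x y) = Affine (\<sigma> x) (r * \<sigma> (y / r))"

text \<open>The slope on \<open>\<rho> * z^2 = x^3 - x^2 + x\<close>. With
  \<open>\<rho> = r^2\<close> it lies in the field of the coordinates \<open>x\<close>,
  \<open>z\<close>, and \<open>r\<close> times it is the slope on the original curve.\<close>

definition twist_slope :: "'a::field \<Rightarrow> 'a \<Rightarrow> 'a \<Rightarrow> 'a \<Rightarrow> 'a \<Rightarrow> 'a" where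
  "twist_slope \<rho> x1 z1 x2 z2 =
     (if x1 = x2 then (3 * x1^2 - 2 * x1 + 1) / (2 * \<rho> * z1) else (z2 - z1) / (x2 - x1))"

lemma twisted_add:
  fixes r :: "'a::field_char_0"
  assumes r: "r \<noteq> 0" and on: "on_curve X12 (Affine x1 (r * z1))" "on_curve X12 (Affine x2 (r * z2))"
    and ne: "\<not> (x1 = x2 \<and> z1 + z2 = 0)"
  defines "l \<equiv> twist_slope (r^2) x1 z1 x2 z2"
  defines "x3 \<equiv> r^2 * l^2 + 1 - x1 - x2"
  shows "ec_add X12 (Affine x1 (r * z1)) (Affine x2 (r * z2)) = Affine x3 (r * (l * (x1 - x3) - z1))"
proof -
  have ne': "x1 = x2 \<Longrightarrow> r * z1 + r * z2 \<noteq> 0" using ne r by (simp flip: distrib_left)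
  have l: "r * l = ec_slope X12 x1 (r * z1) x2 (r * z2)"
    using r by (auto simp: l_def twist_slope_def ec_slope_def power2_eq_square right_diff_distrib)
  have "x3 = (r * l)^2 + a1 X12 * (r * l) - a2 X12 - x1 - x2"
    by (simp add: x3_def power_mult_distrib)
  from ec_add_slope[OF _ l this] ne' show ?thesis by (simp add: algebra_simps)
qed

context
  fixes F :: "'a::field_char_0 set" and \<sigma> :: "'a \<Rightarrow> 'a" and r :: 'a
  assumes F: "is_subfield F" and closed: "\<And>x. x \<in> F \<Longrightarrow> \<sigma> x \<in> F"
    and add: "\<And>x y. x \<in> F \<Longrightarrow> y \<in> F \<Longrightarrow> \<sigma> (x + y) = \<sigma> x + \<sigma> y"
    and mult: "\<And>x y. x \<in> F \<Longrightarrow> y \<in> F \<Longrightarrow> \<sigma> (x * y) = \<sigma> x * \<sigma> y" and one: "\<sigma> 1 = 1"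
    and r: "r \<noteq> 0" "r^2 \<in> F" "\<sigma> (r^2) = r^2"
begin

private lemmas Fi = subfieldI[OF F]

private lemma hom:
  "\<sigma> 0 = 0" "x \<in> F \<Longrightarrow> \<sigma> (- x) = - \<sigma> x" "x \<in> F \<Longrightarrow> y \<in> F \<Longrightarrow> \<sigma> (x - y) = \<sigma> x - \<sigma> y"
  "x \<in> F \<Longrightarrow> \<sigma> x = 0 \<longleftrightarrow> x = 0" "x \<in> F \<Longrightarrow> y \<in> F \<Longrightarrow> \<sigma> (x / y) = \<sigma> x / \<sigma> y"
  "x \<in> F \<Longrightarrow> \<sigma> (x ^ n) = \<sigma> x ^ n" "\<sigma> (numeral k) = numeral k"
proof -
  have "\<sigma> 0 + \<sigma> 0 = \<sigma> 0" using add[of 0 0] Fi(1) by simp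
  then show 0: "\<sigma> 0 = 0" by simp
  have neg: "\<sigma> (- x) = - \<sigma> x" if "x \<in> F" for x
    using add[of x "- x"] that Fi(7) 0 by (simp add: eq_neg_iff_add_eq_0 add.commute)
  then show "x \<in> F \<Longrightarrow> \<sigma> (- x) = - \<sigma> x" .
  show "x \<in> F \<Longrightarrow> y \<in> F \<Longrightarrow> \<sigma> (x - y) = \<sigma> x - \<sigma> y"
    using add[of x "- y"] Fi(7)[of y] neg[of y] by simp
  have inj: "\<sigma> x = 0 \<longleftrightarrow> x = 0" if "x \<in> F" for x
  proof
    assume "\<sigma> x = 0"
    moreover have "x \<noteq> 0 \<Longrightarrow> \<sigma> x * \<sigma> (1 / x) = 1"
      using mult[OF that Fi(6)[OF Fi(2) that]] one by simp
    ultimately show "x = 0" by auto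
  qed (simp add: 0)
  then show "x \<in> F \<Longrightarrow> \<sigma> x = 0 \<longleftrightarrow> x = 0" .
  show "\<sigma> (x / y) = \<sigma> x / \<sigma> y" if "x \<in> F" "y \<in> F"
  proof (cases "y = 0")
    case False
    have "\<sigma> (x / y) * \<sigma> y = \<sigma> x" using mult[OF Fi(6)[OF that] that(2)] False by simp
    then show ?thesis using inj[OF that(2)] False by (simp add: field_simps)
  qed (simp add: 0)
  show "x \<in> F \<Longrightarrow> \<sigma> (x ^ n) = \<sigma> x ^ n"
    by (induction n) (simp_all add: one mult Fi(8))
  have "of_nat n \<in> F \<and> \<sigma> (of_nat n) = of_nat n" for n
    by (induction n) (simp_all add: 0 one add Fi(1-3))
  from this[of "numeral k"] show "\<sigma> (numeral k) = numeral k" by simp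
qed

private lemma on_curve_conj:
  assumes "x \<in> F" "z \<in> F" "on_curve X12 (Affine x (r * z))"
  shows "on_curve X12 (Affine (\<sigma> x) (r * \<sigma> z))"
proof -
  have "r^2 * z^2 = x^3 - x^2 + x" using assms(3) unfolding on_curve_X12 by (simp add: power_mult_distrib)
  then have "\<sigma> (r^2 * z^2) = \<sigma> (x^3 - x^2 + x)" by simp
  then have "r^2 * \<sigma> z^2 = \<sigma> x^3 - \<sigma> x^2 + \<sigma> x"
    using assms r by (simp add: add mult hom Fi)
  then show ?thesis unfolding on_curve_X12 by (simp add: power_mult_distrib)
qed

text \<open>In the coordinates \<open>x\<close>, \<open>z\<close> the addition formulas are rational
  over \<open>F\<close>, with \<open>r\<close> occurring only as \<open>r^2\<close>, which \<sigma>
  fixes; so \<sigma> commutes with them. The case distinctions are preserved because \<sigma> is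
  injective on \<open>F\<close>.\<close>

lemma twisted_conj_add:
  assumes PQ: "twisted F r P" "twisted F r Q" "on_curve X12 P" "on_curve X12 Q"
  shows "twisted F r (ec_add X12 P Q)"
    "point_conj \<sigma> r (ec_add X12 P Q) = ec_add X12 (point_conj \<sigma> r P) (point_conj \<sigma> r Q)"
proof -
  have "twisted F r (ec_add X12 P Q) \<and>
    point_conj \<sigma> r (ec_add X12 P Q) = ec_add X12 (point_conj \<sigma> r P) (point_conj \<sigma> r Q)"
  proof (cases "P = Infinity \<or> Q = Infinity")
    case False
    then obtain x1 z1 x2 z2 where P: "P = Affine x1 (r * z1)" and Q: "Q = Affine x2 (r * z2)"
      and xz: "x1 \<in> F" "z1 \<in> F" "x2 \<in> F" "z2 \<in> F"
      using PQ unfolding twisted_def by blast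
    have conj: "point_conj \<sigma> r (Affine x (r * z)) = Affine (\<sigma> x) (r * \<sigma> z)" for x z
      using r by simp
    have onc: "on_curve X12 (Affine (\<sigma> x1) (r * \<sigma> z1))" "on_curve X12 (Affine (\<sigma> x2) (r * \<sigma> z2))"
      using on_curve_conj PQ(3,4) xz unfolding P Q by blast+
    have x12: "\<sigma> x1 = \<sigma> x2 \<longleftrightarrow> x1 = x2" using hom(3)[of x1 x2] hom(4)[of "x1 - x2"] Fi(5)[of x1 x2] xz by simp
    have z12: "\<sigma> z1 + \<sigma> z2 = 0 \<longleftrightarrow> z1 + z2 = 0" using add[of z1 z2] hom(4)[of "z1 + z2"] Fi(3)[of z1 z2] xz by simp
    show ?thesis
    proof (cases "x1 = x2 \<and> z1 + z2 = 0")
      case True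
      then have "r * z1 + r * z2 = 0" "r * \<sigma> z1 + r * \<sigma> z2 = 0"
        using z12 by (simp_all flip: distrib_left)
      then have "ec_add X12 P Q = Infinity" "ec_add X12 (point_conj \<sigma> r P) (point_conj \<sigma> r Q) = Infinity"
        using True x12 unfolding P Q conj by simp_all
      then show ?thesis by (simp add: twisted_def)
    next
      case ne: False
      define l where "l = twist_slope (r^2) x1 z1 x2 z2"
      define x3 where "x3 = r^2 * l^2 + 1 - x1 - x2"
      have lF: "l \<in> F" unfolding l_def twist_slope_def using xz r Fi by simp
      have x3F: "x3 \<in> F" unfolding x3_def by (intro Fi xz r lF)
      have l: "\<sigma> l = twist_slope (r^2) (\<sigma> x1) (\<sigma> z1) (\<sigma> x2) (\<sigma> z2)"
        unfolding l_def twist_slope_def using xz r by (simp add: x12 add mult hom Fi one)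
      have x3: "\<sigma> x3 = r^2 * (\<sigma> l)^2 + 1 - \<sigma> x1 - \<sigma> x2"
        unfolding x3_def using xz r lF by (simp add: add mult hom Fi one)
      have PQ': "ec_add X12 P Q = Affine x3 (r * (l * (x1 - x3) - z1))"
        unfolding P Q x3_def l_def using twisted_add r(1) PQ(3,4) ne unfolding P Q by blast
      have "ec_add X12 (point_conj \<sigma> r P) (point_conj \<sigma> r Q) = Affine (\<sigma> x3) (r * (\<sigma> l * (\<sigma> x1 - \<sigma> x3) - \<sigma> z1))"
        unfolding P Q x3 l conj using twisted_add[OF r(1) onc] ne x12 z12 by blast
      also have "\<sigma> l * (\<sigma> x1 - \<sigma> x3) - \<sigma> z1 = \<sigma> (l * (x1 - x3) - z1)"
        using xz lF x3F by (simp add: mult hom Fi)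
      finally have "ec_add X12 (point_conj \<sigma> r P) (point_conj \<sigma> r Q) = point_conj \<sigma> r (ec_add X12 P Q)"
        unfolding PQ' conj .
      moreover have "l * (x1 - x3) - z1 \<in> F" by (intro Fi lF x3F xz)
      then have "twisted F r (ec_add X12 P Q)"
        unfolding PQ' twisted_def using x3F by blast
      ultimately show ?thesis by simp
    qed
  qed (use PQ in auto)
  then show "twisted F r (ec_add X12 P Q)"
    "point_conj \<sigma> r (ec_add X12 P Q) = ec_add X12 (point_conj \<sigma> r P) (point_conj \<sigma> r Q)" by auto
qed

lemma twisted_conj:
  assumes P: "twisted F r P" "on_curve X12 P"
  shows "twisted F r (point_conj \<sigma> r P)" "on_curve X12 (point_conj \<sigma> r P)"
    "twisted F r (ec_neg X12 P)" "point_conj \<sigma> r (ec_neg X12 P) = ec_neg X12 (point_conj \<sigma> r P)"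
proof (atomize (full), cases "P = Infinity")
  case False
  then obtain x z where P': "P = Affine x (r * z)" "x \<in> F" "z \<in> F"
    using P unfolding twisted_def by blast
  have neg: "ec_neg X12 P = Affine x (r * (- z))" by (simp add: P')
  have c: "point_conj \<sigma> r P = Affine (\<sigma> x) (r * \<sigma> z)" using r(1) by (simp add: P')
  have "twisted F r (point_conj \<sigma> r P)" "twisted F r (ec_neg X12 P)"
    unfolding twisted_def c neg using P'(2,3) closed Fi(7) by blast+
  moreover have "on_curve X12 (point_conj \<sigma> r P)"
    unfolding c using on_curve_conj P' P(2) by blast
  moreover have "point_conj \<sigma> r (ec_neg X12 P) = ec_neg X12 (point_conj \<sigma> r P)"
    unfolding c unfolding neg using P'(3) r(1) by (simp add: hom)
  ultimately show "(twisted F r (point_conj \<sigma> r P) \<and> on_curve X12 (point_conj \<sigma> r P)) \<and>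
      twisted F r (ec_neg X12 P) \<and> point_conj \<sigma> r (ec_neg X12 P) = ec_neg X12 (point_conj \<sigma> r P)"
    by blast
qed (auto simp: twisted_def)

lemma point_conj_pow:
  assumes P: "twisted F r P" "on_curve X12 P"
  shows "twisted F r (P [^]\<^bsub>MW\<^esub> (n::nat)) \<and> point_conj \<sigma> r (P [^]\<^bsub>MW\<^esub> n) = point_conj \<sigma> r P [^]\<^bsub>MW\<^esub> n"
proof (induction n)
  case 0
  then show ?case by (simp add: one_mordell_weil twisted_def)
next
  case (Suc n)
  have "on_curve X12 (P [^]\<^bsub>MW\<^esub> n)"
    using MW.nat_pow_closed[of P n] P by (simp add: carrier_mordell_weil)
  from twisted_conj_add[OF _ P(1) this P(2)] Suc show ?case by (simp add: mult_mordell_weil)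
qed

end

section \<open>Descent along a tower\<close>

lemma adjoin_conj:
  assumes F: "is_subfield F" "\<theta> \<notin> F"
  obtains \<sigma> where "\<And>a b. a \<in> F \<Longrightarrow> b \<in> F \<Longrightarrow> \<sigma> (a + b * \<theta>) = a - b * \<theta>"
proof
  define \<sigma> where "\<sigma> x = (THE y. \<exists>a\<in>F. \<exists>b\<in>F. x = a + b * \<theta> \<and> y = a - b * \<theta>)" for x
  fix a b assume ab: "a \<in> F" "b \<in> F"
  show "\<sigma> (a + b * \<theta>) = a - b * \<theta>"
    unfolding \<sigma>_def
  proof (rule the_equality)
    fix y assume "\<exists>c\<in>F. \<exists>d\<in>F. a + b * \<theta> = c + d * \<theta> \<and> y = c - d * \<theta>"
    then obtain c d where cd: "c \<in> F" "d \<in> F" "a + b * \<theta> = c + d * \<theta>" and y: "y = c - d * \<theta>" by blast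
    from adjoin_eq_iff[OF F ab cd] show "y = a - b * \<theta>" by (simp add: y)
  qed (use ab in blast)
qed

text \<open>The statement must cover all twists by square roots of rationals, since removing
  \<theta> from the tower replaces a twist by \<open>r\<close> with twists by \<open>r\<close> and
  by \<open>r * \<theta>\<close>. Both resulting points vanish by induction, so the point is its own
  negative and, having odd order, is zero.\<close>

lemma odd_torsion_tower:
  fixes r :: "'a::field_char_0"
  assumes sq: "\<And>\<theta>. \<theta> \<in> set \<theta>s \<Longrightarrow> \<theta>^2 \<in> \<rat>" and n: "odd (n::nat)"
    and r: "r \<noteq> 0" "r^2 \<in> \<rat>"
    and P: "twisted (tower \<rat> \<theta>s) r P" "on_curve X12 P" "P [^]\<^bsub>MW\<^esub> n = \<one>\<^bsub>MW\<^esub>"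
  shows "P = Infinity"
  using sq r P
proof (induction \<theta>s arbitrary: r P)
  case Nil
  have "x \<in> \<rat>" if "P = Affine x y" for x y
    using Nil.prems(4) that unfolding twisted_def by auto
  with Nil.prems(5,6) n show ?case
    unfolding one_mordell_weil by (rule rational_odd_torsion)
next
  case (Cons \<theta> \<theta>s)
  let ?T = "tower \<rat> \<theta>s"
  have T: "is_subfield ?T" "\<rat> \<subseteq> ?T"
    using is_subfield_tower[OF is_subfield_Rats, of \<theta>s] subset_tower[OF is_subfield_Rats, of \<theta>s] Cons.prems(1)
    by auto
  note Ti = subfieldI[OF T(1)]
  note IH = Cons.IH[OF Cons.prems(1)[OF list.set_intros(2)]]
  show ?case
  proof (cases "\<theta> \<in> ?T")
    case True
    then show ?thesis using Cons.prems T by (intro IH) (auto simp: adjoin_mem)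
  next
    case \<theta>: False
    let ?F = "adjoin ?T \<theta>"
    have d: "\<theta>^2 \<in> ?T" using Cons.prems(1) T(2) by auto
    have F: "is_subfield ?F" by (rule is_subfield_adjoin[OF T(1) d])
    obtain \<sigma> where \<sigma>: "\<And>a b. a \<in> ?T \<Longrightarrow> b \<in> ?T \<Longrightarrow> \<sigma> (a + b * \<theta>) = a - b * \<theta>"
      using adjoin_conj[OF T(1) \<theta>] by blast
    have \<sigma>T: "\<sigma> a = a" if "a \<in> ?T" for a using \<sigma>[OF that Ti(1)] by simp
    have F_E: "\<exists>a\<in>?T. \<exists>b\<in>?T. x = a + b * \<theta>" if "x \<in> ?F" for x
      using that unfolding adjoin_def by blast
    have F_I: "a + b * \<theta> \<in> ?F" "a - b * \<theta> \<in> ?F" if "a \<in> ?T" "b \<in> ?T" for a b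
    proof -
      show "a + b * \<theta> \<in> ?F" using that unfolding adjoin_def by blast
      have "a - b * \<theta> = a + (- b) * \<theta>" by simp
      then show "a - b * \<theta> \<in> ?F" using that Ti(7) unfolding adjoin_def by blast
    qed
    have closed: "\<sigma> x \<in> ?F" if "x \<in> ?F" for x
      using F_E[OF that] F_I \<sigma> by auto
    have add: "\<sigma> (x + y) = \<sigma> x + \<sigma> y" and mult: "\<sigma> (x * y) = \<sigma> x * \<sigma> y" if xy: "x \<in> ?F" "y \<in> ?F" for x y
    proof -
      obtain a b c e where x: "x = a + b * \<theta>" and y: "y = c + e * \<theta>" and m: "a \<in> ?T" "b \<in> ?T" "c \<in> ?T" "e \<in> ?T"
        using F_E[OF xy(1)] F_E[OF xy(2)] by blast
      have "x + y = (a + c) + (b + e) * \<theta>" unfolding x y by algebra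
      then have "\<sigma> (x + y) = (a + c) - (b + e) * \<theta>" using \<sigma>[OF Ti(3)[OF m(1,3)] Ti(3)[OF m(2,4)]] by simp
      also have "\<dots> = \<sigma> x + \<sigma> y" unfolding x y \<sigma>[OF m(1,2)] \<sigma>[OF m(3,4)] by algebra
      finally show "\<sigma> (x + y) = \<sigma> x + \<sigma> y" .
      have "x * y = (a * c + b * e * \<theta>^2) + (a * e + b * c) * \<theta>" unfolding x y by algebra
      moreover have "a * c + b * e * \<theta>^2 \<in> ?T" "a * e + b * c \<in> ?T" by (intro Ti d m)+
      ultimately have "\<sigma> (x * y) = (a * c + b * e * \<theta>^2) - (a * e + b * c) * \<theta>" using \<sigma> by simp
      also have "\<dots> = (a - b * \<theta>) * (c - e * \<theta>)" by algebra
      finally show "\<sigma> (x * y) = \<sigma> x * \<sigma> y" unfolding x y \<sigma>[OF m(1,2)] \<sigma>[OF m(3,4)] .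
    qed
    have fixed: "x \<in> ?T" if x: "x \<in> ?F" "\<sigma> x = x" for x
    proof -
      obtain a b where x': "x = a + b * \<theta>" and m: "a \<in> ?T" "b \<in> ?T" using F_E[OF x(1)] by blast
      have "a + (- b) * \<theta> = a + b * \<theta>" using x(2) \<sigma>[OF m] unfolding x' by simp
      from adjoin_eq_iff[OF T(1) \<theta> m(1) Ti(7)[OF m(2)] m this] have "b = 0" by simp
      then show ?thesis using m x' by simp
    qed
    have r2: "r^2 \<in> ?T" using Cons.prems(3) T(2) by auto
    have r2': "r^2 \<in> ?F" "\<sigma> (r^2) = r^2" using r2 subset_adjoin(1)[OF T(1)] \<sigma>T by auto
    note r = \<open>r \<noteq> 0\<close>
    note ctx = F closed add mult \<sigma>T[OF Ti(2)] r r2'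
    have P: "twisted ?F r P" "on_curve X12 P" using Cons.prems by simp_all
    define Q where "Q = point_conj \<sigma> r P"
    have invol: "point_conj \<sigma> r Q = P"
    proof (cases "P = Infinity")
      case False
      then obtain x z where P': "P = Affine x (r * z)" "x \<in> ?F" "z \<in> ?F"
        using P unfolding twisted_def by blast
      have "\<sigma> (\<sigma> x) = x" if xF: "x \<in> ?F" for x
      proof -
        obtain a b where x: "x = a + b * \<theta>" and m: "a \<in> ?T" "b \<in> ?T" using F_E[OF xF] by blast
        have "\<sigma> (a + (- b) * \<theta>) = a - (- b) * \<theta>" using m Ti(7) by (intro \<sigma>)
        then show ?thesis unfolding x \<sigma>[OF m] by simp
      qed
      then show ?thesis unfolding Q_def using P' r by simp
    qed (simp add: Q_def)
    have Q: "twisted ?F r Q" "on_curve X12 Q" "twisted ?F r (ec_neg X12 Q)"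
        "point_conj \<sigma> r (ec_neg X12 Q) = ec_neg X12 P"
      using twisted_conj[OF ctx P] twisted_conj[OF ctx, of Q] invol unfolding Q_def by auto
    have Qn: "Q [^]\<^bsub>MW\<^esub> n = \<one>\<^bsub>MW\<^esub>"
      using point_conj_pow[OF ctx P, of n] Cons.prems(6) by (simp add: Q_def one_mordell_weil)
    have car: "P \<in> carrier MW" "Q \<in> carrier MW" using P Q by (simp_all add: carrier_mordell_weil)
    have negQ: "ec_neg X12 Q = inv\<^bsub>MW\<^esub> Q" using inv_mordell_weil[OF elliptic_curve_X12 Q(2)] by simp
    have negP: "ec_neg X12 P = inv\<^bsub>MW\<^esub> P" using inv_mordell_weil[OF elliptic_curve_X12 P(2)] by simp
    \<comment> \<open>Conjugation fixes \<open>R\<close> and negates \<open>S\<close>.\<close>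
    define R where "R = ec_add X12 P Q"
    define S where "S = ec_add X12 P (ec_neg X12 Q)"
    have R: "R = P \<otimes>\<^bsub>MW\<^esub> Q" and S: "S = P \<otimes>\<^bsub>MW\<^esub> inv\<^bsub>MW\<^esub> Q"
      by (simp_all add: R_def S_def mult_mordell_weil negQ)
    have on: "on_curve X12 R" "on_curve X12 S"
      unfolding R_def S_def using P Q by (auto intro: on_curve_ec_add on_curve_neg)
    have "R [^]\<^bsub>MW\<^esub> n = \<one>\<^bsub>MW\<^esub>" "S [^]\<^bsub>MW\<^esub> n = \<one>\<^bsub>MW\<^esub>"
      unfolding R S using car Cons.prems(6) Qn by (simp_all add: MW.pow_mult_distrib MW.m_comm MW.nat_pow_inv)
    moreover have "twisted ?T r R"
    proof (cases "R = Infinity")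
      case False
      have "twisted ?F r R" unfolding R_def by (rule twisted_conj_add[OF ctx P(1) Q(1) P(2) Q(2)])
      with False obtain x z where R': "R = Affine x (r * z)" "x \<in> ?F" "z \<in> ?F"
        unfolding twisted_def by blast
      have "point_conj \<sigma> r R = ec_add X12 Q P"
        unfolding R_def using twisted_conj_add(2)[OF ctx P(1) Q(1) P(2) Q(2)] invol by (simp add: Q_def)
      then have "point_conj \<sigma> r R = R" unfolding R_def using ec_add_commute P Q by metis
      then have "\<sigma> x = x" "\<sigma> z = z" using R' r by simp_all
      then show ?thesis unfolding twisted_def using R' fixed by blast
    qed (simp add: twisted_def)
    moreover have "twisted ?T (r * \<theta>) S"
    proof (cases "S = Infinity")
      case False
      have "twisted ?F r S" unfolding S_def
        by (rule twisted_conj_add[OF ctx P(1) Q(3) P(2) on_curve_neg[OF Q(2)]])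
      with False obtain x z where S': "S = Affine x (r * z)" "x \<in> ?F" "z \<in> ?F"
        unfolding twisted_def by blast
      have "point_conj \<sigma> r S = ec_add X12 Q (ec_neg X12 P)"
        unfolding S_def using twisted_conj_add(2)[OF ctx P(1) Q(3) P(2) on_curve_neg[OF Q(2)]] Q(4)
        by (simp add: Q_def)
      also have "\<dots> = ec_neg X12 S"
        unfolding S_def using ec_neg_add[OF P(2) on_curve_neg[OF Q(2)]]
          ec_add_commute[OF Q(2) on_curve_neg[OF P(2)]] by simp
      finally have "\<sigma> x = x" "r * \<sigma> z = r * (- z)" using S' r by simp_all
      then have "\<sigma> x = x" "\<sigma> z = - z" using mult_left_cancel[OF r] by blast+
      \<comment> \<open>What \<sigma> negates is a multiple of \<theta>; absorbing \<theta> into the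
        twisting factor leaves coordinates in the smaller field.\<close>
      moreover have "\<exists>b\<in>?T. x = \<theta> * b" if x: "x \<in> ?F" "\<sigma> x = - x" for x
      proof -
        obtain a b where x': "x = a + b * \<theta>" and m: "a \<in> ?T" "b \<in> ?T" using F_E[OF x(1)] by blast
        have "2 * a = 0" using x(2) \<sigma>[OF m] unfolding x' by algebra
        then show ?thesis using m x' by (auto simp: mult.commute)
      qed
      ultimately show ?thesis unfolding twisted_def using S' fixed by (metis mult.assoc)
    qed (simp add: twisted_def)
    moreover have "r * \<theta> \<noteq> 0" "(r * \<theta>)^2 \<in> \<rat>" using r \<theta> Ti(1) Cons.prems(1,3) by (auto simp: power_mult_distrib)
    ultimately have "R = Infinity" "S = Infinity"
      using IH[of r R] IH[of "r * \<theta>" S] on r Cons.prems(3) by blast+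
    then have "P \<otimes>\<^bsub>MW\<^esub> Q = \<one>\<^bsub>MW\<^esub>" "P \<otimes>\<^bsub>MW\<^esub> inv\<^bsub>MW\<^esub> Q = \<one>\<^bsub>MW\<^esub>"
      unfolding R S by (simp_all add: one_mordell_weil)
    then have "P = Q" "P \<otimes>\<^bsub>MW\<^esub> Q = \<one>\<^bsub>MW\<^esub>"
      using car MW.inv_equality[of P "inv\<^bsub>MW\<^esub> Q"] by simp_all
    then have PP: "P [^]\<^bsub>MW\<^esub> (2::nat) = \<one>\<^bsub>MW\<^esub>" using car by (simp add: numeral_2_eq_2)
    show ?thesis using MW.pow_two_odd_one[OF car(1) PP n Cons.prems(6)] by (simp add: one_mordell_weil)
  qed
qed

text \<open>For \<open>n = 2^a * m\<close> with \<open>m\<close> odd, \<open>2^a * P\<close> has odd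
  order and vanishes by the descent. Then \<open>P\<close> is reached from \<open>Infinity\<close>
  by \<open>a\<close> halvings, each of which stays among the cusps.\<close>

lemma torsion_cusp:
  fixes P :: "'k::field_char_0 point"
  assumes K: "multi_quadratic_field TYPE('k)" and P: "on_curve X12 P"
    and n: "n > 0" "P [^]\<^bsub>MW\<^esub> (n::nat) = \<one>\<^bsub>MW\<^esub>"
  shows "P = Infinity \<or> (\<exists>s t. P = Affine s t \<and> cusp_abscissa s)"
proof -
  have two: "P = Infinity \<or> (\<exists>s t. P = Affine s t \<and> cusp_abscissa s)"
    if "on_curve X12 P" "P [^]\<^bsub>MW\<^esub> (2^a::nat) = \<one>\<^bsub>MW\<^esub>" for a and P :: "'k point"
    using that
  proof (induction a arbitrary: P)
    case 0
    then show ?case by (simp add: carrier_mordell_weil one_mordell_weil)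
  next
    case (Suc a)
    have car: "P \<in> carrier MW" using Suc.prems by (simp add: carrier_mordell_weil)
    show ?case
    proof (cases P)
      case (Affine s t)
      have on: "t^2 = s^3 - s^2 + s" using Suc.prems(1) unfolding Affine on_curve_X12 .
      show ?thesis
      proof (cases "t = 0")
        case True
        then have "s * (s^2 - s + 1) = 0" using on by algebra
        then show ?thesis using Affine by (auto simp: cusp_abscissa_def)
      next
        case False
        obtain X Y where XY: "ec_add X12 P P = Affine X Y" "4 * t^2 * X = (s^2 - 1)^2"
          using X12_double[OF _ False] Suc.prems(1) unfolding Affine by metis
        have "P \<otimes>\<^bsub>MW\<^esub> P = P [^]\<^bsub>MW\<^esub> (2::nat)" using car by (simp add: numeral_2_eq_2)
        then have "(P \<otimes>\<^bsub>MW\<^esub> P) [^]\<^bsub>MW\<^esub> (2^a::nat) = \<one>\<^bsub>MW\<^esub>"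
          using Suc.prems(2) car by (simp add: MW.nat_pow_pow)
        then have "cusp_abscissa X"
          using Suc.IH[of "ec_add X12 P P"] on_curve_ec_add[OF Suc.prems(1,1)] XY by (simp add: mult_mordell_weil)
        then show ?thesis using cusp_abscissa_half[OF K on False XY(2)] Affine by blast
      qed
    qed simp
  qed
  have car: "P \<in> carrier MW" using P by (simp add: carrier_mordell_weil)
  obtain m where m: "n = 2 ^ multiplicity 2 n * m" "odd m"
    using multiplicity_decompose'[of n 2] n by auto
  define a where "a = multiplicity 2 n"
  define Q where "Q = P [^]\<^bsub>MW\<^esub> (2^a::nat)"
  have on: "on_curve X12 Q" using MW.nat_pow_closed[OF car] by (simp add: Q_def carrier_mordell_weil)
  have Qm: "Q [^]\<^bsub>MW\<^esub> m = \<one>\<^bsub>MW\<^esub>" unfolding Q_def using n(2) m(1) car by (simp add: MW.nat_pow_pow a_def)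
  have "Q = Infinity"
  proof (cases Q)
    case (Affine x y)
    obtain \<theta>s :: "'k list" where \<theta>s: "\<forall>\<theta>\<in>set \<theta>s. \<theta>^2 \<in> \<rat>" "x \<in> tower \<rat> \<theta>s" "y \<in> tower \<rat> \<theta>s"
      using multi_quadratic_tower[OF K is_subfield_Rats, of x y] by blast
    then have "twisted (tower \<rat> \<theta>s) 1 Q" unfolding twisted_def Affine by simp
    then show ?thesis using odd_torsion_tower[OF _ m(2) _ _ _ on Qm, of \<theta>s 1] \<theta>s(1) by simp
  qed
  then show ?thesis using two[OF P, of a] by (simp add: Q_def one_mordell_weil)
qed

section \<open>From a point of order 12 to Kubert's family\<close>

text \<open>The order of \<open>P\<close> divides 12 but neither 6 nor 4, so it is exactly 12.
  Excluding the point \<open>6 * P\<close> makes \<open>Q\<close> a 2-torsion point outside the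
  group generated by \<open>P\<close>.\<close>

definition order_2_12 :: "'a::field weierstrass \<Rightarrow> 'a point \<Rightarrow> 'a point \<Rightarrow> bool" where
  "order_2_12 E P Q \<longleftrightarrow> elliptic_curve E \<and> on_curve E P \<and> on_curve E Q \<and>
     P [^]\<^bsub>mordell_weil E\<^esub> (12::nat) = Infinity \<and> P [^]\<^bsub>mordell_weil E\<^esub> (6::nat) \<noteq> Infinity \<and>
     P [^]\<^bsub>mordell_weil E\<^esub> (4::nat) \<noteq> Infinity \<and> Q [^]\<^bsub>mordell_weil E\<^esub> (2::nat) = Infinity \<and>
     Q \<noteq> Infinity \<and> Q \<noteq> P [^]\<^bsub>mordell_weil E\<^esub> (6::nat)"

lemma ec_pow_Suc: "P [^]\<^bsub>mordell_weil E\<^esub> Suc n = ec_add E (P [^]\<^bsub>mordell_weil E\<^esub> n) P"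
  by (simp add: mordell_weil_def nat_pow_def)

lemma on_curve_pow:
  "on_curve E P \<Longrightarrow> on_curve E (P [^]\<^bsub>mordell_weil E\<^esub> (n::nat))"
  by (induction n) (simp_all add: one_mordell_weil mult_mordell_weil on_curve_ec_add)

lemma ec_map_pow:
  assumes "ec_change E E' u r s t" "on_curve E' P"
  shows "ec_map u r s t P [^]\<^bsub>mordell_weil E\<^esub> (n::nat) = ec_map u r s t (P [^]\<^bsub>mordell_weil E'\<^esub> n)"
  by (induction n) (simp_all add: one_mordell_weil mult_mordell_weil ec_map_add[OF assms(1)] on_curve_pow assms(2))

lemma order_2_12_ec_change:
  fixes E :: "'a::field_char_0 weierstrass"
  assumes c: "ec_change E E' u r s t"
    and "order_2_12 E (ec_map u r s t P) (ec_map u r s t Q)"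
  shows "order_2_12 E' P Q"
proof -
  have inf: "ec_map u r s t R = Infinity \<longleftrightarrow> R = Infinity" for R by (cases R) auto
  have on: "on_curve E' P" "on_curve E' Q"
    using assms on_curve_ec_map[OF c] by (auto simp: order_2_12_def)
  show ?thesis
    using assms(2) unfolding order_2_12_def ec_map_pow[OF c on(1)] ec_map_pow[OF c on(2)] inf
      on_curve_ec_map[OF c] ec_map_eq_iff[OF c] elliptic_curve_ec_change[OF c] .
qed

lemma subgroup_order_2_12:
  fixes E :: "'a::field_char_0 weierstrass"
  assumes "E \<in> elliptic_curves_2_12"
  shows "\<exists>P Q. order_2_12 E P Q"
proof -
  let ?A = "integer_mod_group 2 \<times>\<times> integer_mod_group 12"
  let ?G = "mordell_weil E"
  have E: "elliptic_curve E" using assms by (simp add: elliptic_curves_2_12_def)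
  interpret G: comm_group ?G by (rule comm_group_mordell_weil[OF E])
  interpret A: group ?A by (intro DirProd_group group_integer_mod_group)
  obtain H where H: "subgroup H ?G" "?G\<lparr>carrier := H\<rparr> \<cong> ?A"
    using assms by (auto simp: elliptic_curves_2_12_def has_subgroup_isomorphic_to_def)
  interpret H: group "?G\<lparr>carrier := H\<rparr>" by (rule G.subgroup_imp_group[OF H(1)])
  obtain h where h: "h \<in> iso ?A (?G\<lparr>carrier := H\<rparr>)"
    using H.iso_sym[OF H(2)] by (auto simp: is_iso_def)
  have hom: "h \<in> hom ?A ?G"
    using h subgroup.subset[OF H(1)] by (auto simp: iso_def hom_def)
  interpret h: group_hom ?A ?G h by unfold_locales (rule hom)
  have inj: "inj_on h (carrier ?A)" using h by (auto simp: iso_def bij_betw_def)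
  have car: "carrier ?A = {0..<2} \<times> {0..<12}"
    by (simp add: carrier_integer_mod_group)
  have pow: "(i, j) [^]\<^bsub>?A\<^esub> n = (int n * i mod 2, int n * j mod 12)" for i j and n :: nat
    by (induction n) (simp_all add: integer_mod_group_def mod_simps distrib_right add.commute)
  have one: "\<one>\<^bsub>?A\<^esub> = (0, 0)" by simp
  have mem: "(0, 1) \<in> carrier ?A" "(1, 0) \<in> carrier ?A" "(0, 6) \<in> carrier ?A" "(0, 4) \<in> carrier ?A" "(0, 0) \<in> carrier ?A"
    unfolding car by auto
  have h0: "h (0, 0) = Infinity" using h.hom_one unfolding one by (simp add: one_mordell_weil)
  define P where "P = h (0, 1)"
  define Q where "Q = h (1, 0)"
  have hP: "P [^]\<^bsub>?G\<^esub> n = h (0, int n mod 12)" and hQ: "Q [^]\<^bsub>?G\<^esub> n = h (int n mod 2, 0)" for n :: nat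
    unfolding P_def Q_def by (simp_all only: h.hom_nat_pow[OF mem(1), symmetric] h.hom_nat_pow[OF mem(2), symmetric] pow) simp_all
  have "on_curve E P" "on_curve E Q" using h.hom_closed mem by (auto simp: P_def Q_def carrier_mordell_weil)
  moreover have "P [^]\<^bsub>?G\<^esub> (12::nat) = Infinity" "Q [^]\<^bsub>?G\<^esub> (2::nat) = Infinity" unfolding hP hQ by (simp_all add: h0)
  moreover have "P [^]\<^bsub>?G\<^esub> (6::nat) \<noteq> Infinity" "P [^]\<^bsub>?G\<^esub> (4::nat) \<noteq> Infinity" "Q \<noteq> Infinity"
      "Q \<noteq> P [^]\<^bsub>?G\<^esub> (6::nat)"
    unfolding hP Q_def h0[symmetric] using inj_onD[OF inj _ mem(3,5)] inj_onD[OF inj _ mem(4,5)] inj_onD[OF inj _ mem(2,5)]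
      inj_onD[OF inj _ mem(2,3)] by auto
  ultimately show ?thesis using E unfolding order_2_12_def by blast
qed

text \<open>If \<open>n * P\<close> vanished, so would \<open>4 * P\<close>, \<open>6 * P\<close>
  or, for \<open>n = 5\<close>, \<open>10 * P\<close>; the last gives \<open>2 * P = 0\<close>
  because \<open>12 * P = 0\<close>.\<close>

lemma order_12_pow_neq:
  fixes E :: "'a::field_char_0 weierstrass"
  assumes "order_2_12 E P Q" "n \<in> {1,2,3,4,5,6}"
  shows "P [^]\<^bsub>mordell_weil E\<^esub> (n::nat) \<noteq> Infinity"
proof
  assume n: "P [^]\<^bsub>mordell_weil E\<^esub> n = Infinity"
  interpret G: comm_group "mordell_weil E"
    using assms by (intro comm_group_mordell_weil) (simp add: order_2_12_def)
  have P: "P \<in> carrier (mordell_weil E)" using assms by (simp add: order_2_12_def carrier_mordell_weil)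
  have "P [^]\<^bsub>mordell_weil E\<^esub> (n * k) = Infinity" for k
  proof -
    have "P [^]\<^bsub>mordell_weil E\<^esub> n = \<one>\<^bsub>mordell_weil E\<^esub>" using n by (simp add: one_mordell_weil)
    with G.nat_pow_pow[OF P, of n k] have "P [^]\<^bsub>mordell_weil E\<^esub> (n * k) = \<one>\<^bsub>mordell_weil E\<^esub>" by simp
    then show ?thesis by (simp add: one_mordell_weil)
  qed
  note this[of 6] this[of 4] this[of 3] this[of 2] this[of 1]
  moreover have False if 10: "P [^]\<^bsub>mordell_weil E\<^esub> (10::nat) = Infinity"
  proof -
    have "P [^]\<^bsub>mordell_weil E\<^esub> (10 + 2::nat) = Infinity" using assms(1) by (simp add: order_2_12_def)
    then have "P [^]\<^bsub>mordell_weil E\<^esub> (2::nat) = \<one>\<^bsub>mordell_weil E\<^esub>"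
      using 10 G.nat_pow_mult[OF P, of 10 2] by (simp add: mult_mordell_weil one_mordell_weil)
    with G.nat_pow_pow[OF P, of 2 3] have "P [^]\<^bsub>mordell_weil E\<^esub> (6::nat) = \<one>\<^bsub>mordell_weil E\<^esub>" by simp
    then show False using assms(1) by (simp add: order_2_12_def one_mordell_weil)
  qed
  ultimately show False using assms by (auto simp: order_2_12_def)
qed

text \<open>The slope enters as a solution of \<open>l * x = y\<close>, so that applications only
  have to check polynomial identities.\<close>

lemma ec_add_origin:
  fixes E :: "'a::field weierstrass"
  assumes "x \<noteq> 0" "l * x = y" "x' = l^2 + a1 E * l - a2 E - x" "y' = - l * x' - a1 E * x' - a3 E"
  shows "ec_add E (Affine x y) (Affine 0 0) = Affine x' y'"
proof -
  have l: "l = ec_slope E x y 0 0" using assms(1,2) by (auto simp: ec_slope_def field_simps)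
  have "ec_add E (Affine x y) (Affine 0 0) = Affine x' (l * (x - x') - y - a1 E * x' - a3 E)"
    by (rule ec_add_slope[OF _ l]) (use assms in auto)
  also have "l * (x - x') - y = - l * x'" using assms(2) by (simp add: algebra_simps)
  finally show ?thesis by (simp add: assms(4))
qed

section \<open>Tate's and Kubert's normal forms\<close>

text \<open>Translation and shear put \<open>P\<close> at the origin with tangent
  \<open>y = 0\<close>. Then \<open>a3\<close> is nonzero because \<open>2 * P\<close> is, and
  \<open>a2\<close> because \<open>3 * P\<close> is; since these coefficients have weights 3 and 2,
  scaling by \<open>a3 / a2\<close> makes them equal.\<close>

lemma order_2_12_tangent:
  fixes E :: "'a::field_char_0 weierstrass"
  assumes "order_2_12 E P Q"
  shows "\<exists>(E' :: 'a weierstrass) Q'. order_2_12 E' (Affine 0 0) Q' \<and> a4 E' = 0 \<and> a6 E' = 0 \<and> a2 E' = a3 E' \<and> a3 E' \<noteq> 0"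
proof -
  have P1: "P [^]\<^bsub>mordell_weil E\<^esub> Suc 0 = P" by (simp add: one_mordell_weil mult_mordell_weil)
  then have "P \<noteq> Infinity" using order_12_pow_neq[OF assms, of 1] by simp
  then obtain x y where P: "P = Affine x y" by (cases P) auto
  have on: "on_curve E (Affine x y)" using assms by (simp add: order_2_12_def P)
  have "ec_add E P P \<noteq> Infinity"
    using order_12_pow_neq[OF assms, of 2] by (simp add: numeral_2_eq_2 one_mordell_weil mult_mordell_weil)
  then have D: "2 * y + a1 E * x + a3 E \<noteq> 0" unfolding P mult_2 by auto
  define s where "s = ec_slope E x y x y"
  have s: "s * (2 * y + a1 E * x + a3 E) = 3 * x^2 + 2 * a2 E * x + a4 E - a1 E * y"
    using D by (simp add: s_def ec_slope_def)
  obtain F where F: "ec_change E F 1 x s y" by (rule ec_change_exists[OF one_neq_zero])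
  obtain R where R: "ec_map 1 x s y R = Q" using ec_map_surj[OF F] by blast
  have "ec_map 1 x s y (Affine 0 0) = P" by (simp add: P)
  then have lF: "order_2_12 F (Affine 0 0) R" using order_2_12_ec_change[OF F] assms R by metis
  have c: "a3 F = a3 E + x * a1 E + 2 * y"
      "a4 F = a4 E - s * a3 E + 2 * x * a2 E - (y + x * s) * a1 E + 3 * x^2 - 2 * s * y"
      "a6 F = a6 E + x * a4 E + x^2 * a2 E + x^3 - y * a3 E - y^2 - x * y * a1 E"
    using F by (simp_all add: ec_change_def)
  have "a4 F = 0" unfolding c using s by algebra
  have "a6 F = 0" unfolding c using on unfolding on_curve.simps by algebra
  have "a3 F \<noteq> 0" unfolding c using D by (simp add: ac_simps)
  have 2: "Affine 0 0 [^]\<^bsub>mordell_weil F\<^esub> Suc (Suc 0) = Affine (- a2 F) (a1 F * a2 F - a3 F)"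
    using \<open>a3 F \<noteq> 0\<close> \<open>a4 F = 0\<close> by (simp add: one_mordell_weil mult_mordell_weil Let_def)
  have "a2 F \<noteq> 0"
  proof
    assume "a2 F = 0"
    then have "Affine 0 0 [^]\<^bsub>mordell_weil F\<^esub> Suc (Suc (Suc 0)) = Infinity"
      unfolding ec_pow_Suc[of _ _ "Suc (Suc 0)"] 2 by simp
    then show False using order_12_pow_neq[OF lF, of 3] by (simp add: numeral_3_eq_3)
  qed
  define u where "u = a3 F / a2 F"
  have u: "u \<noteq> 0" "u * a2 F = a3 F" using \<open>a2 F \<noteq> 0\<close> \<open>a3 F \<noteq> 0\<close> by (simp_all add: u_def)
  obtain E' where E': "ec_change F E' u 0 0 0" by (rule ec_change_exists[OF u(1)])
  obtain Q' where Q': "ec_map u 0 0 0 Q' = R" using ec_map_surj[OF E'] by blast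
  have "ec_map u 0 0 0 (Affine 0 0) = Affine 0 0" by simp
  then have "order_2_12 E' (Affine 0 0) Q'" using order_2_12_ec_change[OF E'] lF Q' by metis
  moreover have "a4 E' = 0" "a6 E' = 0"
    using E' u(1) \<open>a4 F = 0\<close> \<open>a6 F = 0\<close> by (simp_all add: ec_change_def)
  moreover have e: "u^2 * a2 E' = a2 F" "u^3 * a3 E' = a3 F" using E' by (simp_all add: ec_change_def)
  have "u^3 * a2 E' = u * (u^2 * a2 E')" by (simp add: eval_nat_numeral)
  then have "u^3 * a2 E' = u^3 * a3 E'" unfolding e u(2) .
  then have "a2 E' = a3 E'" using u(1) by simp
  moreover have "a3 E' \<noteq> 0" using e(2) \<open>a3 F \<noteq> 0\<close> by auto
  ultimately show ?thesis by blast
qed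

text \<open>Each substitution divides by a quantity whose vanishing would give a multiple of
  \<open>P\<close> below the twelfth the abscissa 0, forcing a smaller order. That
  \<open>6 * P\<close> is 2-torsion then expresses \<open>f\<close> through \<tau>, leaving one
  parameter.\<close>

lemma order_2_12_kubert:
  fixes E :: "'a::field_char_0 weierstrass"
  assumes ord: "order_2_12 E (Affine 0 0) Q" and "a4 E = 0" "a6 E = 0" "a2 E = a3 E" "a3 E \<noteq> 0"
  shows "\<exists>(\<tau> :: 'a) Q'. order_2_12 (kubert_curve \<tau>) (Affine 0 0) Q' \<and> \<tau> \<noteq> 0 \<and> \<tau> - 1 \<noteq> 0 \<and> 2 * \<tau> - 1 \<noteq> 0 \<and>
     2 * \<tau>^2 - 2 * \<tau> + 1 \<noteq> 0 \<and> 3 * \<tau>^2 - 3 * \<tau> + 1 \<noteq> 0"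
proof -
  \<comment> \<open>\<open>b\<close>, \<open>c\<close> are the coefficients of Tate's normal form, and \<open>d\<close>, \<open>f\<close>, \<open>\<tau>\<close> are Kubert's substitutions,
    chosen so that the multiples of \<open>P\<close> factor.\<close>
  define b where "b = - a2 E"
  define c where "c = 1 - a1 E"
  have E: "a1 E = 1 - c" "a2 E = - b" "a3 E = - b" "a4 E = 0" "a6 E = 0" and b0: "b \<noteq> 0"
    using assms by (simp_all add: b_def c_def)
  define P :: "'a point" where "P = Affine 0 0"
  let ?p = "\<lambda>n::nat. P [^]\<^bsub>mordell_weil E\<^esub> n"
  have S: "?p (Suc n) = ec_add E (?p n) (Affine 0 0)" for n
    by (simp add: mult_mordell_weil P_def)
  have ne: "?p n \<noteq> Infinity" if "n \<in> {1,2,3,4,5,6}" for n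
    using order_12_pow_neq[OF ord that] by (simp add: P_def)
  have opp: "ec_add E (Affine 0 b) (Affine 0 0) = Infinity" by (simp add: E)
  have p1: "?p 1 = Affine 0 0" by (simp add: P_def one_mordell_weil mult_mordell_weil)
  have p2: "?p 2 = Affine b (b * c)"
    using S[of 1] b0 unfolding p1 by (simp add: numeral_2_eq_2 E Let_def algebra_simps)
  have p3: "?p 3 = Affine c (b - c)"
    using S[of 2] b0 ec_add_origin[of b c "b * c" c E "b - c"] unfolding p2
    by (simp add: E algebra_simps power2_eq_square)
  have c0: "c \<noteq> 0"
  proof
    assume "c = 0"
    then have "?p 3 = Affine 0 b" unfolding p3 by simp
    then show False using S[of 3] ne[of 4] opp by simp
  qed
  define d where "d = b / c"
  have b: "b = c * d" using c0 by (simp add: d_def)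
  have d0: "d \<noteq> 0" using b0 b by auto
  have p4: "?p 4 = Affine (d * (d - 1)) (d^2 * (c - d + 1))"
  proof -
    have "?p 4 = ec_add E (Affine c (b - c)) (Affine 0 0)" using S[of 3] unfolding p3 by simp
    also have "\<dots> = Affine (d * (d - 1)) (d^2 * (c - d + 1))"
      by (rule ec_add_origin[OF c0, where l = "d - 1"]) (unfold E b, algebra+)
    finally show ?thesis .
  qed
  have d1: "d - 1 \<noteq> 0"
  proof
    assume "d - 1 = 0"
    then have "d = 1" by simp
    then have "?p 4 = Affine 0 b" unfolding p4 b by simp
    then show False using S[of 4] ne[of 5] opp by simp
  qed
  define f where "f = c / (d - 1)"
  have c: "c = f * (d - 1)" using d1 by (simp add: f_def)
  have f0: "f \<noteq> 0" using c0 c by auto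
  have p5: "?p 5 = Affine (d * f * (f - 1)) (d * f^2 * (d - f))"
  proof -
    have "?p 5 = ec_add E (Affine (d * (d - 1)) (d^2 * (c - d + 1))) (Affine 0 0)"
      using S[of 4] unfolding p4 by simp
    also have "\<dots> = Affine (d * f * (f - 1)) (d * f^2 * (d - f))"
      by (rule ec_add_origin[where l = "d * (f - 1)"], use d0 d1 in simp) (unfold E b c, algebra+)
    finally show ?thesis .
  qed
  have on: "on_curve E (?p n)" for n using ord by (auto simp: order_2_12_def P_def intro: on_curve_pow)
  have f1: "f - 1 \<noteq> 0"
  proof
    assume "f - 1 = 0"
    then have x5: "?p 5 = Affine 0 (d * f^2 * (d - f))" unfolding p5 by simp
    \<comment> \<open>Abscissa 0 means \<open>5 * P = P\<close> or \<open>5 * P = - P\<close>. The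
      first forces \<open>d = f = 1\<close>, which is already excluded, and the second forces
      \<open>6 * P = 0\<close>.\<close>
    have "d * f^2 * (d - f) = 0 \<or> d * f^2 * (d - f) + 0 + a1 E * 0 + a3 E = 0"
      using on_curve_same_x[OF on[of 5, unfolded x5] on[of 1, unfolded p1]] .
    then show False
    proof
      assume "d * f^2 * (d - f) = 0"
      then have "d = f" using d0 f0 by simp
      then show False using d1 \<open>f - 1 = 0\<close> by simp
    next
      assume "d * f^2 * (d - f) + 0 + a1 E * 0 + a3 E = 0"
      then have "?p 5 = Affine 0 b" unfolding x5 by (simp add: E)
      then show False using S[of 5] ne[of 6] opp by simp
    qed
  qed
  define \<tau> where "\<tau> = (d - f) / (1 - f)"
  have d: "d = f + \<tau> * (1 - f)" using f1 by (simp add: \<tau>_def)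
  have d': "d - 1 = (f - 1) * (1 - \<tau>)" unfolding d by algebra
  have \<tau>1: "\<tau> - 1 \<noteq> 0" using d1 unfolding d' by auto
  define x6 where "x6 = f * \<tau> * (\<tau> - 1)"
  define y6 where "y6 = - (- f * \<tau>) * x6 - a1 E * x6 - a3 E"
  have p6: "?p 6 = Affine x6 y6"
  proof -
    have "?p 6 = ec_add E (Affine (d * f * (f - 1)) (d * f^2 * (d - f))) (Affine 0 0)"
      using S[of 5] unfolding p5 by simp
    also have "\<dots> = Affine x6 y6"
      by (rule ec_add_origin[where l = "- f * \<tau>"], use d0 f0 f1 in simp, unfold y6_def)
        (unfold x6_def E b c, unfold d, (algebra | rule refl)+)
    finally show ?thesis .
  qed
  have "ec_add E (?p 6) (?p 6) = Infinity"
  proof -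
    interpret G: comm_group "mordell_weil E"
      using ord by (intro comm_group_mordell_weil) (simp add: order_2_12_def)
    have "P \<in> carrier (mordell_weil E)" using ord by (simp add: order_2_12_def carrier_mordell_weil P_def)
    from G.nat_pow_mult[OF this, of 6 6] show ?thesis
      using ord by (simp add: order_2_12_def P_def mult_mordell_weil)
  qed
  then have "y6 + y6 + a1 E * x6 + a3 E = 0" unfolding p6 by (simp add: Let_def split: if_splits)
  \<comment> \<open>The 2-torsion condition at \<open>6 * P\<close>, factored; only the last factor
    can vanish.\<close>
  then have "f^2 * (\<tau> - 1) * (f * (\<tau> - 1)^2 - (3 * \<tau>^2 - 3 * \<tau> + 1)) = 0"
    unfolding y6_def unfolding x6_def E b c unfolding d by algebra
  then have f: "f * (\<tau> - 1)^2 = 3 * \<tau>^2 - 3 * \<tau> + 1" using f0 \<tau>1 by simp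
  have f1': "(f - 1) * (\<tau> - 1)^2 = \<tau> * (2 * \<tau> - 1)" using f by algebra
  have \<tau>0: "\<tau> \<noteq> 0" "2 * \<tau> - 1 \<noteq> 0" using f1 \<tau>1 f1' by auto
  have m3: "3 * \<tau>^2 - 3 * \<tau> + 1 \<noteq> 0" using f f0 \<tau>1 by auto
  have dm: "d * (\<tau> - 1) = - (2 * \<tau>^2 - 2 * \<tau> + 1)"
  proof -
    have "(d * (\<tau> - 1) + (2 * \<tau>^2 - 2 * \<tau> + 1)) * (\<tau> - 1) = 0" unfolding d using f by algebra
    then show ?thesis using \<tau>1 unfolding eq_neg_iff_add_eq_0 mult_eq_0_iff by blast
  qed
  have m2: "2 * \<tau>^2 - 2 * \<tau> + 1 \<noteq> 0"
    using dm d0 \<tau>1 by (metis mult_eq_0_iff neg_0_equal_iff_equal)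
  \<comment> \<open>This scaling clears the denominators \<open>(\<tau> - 1)^3\<close> of
    \<open>c\<close> and \<open>(\<tau> - 1)^4\<close> of \<open>b\<close>; the sign is that of
    \<open>kubert_curve\<close>.\<close>
  define v where "v = - ((\<tau> - 1)^3)"
  have v0: "v \<noteq> 0" using \<tau>1 by (simp add: v_def)
  have cc: "c * (\<tau> - 1)^3 = - \<tau> * (2 * \<tau> - 1) * (3 * \<tau>^2 - 3 * \<tau> + 1)"
    unfolding c d' using f f1' by algebra
  have bb: "b * (\<tau> - 1)^4 = \<tau> * (2 * \<tau> - 1) * (2 * \<tau>^2 - 2 * \<tau> + 1) * (3 * \<tau>^2 - 3 * \<tau> + 1)"
  proof -
    have "b * (\<tau> - 1)^4 = (c * (\<tau> - 1)^3) * (d * (\<tau> - 1))" unfolding b by algebra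
    then show ?thesis unfolding cc dm by algebra
  qed
  have k: "a1 (kubert_curve \<tau>) = v * a1 E" "a2 (kubert_curve \<tau>) = v^2 * a2 E"
      "a3 (kubert_curve \<tau>) = v^3 * a3 E"
    unfolding kubert_curve_def weierstrass.sel E v_def using cc bb by algebra+
  have k': "a4 (kubert_curve \<tau>) = 0" "a6 (kubert_curve \<tau>) = 0" by (simp_all add: kubert_curve_def)
  have K: "ec_change E (kubert_curve \<tau>) (1 / v) 0 0 0"
    unfolding ec_change_def k k' E using v0 by (simp add: power_divide)
  obtain Q' where Q': "ec_map (1 / v) 0 0 0 Q' = Q" using ec_map_surj[OF K] by blast
  have "ec_map (1 / v) 0 0 0 (Affine 0 0) = Affine 0 0" by simp
  then have "order_2_12 (kubert_curve \<tau>) (Affine 0 0) Q'" using order_2_12_ec_change[OF K] ord Q' by metis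
  then show ?thesis using \<tau>0 \<tau>1 m2 m3 by blast
qed

section \<open>Kubert's family and 24a4\<close>

lemma two_torsion_cubic:
  fixes E :: "'a::field_char_0 weierstrass"
  assumes "on_curve E (Affine x y)" "2 * y + a1 E * x + a3 E = 0"
  shows "4 * x^3 + b2 E * x^2 + 2 * b4 E * x + b6 E = 0"
proof -
  have "4 * x^3 + b2 E * x^2 + 2 * b4 E * x + b6 E =
      (2 * y + a1 E * x + a3 E)^2 - 4 * (y^2 + a1 E * x * y + a3 E * y - (x^3 + a2 E * x^2 + a4 E * x + a6 E))"
    unfolding b2_def b4_def b6_def by algebra
  also have "\<dots> = 0" using assms(1) unfolding assms(2) on_curve.simps by simp
  finally show ?thesis .
qed

text \<open>The 2-division cubic has the known root of \<open>6 * P\<close>, so the abscissa of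
  \<open>Q\<close> is a root of the quadratic cofactor. The discriminant
  \<open>h^6 * m2^3 * m6\<close> of that cofactor must therefore be a square.\<close>

lemma order_2_12_kubert_quadratic:
  fixes \<tau> :: "'a::field_char_0"
  assumes nz: "\<tau> \<noteq> 0" "\<tau> - 1 \<noteq> 0" "2 * \<tau> - 1 \<noteq> 0" "2 * \<tau>^2 - 2 * \<tau> + 1 \<noteq> 0" "3 * \<tau>^2 - 3 * \<tau> + 1 \<noteq> 0"
    and ord: "order_2_12 (kubert_curve \<tau>) (Affine 0 0) Q"
  shows "6 * \<tau>^2 - 6 * \<tau> + 1 \<noteq> 0 \<and>
    (\<exists>W. W^2 = 4 * (2 * \<tau>^2 - 2 * \<tau> + 1) * (6 * \<tau>^2 - 6 * \<tau> + 1))"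
proof -
  define E where "E = kubert_curve \<tau>"
  define a h m2 m3 m6 where "a = \<tau> - 1" and "h = 2 * \<tau> - 1" and "m2 = 2 * \<tau>^2 - 2 * \<tau> + 1"
    and "m3 = 3 * \<tau>^2 - 3 * \<tau> + 1" and "m6 = 6 * \<tau>^2 - 6 * \<tau> + 1"
  note nz' = nz[folded a_def h_def m2_def m3_def]
  have E: "a1 E = - (a^3) - \<tau> * h * m3" "a2 E = - \<tau> * h * a^2 * m2 * m3"
      "a3 E = \<tau> * h * a^5 * m2 * m3" "a4 E = 0" "a6 E = 0"
    by (simp_all add: E_def kubert_curve_def a_def h_def m2_def m3_def)
  have QQ: "ec_add E Q Q = Infinity" and Q6: "Q \<noteq> Infinity" "on_curve E Q" "elliptic_curve E"
      "Q \<noteq> Affine (\<tau> * a^5 * m3) (\<tau>^2 * a^6 * m3^2)"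
    using ord kubert_multiples(7)[OF nz] unfolding order_2_12_def E_def[symmetric]
    by (auto simp: numeral_2_eq_2 one_mordell_weil mult_mordell_weil a_def m3_def E_def)
  obtain x y where Q: "Q = Affine x y" using Q6 by (cases Q) auto
  have t: "2 * y + a1 E * x + a3 E = 0" using QQ unfolding Q mult_2 by (auto split: if_splits simp: Let_def)
  define B where "B = (12 * \<tau>^4 - 20 * \<tau>^3 + 10 * \<tau>^2 - 1) * h * m2"
  define q where "q = 4 * x^2 + B * x - \<tau> * a^5 * h^2 * m3 * m2^2"
  have "(x - \<tau> * a^5 * m3) * q = 0"
    using kubert_factor[of x \<tau>, folded E_def a_def h_def m2_def m3_def] two_torsion_cubic[OF _ t] Q6(2)
    unfolding Q q_def B_def by simp
  moreover have "x \<noteq> \<tau> * a^5 * m3"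
  proof
    assume x: "x = \<tau> * a^5 * m3"
    have "2 * (\<tau>^2 * a^6 * m3^2) + a1 E * (\<tau> * a^5 * m3) + a3 E = 0"
      unfolding E a_def h_def m2_def m3_def by algebra
    then have "2 * y = 2 * (\<tau>^2 * a^6 * m3^2)" using t unfolding x by algebra
    then have "y = \<tau>^2 * a^6 * m3^2" by simp
    with x Q6(4) show False unfolding Q by simp
  qed
  ultimately have q: "q = 0" by simp
  have sq: "(8 * x + B)^2 = h^6 * m2^3 * m6"
  proof -
    have "(8 * x + B)^2 = 16 * q + B^2 + 16 * \<tau> * a^5 * h^2 * m3 * m2^2" unfolding q_def by algebra
    also have "\<dots> = h^6 * m2^3 * m6" unfolding q B_def a_def h_def m2_def m3_def m6_def by algebra
    finally show ?thesis .
  qed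
  have "m6 \<noteq> 0"
  proof
    assume "m6 = 0"
    then have 0: "8 * x + B = 0" using sq by simp
    \<comment> \<open>With \<open>m6 = 0\<close> the cofactor has a double root at \<open>x\<close>.
      Differentiating the factored cubic shows that both partial derivatives vanish at
      \<open>Q\<close>, so the curve would be singular.\<close>
    have "4 * (3 * x^2 + 2 * a2 E * x + a4 E - a1 E * y) + 2 * a1 E * (2 * y + a1 E * x + a3 E) =
        q + (x - \<tau> * a^5 * m3) * (8 * x + B)"
      unfolding q_def B_def E unfolding a_def h_def m2_def m3_def by algebra
    then have "4 * (3 * x^2 + 2 * a2 E * x + a4 E - a1 E * y) = 0" unfolding t 0 q by simp
    then have "3 * x^2 + 2 * a2 E * x + a4 E - a1 E * y = 0" unfolding mult_eq_0_iff by simp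
    with elliptic_curve_nonsingular[OF Q6(3) _ t] Q6(2) show False unfolding Q by simp
  qed
  moreover have "(2 * (8 * x + B) / (h^3 * m2))^2 = 4 * m2 * m6"
    unfolding power_divide power_mult_distrib sq using nz' by (simp add: field_simps eval_nat_numeral)
  ultimately show ?thesis unfolding m2_def m6_def by blast
qed

text \<open>Each cuspidal value of \<open>s\<close> forces a degenerate parameter: 0 gives
  \<open>\<tau> = 1\<close>; -1 and the roots of \<open>s^2 - s + 1\<close> give
  \<open>3 * \<tau>^2 - 3 * \<tau> + 1 = 0\<close>. The roots of \<open>s^2 + 1\<close> give
  \<open>\<tau> = 1 / 2\<close> or \<open>2 * \<tau>^2 - 2 * \<tau> + 1 = 0\<close>, and those of
  \<open>s^2 - 4 * s + 1\<close> give infinite \<tau> or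
  \<open>6 * \<tau>^2 - 6 * \<tau> + 1 = 0\<close>.\<close>

lemma quartic_to_X12:
  fixes \<tau> W :: "'a::field_char_0"
  assumes nz: "\<tau> \<noteq> 0" "\<tau> - 1 \<noteq> 0" "2 * \<tau> - 1 \<noteq> 0" "2 * \<tau>^2 - 2 * \<tau> + 1 \<noteq> 0" "3 * \<tau>^2 - 3 * \<tau> + 1 \<noteq> 0"
      "6 * \<tau>^2 - 6 * \<tau> + 1 \<noteq> 0"
    and W: "W^2 = 4 * (2 * \<tau>^2 - 2 * \<tau> + 1) * (6 * \<tau>^2 - 6 * \<tau> + 1)"
  shows "\<exists>s t :: 'a. on_curve X12 (Affine s t) \<and> \<not> cusp_abscissa s"
proof -
  \<comment> \<open>The quartic takes the square value 4 at \<open>\<tau> = 0\<close>, and inversion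
    moves this point to infinity, making the leading coefficient a square. With
    \<open>w = W * u^2\<close> one has \<open>w^2 - (2 * u^2 + 4 * u + 1)^2 = 4 * u + 2\<close>;
    \<open>s - 1\<close> is the factor \<open>w + 2 * u^2 + 4 * u + 1\<close> of the left side, and
    \<open>t\<close> completes the square in \<open>2 * u * (s - 1)\<close>.\<close>
  define u where "u = - 1 / (2 * \<tau>)"
  define s where "s = W * u^2 + 2 * u^2 + 4 * u + 2"
  define t where "t = 2 * u * (s - 1) + 2 * s - 1"
  have u: "2 * u * \<tau> = - 1" using nz by (simp add: u_def)
  have Wu: "(W * u^2)^2 = 4 * u^4 + 16 * u^3 + 20 * u^2 + 12 * u + 3"
  proof -
    have "4 * (W * u^2)^2 = 4 * (2 * u^2 * (2 * \<tau>^2 - 2 * \<tau> + 1)) * (2 * u^2 * (6 * \<tau>^2 - 6 * \<tau> + 1))"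
      unfolding power_mult_distrib W by algebra
    also have "2 * u^2 * (2 * \<tau>^2 - 2 * \<tau> + 1) = 1 + 2 * u + 2 * u^2" using u by algebra
    also have "2 * u^2 * (6 * \<tau>^2 - 6 * \<tau> + 1) = 3 + 6 * u + 2 * u^2" using u by algebra
    also have "4 * (1 + 2 * u + 2 * u^2) * (3 + 6 * u + 2 * u^2) = 4 * (4 * u^4 + 16 * u^3 + 20 * u^2 + 12 * u + 3)"
      by algebra
    finally show ?thesis by (simp only: mult_left_cancel[OF zero_neq_numeral[symmetric]])
  qed
  have st: "t^2 = s^3 - s^2 + s" using Wu unfolding t_def s_def by algebra
  have s1: "s \<noteq> 1"
  proof
    assume "s = 1"
    then have "W * u^2 = - (2 * u^2 + 4 * u + 1)" unfolding s_def by algebra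
    with Wu have "(2 * u^2 + 4 * u + 1)^2 = 4 * u^4 + 16 * u^3 + 20 * u^2 + 12 * u + 3"
      by (metis power2_minus)
    then have "2 * (2 * u + 1) = 0" by algebra
    then have "2 * u = - 1" unfolding mult_eq_0_iff eq_neg_iff_add_eq_0 by simp
    with u nz show False by simp
  qed
  have \<tau>: "\<tau> * (t - 2 * s + 1) = 1 - s" using u unfolding t_def by algebra
  have "s \<noteq> 0"
  proof
    assume "s = 0"
    then have "t = 0" using st by simp
    with \<open>s = 0\<close> \<tau> nz show False by simp
  qed
  moreover have "s \<noteq> - 1"
  proof
    assume s: "s = - 1"
    have "(2 - 3 * \<tau>)^2 = \<tau>^2 * t^2" using \<tau> unfolding s by algebra
    then have "4 * (3 * \<tau>^2 - 3 * \<tau> + 1) = 0" using st unfolding s by algebra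
    with nz show False unfolding mult_eq_0_iff by simp
  qed
  moreover have "s^2 - s + 1 \<noteq> 0"
  proof
    assume s: "s^2 - s + 1 = 0"
    have "t^2 = s * (s^2 - s + 1)" using st by algebra
    then have "t = 0" using s by simp
    then have "3 * (3 * \<tau>^2 - 3 * \<tau> + 1) = 0" using \<tau> s by algebra
    with nz show False unfolding mult_eq_0_iff by simp
  qed
  moreover have "s^2 + 1 \<noteq> 0"
  proof
    assume s: "s^2 + 1 = 0"
    then have "(t - 1) * (t + 1) = 0" using st by algebra
    then consider "t = 1" | "t = - 1" by (auto simp: eq_neg_iff_add_eq_0)
    then show False
    proof cases
      case 1
      have "(2 * \<tau> - 1) * (1 - s) = 0" using \<tau> unfolding 1 by algebra
      then show False using nz s1 by simp
    next
      case 2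
      have "2 * (2 * \<tau>^2 - 2 * \<tau> + 1) = 0" using \<tau> s unfolding 2 by algebra
      then show False using nz unfolding mult_eq_0_iff by simp
    qed
  qed
  moreover have "s^2 - 4 * s + 1 \<noteq> 0"
  proof
    assume s: "s^2 - 4 * s + 1 = 0"
    then have "(t - (2 * s - 1)) * (t - (1 - 2 * s)) = 0" using st by algebra
    then consider "t = 2 * s - 1" | "t = 1 - 2 * s" unfolding mult_eq_0_iff right_minus_eq by blast
    then show False
    proof cases
      case 1
      then show False using \<tau> s1 by simp
    next
      case 2
      have "(2 * s - 1) * (6 * \<tau>^2 - 6 * \<tau> + 1) = 0" using \<tau> s unfolding 2 by algebra
      moreover have "2 * s - 1 \<noteq> 0"
      proof
        assume "2 * s - 1 = 0"
        then have "3 = (0 :: 'a)" using s by algebra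
        then show False by simp
      qed
      ultimately show False using nz by simp
    qed
  qed
  ultimately have "\<not> cusp_abscissa s" using s1 by (simp add: cusp_abscissa_def)
  then show ?thesis using st by (auto simp only: on_curve_X12)
qed

text \<open>This inverts the birational map: \<tau> and \<open>s\<close> determine \<open>u\<close>
  and \<open>W\<close>, and \<open>W\<close> is, up to known factors, the square root of the
  discriminant of the quadratic.\<close>

lemma X12_to_quadratic:
  fixes s t :: "'a::field_char_0"
  assumes on: "on_curve X12 (Affine s t)" and s1: "s \<noteq> 1" and \<tau>: "\<tau> * (t - 2 * s + 1) = 1 - s"
  defines "h \<equiv> 2 * \<tau> - 1" and "m2 \<equiv> 2 * \<tau>^2 - 2 * \<tau> + 1" and "m3 \<equiv> 3 * \<tau>^2 - 3 * \<tau> + 1"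
  shows "\<exists>x. 4 * x^2 + (12 * \<tau>^4 - 20 * \<tau>^3 + 10 * \<tau>^2 - 1) * h * m2 * x - \<tau> * (\<tau> - 1)^5 * h^2 * m3 * m2^2 = 0"
proof -
  define m6 where "m6 = 6 * \<tau>^2 - 6 * \<tau> + 1"
  define a where "a = \<tau> - 1"
  have \<tau>0: "\<tau> \<noteq> 0" using \<tau> s1 by auto
  define u where "u = - 1 / (2 * \<tau>)"
  have u: "2 * u * \<tau> = - 1" "u \<noteq> 0" using \<tau>0 by (simp_all add: u_def)
  have "2 * u * (s - 1) = (2 * u * \<tau>) * - (t - 2 * s + 1)" using \<tau> by algebra
  then have t: "t = 2 * u * (s - 1) + 2 * s - 1" unfolding u by (simp add: algebra_simps)
  define W where "W = (s - 2 * u^2 - 4 * u - 2) / u^2"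
  have Wu: "W * u^2 = s - 2 * u^2 - 4 * u - 2" using u by (simp add: W_def)
  have "(s - 1) * ((W * u^2)^2 - (4 * u^4 + 16 * u^3 + 20 * u^2 + 12 * u + 3)) = s^3 - s^2 + s - t^2"
    unfolding Wu t by algebra
  then have "(s - 1) * ((W * u^2)^2 - (4 * u^4 + 16 * u^3 + 20 * u^2 + 12 * u + 3)) = 0"
    using on unfolding on_curve_X12 by simp
  then have Wu2: "(W * u^2)^2 = 4 * u^4 + 16 * u^3 + 20 * u^2 + 12 * u + 3" using s1 by simp
  have W: "W^2 = 4 * m2 * m6"
  proof -
    have "16 * \<tau>^4 * u^4 = (2 * u * \<tau>)^4" by algebra
    then have 1: "16 * \<tau>^4 * u^4 = 1" unfolding u by simp
    have "W^2 = 16 * \<tau>^4 * u^4 * W^2" unfolding 1 by simp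
    also have "\<dots> = 16 * \<tau>^4 * (W * u^2)^2" by algebra
    also have "\<dots> = 4 * m2 * m6" unfolding Wu2 m2_def m6_def using u(1) by algebra
    finally show ?thesis .
  qed
  define B where "B = (12 * \<tau>^4 - 20 * \<tau>^3 + 10 * \<tau>^2 - 1) * h * m2"
  define x where "x = (h^3 * m2 * W / 2 - B) / 8"
  have "8 * x = h^3 * m2 * W / 2 - B" by (simp add: x_def)
  then have xB: "2 * (8 * x + B) = h^3 * m2 * W" by simp
  have "4 * (8 * x + B)^2 = (2 * (8 * x + B))^2" by algebra
  also have "\<dots> = h^6 * m2^2 * W^2" unfolding xB by algebra
  finally have "4 * (8 * x + B)^2 = 4 * (h^6 * m2^3 * m6)" unfolding W by (simp add: eval_nat_numeral ac_simps)
  then have sq: "(8 * x + B)^2 = h^6 * m2^3 * m6" by simp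
  have "16 * (4 * x^2 + B * x - \<tau> * a^5 * h^2 * m3 * m2^2) = (8 * x + B)^2 - (B^2 + 16 * \<tau> * a^5 * h^2 * m3 * m2^2)"
    by algebra
  also have "\<dots> = 0" unfolding sq unfolding B_def a_def h_def m2_def m3_def m6_def by algebra
  finally have "4 * x^2 + B * x - \<tau> * a^5 * h^2 * m3 * m2^2 = 0" unfolding mult_eq_0_iff by simp
  then show ?thesis unfolding B_def a_def by blast
qed

section \<open>Points of infinite order and isomorphism classes\<close>

lemma (in group) int_pow_mod:
  assumes "x \<in> carrier G" "x [^] (k::int) = \<one>"
  shows "x [^] (n mod k) = x [^] n"
proof -
  have "x [^] n = x [^] (k * (n div k) + n mod k)" by simp
  also have "\<dots> = x [^] (k * (n div k)) \<otimes> x [^] (n mod k)" by (rule int_pow_mult[OF assms(1)])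
  also have "x [^] (k * (n div k)) = \<one>"
    using int_pow_pow[OF assms(1), of k "n div k"] assms(2) by (simp add: int_pow_one)
  finally show ?thesis using assms(1) by simp
qed

text \<open>Exponents may be reduced modulo 2 and 12, so the two points define a homomorphism. Its
  kernel is trivial because representatives can be taken nonnegative, where the level structure
  applies.\<close>

lemma level_structure_subgroup:
  fixes E :: "'a::field_char_0 weierstrass"
  assumes E: "elliptic_curve E" and L: "level_structure 2 12 E Q P"
  shows "E \<in> elliptic_curves_2_12"
proof -
  let ?A = "integer_mod_group 2 \<times>\<times> integer_mod_group 12"
  let ?G = "mordell_weil E"
  interpret G: comm_group ?G by (rule comm_group_mordell_weil[OF E])
  interpret A: group ?A by (intro DirProd_group group_integer_mod_group)
  have PQ: "P \<in> carrier ?G" "Q \<in> carrier ?G" using L by (simp_all add: level_structure_def)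
  have rel: "P [^]\<^bsub>?G\<^esub> n \<otimes>\<^bsub>?G\<^esub> Q [^]\<^bsub>?G\<^esub> m = \<one>\<^bsub>?G\<^esub> \<longleftrightarrow> 2 dvd m \<and> 12 dvd n" for m n :: nat
    using L unfolding level_structure_def mult_mordell_weil one_mordell_weil by blast
  have "P [^]\<^bsub>?G\<^esub> (12::nat) = \<one>\<^bsub>?G\<^esub>" "Q [^]\<^bsub>?G\<^esub> (2::nat) = \<one>\<^bsub>?G\<^esub>"
    using rel[of 12 0] rel[of 0 2] PQ by simp_all
  then have ord: "P [^]\<^bsub>?G\<^esub> (12::int) = \<one>\<^bsub>?G\<^esub>" "Q [^]\<^bsub>?G\<^esub> (2::int) = \<one>\<^bsub>?G\<^esub>"
    using int_pow_int[of ?G P 12] int_pow_int[of ?G Q 2] by simp_all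
  note Pmod = G.int_pow_mod[OF PQ(1) ord(1)] and Qmod = G.int_pow_mod[OF PQ(2) ord(2)]
  define h where "h = (\<lambda>(i, j). P [^]\<^bsub>?G\<^esub> (j::int) \<otimes>\<^bsub>?G\<^esub> Q [^]\<^bsub>?G\<^esub> (i::int))"
  have car: "carrier ?A = {0..<2} \<times> {0..<12}"
    by (simp add: carrier_integer_mod_group)
  have mult: "(i, j) \<otimes>\<^bsub>?A\<^esub> (k, l) = ((i + k) mod 2, (j + l) mod 12)" for i j k l
    by (simp add: mult_integer_mod_group)
  have hclosed: "h x \<in> carrier ?G" for x using PQ by (simp add: h_def case_prod_beta)
  have hom: "h \<in> hom ?A ?G"
  proof (rule homI)
    fix x y assume "x \<in> carrier ?A" "y \<in> carrier ?A"
    obtain i j k l where xy: "x = (i, j)" "y = (k, l)" by (metis prod.exhaust)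
    have "h (x \<otimes>\<^bsub>?A\<^esub> y) = P [^]\<^bsub>?G\<^esub> (j + l) \<otimes>\<^bsub>?G\<^esub> Q [^]\<^bsub>?G\<^esub> (i + k)"
      unfolding xy mult h_def by (simp add: Pmod Qmod)
    also have "\<dots> = h x \<otimes>\<^bsub>?G\<^esub> h y"
      unfolding xy h_def using PQ by (simp add: G.int_pow_mult G.m_ac)
    finally show "h (x \<otimes>\<^bsub>?A\<^esub> y) = h x \<otimes>\<^bsub>?G\<^esub> h y" .
  qed (use hclosed in simp)
  interpret h: group_hom ?A ?G h by unfold_locales (rule hom)
  have inj: "inj_on h (carrier ?A)"
    unfolding h.inj_on_one_iff
  proof (intro allI impI)
    fix x assume x: "x \<in> carrier ?A" "h x = \<one>\<^bsub>?G\<^esub>"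
    from x(1) obtain m n :: nat where mn: "x = (int m, int n)" "m < 2" "n < 12"
      unfolding car by (auto elim!: nonneg_int_cases)
    have "2 dvd m \<and> 12 dvd n" using x(2) rel[of n m] unfolding mn h_def by (simp add: int_pow_int)
    then show "x = \<one>\<^bsub>?A\<^esub>" using mn by (auto dest!: dvd_imp_le)
  qed
  have "h \<in> iso ?A (?G\<lparr>carrier := h ` carrier ?A\<rparr>)"
    using hom inj by (auto simp: iso_def bij_betw_def hom_def)
  then have "?A \<cong> ?G\<lparr>carrier := h ` carrier ?A\<rparr>" by (auto simp: is_iso_def)
  then have "?G\<lparr>carrier := h ` carrier ?A\<rparr> \<cong> ?A" by (rule A.iso_sym)
  then have "has_subgroup_isomorphic_to ?G ?A"
    unfolding has_subgroup_isomorphic_to_def using h.img_is_subgroup by blast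
  then show ?thesis using E by (simp add: elliptic_curves_2_12_def)
qed

text \<open>Any member of an independent set has infinite order, by coefficients supported at it
  alone; conversely a single element of infinite order is an independent set.\<close>

lemma group_rank_ge_1_iff:
  assumes "comm_group G"
  shows "group_rank G \<ge> 1 \<longleftrightarrow> (\<exists>x\<in>carrier G. \<forall>n>0. x [^]\<^bsub>G\<^esub> (n::nat) \<noteq> \<one>\<^bsub>G\<^esub>)"
proof -
  interpret comm_group G by (rule assms)
  have fin1: "(\<Otimes>\<^bsub>G\<^esub>y\<in>{x}. y [^]\<^bsub>G\<^esub> c y) = x [^]\<^bsub>G\<^esub> c x" if "x \<in> carrier G" for x and c :: "'a \<Rightarrow> int"
    using that by (subst finprod_insert) auto
  have "group_rank G \<ge> 1 \<longleftrightarrow> (\<exists>S. int_independent G S \<and> S \<noteq> {})"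
  proof
    assume r: "group_rank G \<ge> 1"
    show "\<exists>S. int_independent G S \<and> S \<noteq> {}"
    proof (rule ccontr)
      assume "\<not> ?thesis"
      then have "group_rank G \<le> 0" unfolding group_rank_def by (intro Sup_least) (auto simp: zero_enat_def)
      with r show False by simp
    qed
  next
    assume "\<exists>S. int_independent G S \<and> S \<noteq> {}"
    then obtain S where S: "int_independent G S" "S \<noteq> {}" by blast
    then have "card S \<ge> 1" by (auto simp: int_independent_def Suc_le_eq card_gt_0_iff)
    then have "1 \<le> enat (card S)" by (simp add: one_enat_def)
    also have "\<dots> \<le> group_rank G" unfolding group_rank_def using S by (intro Sup_upper) blast
    finally show "group_rank G \<ge> 1" .
  qed
  also have "\<dots> \<longleftrightarrow> (\<exists>x\<in>carrier G. \<forall>n>0. x [^]\<^bsub>G\<^esub> (n::nat) \<noteq> \<one>\<^bsub>G\<^esub>)"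
  proof
    assume "\<exists>S. int_independent G S \<and> S \<noteq> {}"
    then obtain S x where S: "int_independent G S" "x \<in> S" by blast
    then have fin: "finite S" "S \<subseteq> carrier G" by (auto simp: int_independent_def)
    have "x [^]\<^bsub>G\<^esub> n \<noteq> \<one>\<^bsub>G\<^esub>" if "n > 0" for n :: nat
    proof
      assume n: "x [^]\<^bsub>G\<^esub> n = \<one>\<^bsub>G\<^esub>"
      define c where "c = (\<lambda>y. if y = x then int n else 0)"
      have "(\<Otimes>\<^bsub>G\<^esub>y\<in>S. y [^]\<^bsub>G\<^esub> c y) = (\<Otimes>\<^bsub>G\<^esub>y\<in>S. \<one>\<^bsub>G\<^esub>)"
        by (rule finprod_cong') (use fin n in \<open>auto simp: c_def int_pow_int\<close>)
      then have "c x = 0" using S by (simp add: int_independent_def)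
      with that show False by (simp add: c_def)
    qed
    then show "\<exists>x\<in>carrier G. \<forall>n>0. x [^]\<^bsub>G\<^esub> (n::nat) \<noteq> \<one>\<^bsub>G\<^esub>" using S fin by blast
  next
    assume "\<exists>x\<in>carrier G. \<forall>n>0. x [^]\<^bsub>G\<^esub> (n::nat) \<noteq> \<one>\<^bsub>G\<^esub>"
    then obtain x where x: "x \<in> carrier G" "\<And>n. n > 0 \<Longrightarrow> x [^]\<^bsub>G\<^esub> (n::nat) \<noteq> \<one>\<^bsub>G\<^esub>" by blast
    have "k = 0" if "x [^]\<^bsub>G\<^esub> k = \<one>\<^bsub>G\<^esub>" for k :: int
    proof (cases k rule: int_cases2)
      case (nonneg n)
      then show ?thesis using that x(2)[of n] by (cases "n = 0") (auto simp: int_pow_int)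
    next
      case (nonpos n)
      then have "inv\<^bsub>G\<^esub> (x [^]\<^bsub>G\<^esub> n) = \<one>\<^bsub>G\<^esub>" using that x(1) by (simp add: int_pow_neg int_pow_int)
      then have "x [^]\<^bsub>G\<^esub> n = \<one>\<^bsub>G\<^esub>" using x(1) by (metis inv_inv inv_one nat_pow_closed)
      then show ?thesis using x(2)[of n] nonpos by (cases "n = 0") auto
    qed
    then have "int_independent G {x}" unfolding int_independent_def using x(1) fin1 by auto
    then show "\<exists>S. int_independent G S \<and> S \<noteq> {}" by blast
  qed
  finally show ?thesis .
qed

section \<open>Infinitely many parameters\<close>

lemma infinite_X12_points:
  fixes P :: "'a::field_char_0 point"
  assumes P: "on_curve X12 P" "\<And>n. n > 0 \<Longrightarrow> P [^]\<^bsub>MW\<^esub> (n::nat) \<noteq> \<one>\<^bsub>MW\<^esub>"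
  shows "infinite {(s :: 'a, t). on_curve X12 (Affine s t)}"
proof
  assume fin: "finite {(s :: 'a, t). on_curve X12 (Affine s t)}"
  have Pc: "P \<in> carrier MW" using P by (simp add: carrier_mordell_weil)
  have "carrier MW \<subseteq> insert Infinity ((\<lambda>(s :: 'a, t). Affine s t) ` {(s, t). on_curve X12 (Affine s t)})"
  proof
    fix R :: "'a point" assume "R \<in> carrier MW"
    then show "R \<in> insert Infinity ((\<lambda>(s, t). Affine s t) ` {(s, t). on_curve X12 (Affine s t)})"
      by (cases R) (auto simp: carrier_mordell_weil simp del: on_curve.simps)
  qed
  with fin have "finite (carrier (MW :: 'a point monoid))" by (meson finite_imageI finite_insert finite_subset)
  moreover have "range (\<lambda>n::nat. P [^]\<^bsub>MW\<^esub> n) \<subseteq> carrier MW" using Pc by auto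
  ultimately have "\<not> inj (\<lambda>n::nat. P [^]\<^bsub>MW\<^esub> n)"
    by (meson finite_subset finite_imageD infinite_UNIV_nat)
  then obtain m n :: nat where "m < n" "P [^]\<^bsub>MW\<^esub> m = P [^]\<^bsub>MW\<^esub> n"
    unfolding inj_def by (metis nat_neq_iff)
  have "P [^]\<^bsub>MW\<^esub> m \<otimes>\<^bsub>MW\<^esub> P [^]\<^bsub>MW\<^esub> (n - m) = P [^]\<^bsub>MW\<^esub> n"
    using MW.nat_pow_mult[OF Pc, of m "n - m"] \<open>m < n\<close> by simp
  also note \<open>P [^]\<^bsub>MW\<^esub> m = P [^]\<^bsub>MW\<^esub> n\<close>[symmetric]
  finally have "P [^]\<^bsub>MW\<^esub> (n - m) = \<one>\<^bsub>MW\<^esub>" using Pc by simp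
  with P(2)[of "n - m"] \<open>m < n\<close> show False by simp
qed

lemma finite_line_X12: "finite {(s :: 'a::field_char_0, t). on_curve X12 (Affine s t) \<and> t = c * s + d}"
proof -
  define p :: "'a poly" where "p = [:- (d^2), 1 - 2 * c * d, - 1 - c^2, 1:]"
  have "p \<noteq> 0" by (simp add: p_def)
  then have "finite {s. poly p s = 0}" by (rule poly_roots_finite)
  moreover have "{(s, t). on_curve X12 (Affine s t) \<and> t = c * s + d} \<subseteq> (\<lambda>s. (s, c * s + d)) ` {s. poly p s = 0}"
    unfolding on_curve_X12 by (auto simp: p_def algebra_simps power2_eq_square power3_eq_cube)
  ultimately show ?thesis by (meson finite_imageI finite_subset)
qed

text \<open>The parameter is governed by the slope \<open>c\<close> of the line through the cusp
  \<open>(1, 1)\<close>, namely \<open>1 / \<tau> = 2 - c\<close>. Each such line contains finitely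
  many points of the curve, so infinitely many points give infinitely many slopes.\<close>

lemma infinite_slopes:
  assumes inf: "infinite {(s :: 'a::field_char_0, t). on_curve X12 (Affine s t)}"
  shows "infinite {c :: 'a. \<exists>s t. on_curve X12 (Affine s t) \<and> s \<noteq> 1 \<and> t = c * s + (1 - c)}" (is "infinite ?C")
proof
  assume "finite ?C"
  then have "finite (\<Union>c\<in>?C. {(s, t). on_curve X12 (Affine s t) \<and> t = c * s + (1 - c)})"
    using finite_line_X12 by (intro finite_UN_I) auto
  moreover have "{(s :: 'a, t). on_curve X12 (Affine s t)} \<subseteq>
      {(1, 1), (1, - 1)} \<union> (\<Union>c\<in>?C. {(s, t). on_curve X12 (Affine s t) \<and> t = c * s + (1 - c)})"
  proof
    fix p :: "'a \<times> 'a" assume "p \<in> {(s, t). on_curve X12 (Affine s t)}"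
    then obtain s t where p: "p = (s, t)" and on: "on_curve X12 (Affine s t)" by blast
    show "p \<in> {(1, 1), (1, - 1)} \<union> (\<Union>c\<in>?C. {(s, t). on_curve X12 (Affine s t) \<and> t = c * s + (1 - c)})"
    proof (cases "s = 1")
      case True
      then have "t^2 = 1" using on unfolding on_curve_X12 by simp
      then show ?thesis using True p by (auto simp: power2_eq_1_iff)
    next
      case False
      define c where "c = (t - 1) / (s - 1)"
      have "c * (s - 1) = t - 1" using False by (simp add: c_def)
      then have "t = c * s + (1 - c)" by (simp add: algebra_simps)
      then show ?thesis using on False p by blast
    qed
  qed
  ultimately show False using inf by (meson finite.emptyI finite.insertI finite_UnI finite_subset)
qed

definition bad_parameter :: "'a::field_char_0 \<Rightarrow> bool" where
  "bad_parameter \<tau> \<longleftrightarrow> \<tau> * (\<tau> - 1) * (2 * \<tau> - 1) * (2 * \<tau>^2 - 2 * \<tau> + 1) * (3 * \<tau>^2 - 3 * \<tau> + 1) *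
     discr (kubert_curve \<tau>) = 0"

lemma finite_bad_parameter: "finite {\<tau> :: 'a::field_char_0. bad_parameter \<tau>}"
  unfolding bad_parameter_def
proof (rule polyfun_finite_roots)
  let ?g = "\<lambda>\<tau> :: 'a. \<tau> * (\<tau> - 1) * (2 * \<tau> - 1) * (2 * \<tau>^2 - 2 * \<tau> + 1) * (3 * \<tau>^2 - 3 * \<tau> + 1) *
     discr (kubert_curve \<tau>)"
  show "polyfun ?g" unfolding kubert_unfold by (intro polyfun_intros)
  show "?g 2 \<noteq> 0" unfolding kubert_unfold by simp
qed

lemma X12_point_kubert:
  fixes s t :: "'a::field_char_0"
  assumes "on_curve X12 (Affine s t)" "s \<noteq> 1" "\<tau> * (t - 2 * s + 1) = 1 - s" "\<not> bad_parameter \<tau>"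
  shows "kubert_curve \<tau> \<in> elliptic_curves_2_12"
proof -
  obtain x where x: "4 * x^2 + (12 * \<tau>^4 - 20 * \<tau>^3 + 10 * \<tau>^2 - 1) * (2 * \<tau> - 1) * (2 * \<tau>^2 - 2 * \<tau> + 1) * x
      - \<tau> * (\<tau> - 1)^5 * (2 * \<tau> - 1)^2 * (3 * \<tau>^2 - 3 * \<tau> + 1) * (2 * \<tau>^2 - 2 * \<tau> + 1)^2 = 0"
    using X12_to_quadratic[OF assms(1-3)] by blast
  define y where "y = - (a1 (kubert_curve \<tau>) * x + a3 (kubert_curve \<tau>)) / 2"
  have y: "2 * y + a1 (kubert_curve \<tau>) * x + a3 (kubert_curve \<tau>) = 0"
    unfolding y_def by (simp add: field_simps)
  show ?thesis
    by (rule level_structure_subgroup[OF _ kubert_level_structure[OF _ _ _ _ _ x y]])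
      (use assms(4) in \<open>auto simp: bad_parameter_def elliptic_curve_def\<close>)
qed

section \<open>Isomorphism classes\<close>

lemma ec_isom_class_j_inv:
  fixes E :: "'a::field_char_0 weierstrass"
  assumes "ec_isom `` {E} = ec_isom `` {E'}"
  shows "j_inv E = j_inv E'"
proof -
  have "ec_change E' E' 1 0 0 0" by (simp add: ec_change_def)
  then have "(E', E') \<in> ec_isom" unfolding ec_isom_iff by blast
  then have "(E, E') \<in> ec_isom" using assms by blast
  then show ?thesis unfolding ec_isom_iff using j_inv_ec_change by blast
qed

text \<open>If there were finitely many classes, infinitely many parameters would share one, hence
  one j-invariant; but a fixed j-invariant is a nontrivial polynomial condition on \<tau>.\<close>

lemma infinite_kubert_classes:
  fixes T :: "'a::field_char_0 set"
  assumes T: "infinite T" "\<And>\<tau>. \<tau> \<in> T \<Longrightarrow> kubert_curve \<tau> \<in> A" "\<And>\<tau>. \<tau> \<in> T \<Longrightarrow> elliptic_curve (kubert_curve \<tau>)"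
  shows "infinite (A // ec_isom)"
proof
  assume fin: "finite (A // ec_isom)"
  define g where "g = (\<lambda>\<tau> :: 'a. ec_isom `` {kubert_curve \<tau>})"
  have "g ` T \<subseteq> A // ec_isom" using T(2) by (auto simp: g_def intro: quotientI)
  with fin have "finite (g ` T)" by (rule rev_finite_subset)
  then obtain \<tau>0 where \<tau>0: "infinite {\<tau> \<in> T. g \<tau> = g \<tau>0}" using pigeonhole_infinite[OF T(1)] by blast
  define f where "f = (\<lambda>\<tau> :: 'a. c4 (kubert_curve \<tau>)^3 - j_inv (kubert_curve \<tau>0) * discr (kubert_curve \<tau>))"
  have "{\<tau> \<in> T. g \<tau> = g \<tau>0} \<subseteq> {\<tau>. f \<tau> = 0}"
  proof
    fix \<tau> assume "\<tau> \<in> {\<tau> \<in> T. g \<tau> = g \<tau>0}"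
    then have "j_inv (kubert_curve \<tau>0) = j_inv (kubert_curve \<tau>)" "discr (kubert_curve \<tau>) \<noteq> 0"
      using ec_isom_class_j_inv T(3) unfolding g_def elliptic_curve_def by auto
    then show "\<tau> \<in> {\<tau>. f \<tau> = 0}" by (simp add: f_def j_inv_def)
  qed
  moreover have "finite {\<tau>. f \<tau> = 0}"
  proof (rule polyfun_finite_roots)
    define j where "j = j_inv (kubert_curve \<tau>0)"
    show "polyfun f" unfolding f_def j_def[symmetric] kubert_unfold by (intro polyfun_intros)
    \<comment> \<open>At \<open>\<tau> = 0\<close> the curve is a nodal cubic with
      \<open>c4 = 1\<close> and discriminant 0, so the value is 1 for every
      \<open>j\<close>.\<close>
    show "f 0 \<noteq> 0" unfolding f_def j_def[symmetric] kubert_unfold by simp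
  qed
  ultimately show False using \<tau>0 finite_subset by blast
qed

lemma rank_imp_infinite:
  assumes "group_rank (MW :: 'a::field_char_0 point monoid) \<ge> 1"
  shows "infinite ((elliptic_curves_2_12 :: 'a weierstrass set) // ec_isom)"
proof -
  obtain P :: "'a point" where P: "on_curve X12 P" "\<And>n. n > 0 \<Longrightarrow> P [^]\<^bsub>MW\<^esub> (n::nat) \<noteq> \<one>\<^bsub>MW\<^esub>"
    using assms unfolding group_rank_ge_1_iff[OF MW.comm_group_axioms] by (auto simp: carrier_mordell_weil)
  define C where "C = {c :: 'a. \<exists>s t. on_curve X12 (Affine s t) \<and> s \<noteq> 1 \<and> t = c * s + (1 - c)}"
  have "infinite C" unfolding C_def by (rule infinite_slopes[OF infinite_X12_points[OF P]])
  \<comment> \<open>The slope 2 corresponds to an infinite parameter and is left out.\<close>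
  define T where "T = (\<lambda>c. 1 / (2 - c)) ` (C - {2}) - {\<tau>. bad_parameter \<tau>}"
  have "inj_on (\<lambda>c :: 'a. 1 / (2 - c)) (C - {2})" by (auto intro!: inj_onI simp: field_simps)
  then have "infinite T"
    unfolding T_def using \<open>infinite C\<close> finite_bad_parameter
    by (metis Diff_infinite_finite finite.emptyI finite.insertI finite_imageD)
  moreover have "kubert_curve \<tau> \<in> elliptic_curves_2_12" if "\<tau> \<in> T" for \<tau>
  proof -
    obtain c s t where c: "on_curve X12 (Affine s t)" "s \<noteq> 1" "t = c * s + (1 - c)" "c \<noteq> 2" "\<tau> = 1 / (2 - c)"
      and bad: "\<not> bad_parameter \<tau>"
      using \<open>\<tau> \<in> T\<close> unfolding T_def C_def by auto
    have "\<tau> * (2 - c) = 1" using c(4) by (simp add: c(5))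
    moreover have "\<tau> * (t - 2 * s + 1) = (\<tau> * (2 - c)) * (1 - s)" unfolding c(3) by algebra
    ultimately have "\<tau> * (t - 2 * s + 1) = 1 - s" by simp
    from X12_point_kubert[OF c(1,2) this bad] show ?thesis .
  qed
  moreover from this have "elliptic_curve (kubert_curve \<tau>)" if "\<tau> \<in> T" for \<tau>
    using that by (simp add: elliptic_curves_2_12_def)
  ultimately show ?thesis by (rule infinite_kubert_classes)
qed

lemma curve_imp_rank:
  fixes E :: "'k::field_char_0 weierstrass"
  assumes K: "multi_quadratic_field TYPE('k)" and E: "E \<in> elliptic_curves_2_12"
  shows "group_rank (MW :: 'k point monoid) \<ge> 1"
proof -
  obtain E' :: "'k weierstrass" and Q where "order_2_12 E' (Affine 0 0) Q" "a4 E' = 0" "a6 E' = 0" "a2 E' = a3 E'" "a3 E' \<noteq> 0"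
    using subgroup_order_2_12[OF E] order_2_12_tangent by blast
  then obtain \<tau> :: 'k and Q where ord: "order_2_12 (kubert_curve \<tau>) (Affine 0 0) Q"
    and nz: "\<tau> \<noteq> 0" "\<tau> - 1 \<noteq> 0" "2 * \<tau> - 1 \<noteq> 0" "2 * \<tau>^2 - 2 * \<tau> + 1 \<noteq> 0" "3 * \<tau>^2 - 3 * \<tau> + 1 \<noteq> 0"
    using order_2_12_kubert by blast
  then obtain s t :: 'k where st: "on_curve X12 (Affine s t)" "\<not> cusp_abscissa s"
    using order_2_12_kubert_quadratic[OF nz ord] quartic_to_X12[OF nz] by blast
  then have "Affine s t [^]\<^bsub>MW\<^esub> n \<noteq> \<one>\<^bsub>MW\<^esub>" if "n > 0" for n :: nat
    using torsion_cusp[OF K st(1) that] by auto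
  moreover have "Affine s t \<in> carrier MW" using st(1) by (simp only: carrier_mordell_weil mem_Collect_eq)
  ultimately show ?thesis unfolding group_rank_ge_1_iff[OF MW.comm_group_axioms] by blast
qed

theorem theorem5p10:
  assumes "multi_quadratic_field TYPE('k::field_char_0)"
  shows "((\<exists>E :: 'k weierstrass. E \<in> elliptic_curves_2_12) \<longleftrightarrow>
            infinite ((elliptic_curves_2_12 :: 'k weierstrass set) // ec_isom)) \<and>
         (infinite ((elliptic_curves_2_12 :: 'k weierstrass set) // ec_isom) \<longleftrightarrow>
            group_rank (mordell_weil (base_change J1_2_12 :: 'k weierstrass)) \<ge> 1)"
proof -
  have "\<exists>E :: 'k weierstrass. E \<in> elliptic_curves_2_12"
    if "infinite ((elliptic_curves_2_12 :: 'k weierstrass set) // ec_isom)"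
    using that by (metis all_not_in_conv finite.emptyI quotient_empty)
  then show ?thesis using curve_imp_rank[OF assms] rank_imp_infinite[where 'a = 'k] by blast
qed

end
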